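(* Let $(X,d,\sigma)$ be a compatible metric-topological space with $(X,d)$ complete, let $\phi:X\to(-\infty,\infty]$ be proper and satisfy the LSCC assumptions with coercivity constant $\mathsf B$, and let $\varepsilon>0$ with $\frac1{16\varepsilon}>\mathsf B$. Then, for every $\bar u\in D(V_\varepsilon)$, every $u_\varepsilon\in\mathcal M_\varepsilon(\bar u)$ is a curve of maximal slope for $V_\varepsilon$ with respect to the ($L^1$-moderated) upper gradient $G_\varepsilon$.
   Context: **Setting.** $(X,d)$ is a complete metric space and $\sigma$ is a Hausdorff topology on $X$; $(X,d,\sigma)$ is called compatible if (MT1) $u_n\to u$ and $v_n\to v$ in $\sigma$ imply $\liminf_n d(u_n,v_n)\ge d(u,v)$; (MT2) for every $\sigma$-open set $U$ and $x\in U$ there exist a $\sigma$-open neighborhood $V$ of $x$ and $\delta>0$ such that $d(y,V)<\delta$ implies $y\in U$, where $d(y,V)=\inf_{v\in V}d(y,v)$. For an interval $I\subset\mathbb R$ and $p\in[1,\infty]$, $AC^p(I;X)$ is the set of curves $u:I\to X$ for which there is $m\in L^p(I)$ with $d(u(s),u(t))\le\int_s^t m(r)\,dr$ for all $s\le t$ in $I$; $AC=AC^1$; $AC^p_{\rm loc}(I;X)$ is the set of curves belonging to $AC^p(J;X)$ for every compact interval $J\subset I$. The metric derivative $|u'|(t)=\lim_{s\to t}\frac{d(u(s),u(t))}{|t-s|}$ exists for a.e. $t\in I$. **LSCC assumptions.** $\phi:X\to(-\infty,\infty]$ is proper, and: (Lower semicontinuity) if $\sup_{n,m}d(u_n,u_m)<\infty$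 and $u_n\to u$ in $\sigma$, then $\liminf_n\phi(u_n)\ge\phi(u)$; (Compactness) every sequence with $\sup_n\phi(u_n)<\infty$ and $\sup_{n,m}d(u_n,u_m)<\infty$ has a $\sigma$-convergent subsequence; (Coercivity) there are $u_*\in X$ and constants $\mathsf A,\mathsf B\ge0$ such that $\phi(u)\ge-\mathsf B\,d^2(u,v)-\mathsf Q(v)$ for all $u,v\in X$, where $\mathsf Q(v)=\mathsf B\,d^2(v,u_* )+\mathsf A$. **WED functional and value function.** $\mu_\varepsilon$ is the probability measure on $(0,\infty)$ with density $\frac1\varepsilon e^{-t/\varepsilon}$; $\mathcal I_\varepsilon[u]=\int_0^\infty\big(\frac\varepsilon2|u'|^2+\phi(u)\big)\,d\mu_\varepsilon$ for $u\in\mathscr C_\varepsilon(x)=\{u\in AC^2_{\rm loc}([0,\infty);X): u(0)=x,\ \int_0^\infty|u'|^2\,d\mu_\varepsilon<\infty\}$; $\mathcal M_\varepsilon(x)$ is the set of minimizers of $\mathcal I_\varepsilon$ in $\mathscr C_\varepsilon(x)$. The value function is $V_\varepsilon(x)=\inf_{u\in\mathscr C_\varepsilon(x)}\mathcal I_\varepsilon[u]$, $D(V_\varepsilon)=\{V_\varepsilon<\infty\}$. Set $G_\varepsilon(x)=\sqrt{2(\phi(x)-V_\varepsilon(x))/\varepsilon}$ if $x\in D(V_\varepsilon)$ and $G_\varepsilon(x)=\infty$ otherwise. **Upper gradients and curves of maximal slope.** For $p\in[1,\infty]$ and $\psi:X\to(-\infty,\infty]$, $g:X\to[0,\infty]$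 is an $L^p$-moderated upper gradient for $\psi$ if for every curve $u\in AC(I;X)$ with $\psi\circ u\in L^p(I;|u'|\mathscr L^1)$ and $g\circ u\in L^1(I;|u'|\mathscr L^1)$ one has $|\psi(u(t))-\psi(u(s))|\le\int_s^t g(u(r))|u'|(r)\,dr$ for all $s\le t$ in $I$. A curve $u\in AC^2_{\rm loc}([0,\infty);X)$ is a curve of maximal slope for $\psi$ with respect to $g$ if $\psi\circ u$ is locally bounded on $[0,\infty)$ and $-(\psi\circ u)'(t)=|u'|^2(t)=g^2(u(t))$ for a.e. $t\in(0,\infty)$. *)

theory Defs
  imports "HOL-Analysis.Analysis"
begin

section \<open>Compatible metric-topological spaces\<close>

text \<open>The metric is that of the type class; \<open>\<sigma>\<close> is a second topology on the same points.\<close>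

definition compatible_topology :: "'a::metric_space topology \<Rightarrow> bool" where
  "compatible_topology \<sigma> \<longleftrightarrow>
     topspace \<sigma> = UNIV \<and> Hausdorff_space \<sigma> \<and>
     (\<forall>x y u v. limitin \<sigma> x u sequentially \<longrightarrow> limitin \<sigma> y v sequentially \<longrightarrow>
        ereal (dist u v) \<le> liminf (\<lambda>n. ereal (dist (x n) (y n)))) \<and>
     (\<forall>U x. openin \<sigma> U \<longrightarrow> x \<in> U \<longrightarrow>
        (\<exists>V \<delta>. openin \<sigma> V \<and> x \<in> V \<and> \<delta> > 0 \<and> (\<forall>y. infdist y V < \<delta> \<longrightarrow> y \<in> U)))"

section \<open>The energy\<close>

definition proper_fun :: "('a \<Rightarrow> ereal) \<Rightarrow> bool" where
  "proper_fun \<phi> \<longleftrightarrow> (\<forall>x. \<phi> x \<noteq> -\<infinity>) \<and> (\<exists>x. \<phi> x < \<infinity>)"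

definition LSCC_lsc :: "'a::metric_space topology \<Rightarrow> ('a \<Rightarrow> ereal) \<Rightarrow> bool" where
  "LSCC_lsc \<sigma> \<phi> \<longleftrightarrow>
     (\<forall>x u. bounded (range x) \<longrightarrow> limitin \<sigma> x u sequentially \<longrightarrow>
        \<phi> u \<le> liminf (\<lambda>n. \<phi> (x n)))"

definition LSCC_compact :: "'a::metric_space topology \<Rightarrow> ('a \<Rightarrow> ereal) \<Rightarrow> bool" where
  "LSCC_compact \<sigma> \<phi> \<longleftrightarrow>
     (\<forall>x :: nat \<Rightarrow> 'a. (SUP n. \<phi> (x n)) < \<infinity> \<longrightarrow> bounded (range x) \<longrightarrow>
        (\<exists>(r :: nat \<Rightarrow> nat) u. strict_mono r \<and> limitin \<sigma> (x \<circ> r) u sequentially))"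

definition LSCC_coercive :: "('a::metric_space \<Rightarrow> ereal) \<Rightarrow> 'a \<Rightarrow> real \<Rightarrow> real \<Rightarrow> bool" where
  "LSCC_coercive \<phi> u0 A B \<longleftrightarrow> A \<ge> 0 \<and> B \<ge> 0 \<and>
     (\<forall>u v. \<phi> u \<ge> ereal (- B * (dist u v)\<^sup>2 - (B * (dist v u0)\<^sup>2 + A)))"

definition LSCC :: "'a::metric_space topology \<Rightarrow> ('a \<Rightarrow> ereal) \<Rightarrow> 'a \<Rightarrow> real \<Rightarrow> real \<Rightarrow> bool" where
  "LSCC \<sigma> \<phi> u0 A B \<longleftrightarrow>
     proper_fun \<phi> \<and> LSCC_lsc \<sigma> \<phi> \<and> LSCC_compact \<sigma> \<phi> \<and> LSCC_coercive \<phi> u0 A B"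

section \<open>Lebesgue spaces and integrals of extended-real functions\<close>

text \<open>Membership in \<open>L\<^sup>p\<close> for \<open>1 \<le> p \<le> \<infinity>\<close>; an extended-real member must be finite almost everywhere.\<close>

definition Lp :: "ennreal \<Rightarrow> 'b measure \<Rightarrow> ('b \<Rightarrow> ereal) \<Rightarrow> bool" where
  "Lp p M f \<longleftrightarrow> f \<in> borel_measurable M \<and> (AE x in M. \<bar>f x\<bar> \<noteq> \<infinity>) \<and>
     (if p = \<infinity> then \<exists>C::real. AE x in M. \<bar>f x\<bar> \<le> ereal C
      else (\<integral>\<^sup>+ x. ennreal (\<bar>real_of_ereal (f x)\<bar> powr enn2real p) \<partial>M) < \<infinity>)"

text \<open>Positive part minus negative part. Should both be infinite, the value is \<open>\<infinity>\<close>,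
  by the convention of \<^typ>\<open>ereal\<close>; under the coercivity condition with
  \<open>B < 1 / (16 \<epsilon>)\<close> the negative part below is always finite.\<close>

definition ext_integral :: "'b measure \<Rightarrow> ('b \<Rightarrow> ereal) \<Rightarrow> ereal" where
  "ext_integral M f =
     enn2ereal (\<integral>\<^sup>+ x. e2ennreal (f x) \<partial>M) - enn2ereal (\<integral>\<^sup>+ x. e2ennreal (- f x) \<partial>M)"

section \<open>Absolutely continuous curves\<close>

text \<open>A curve on an interval \<open>I\<close> is a total function on the reals whose values off \<open>I\<close>
  are ignored; hence limits at points of \<open>I\<close> are taken within \<open>I\<close>.\<close>

definition AC :: "ennreal \<Rightarrow> real set \<Rightarrow> (real \<Rightarrow> 'a::metric_space) set" where
  "AC p I = {u. \<exists>m::real \<Rightarrow> real. Lp p (lebesgue_on I) (\<lambda>r. ereal (m r)) \<and>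
     (\<forall>s\<in>I. \<forall>t\<in>I. s \<le> t \<longrightarrow> dist (u s) (u t) \<le> (LINT r:{s..t}|lebesgue. m r))}"

definition AC_loc :: "ennreal \<Rightarrow> real set \<Rightarrow> (real \<Rightarrow> 'a::metric_space) set" where
  "AC_loc p I = {u. \<forall>a b. a \<le> b \<longrightarrow> {a..b} \<subseteq> I \<longrightarrow> u \<in> AC p {a..b}}"

text \<open>Unspecified where the limit does not exist, which for the curves considered happens
  only on a null set.\<close>

definition metric_deriv :: "real set \<Rightarrow> (real \<Rightarrow> 'a::metric_space) \<Rightarrow> real \<Rightarrow> real" where
  "metric_deriv I u t = Lim (at t within I) (\<lambda>s. dist (u s) (u t) / \<bar>t - s\<bar>)"

section \<open>The WED functional and its value function\<close>

definition wed_measure :: "real \<Rightarrow> real measure" where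
  "wed_measure \<epsilon> = density (lebesgue_on {0<..}) (\<lambda>t. ennreal (exp (- t / \<epsilon>) / \<epsilon>))"

definition wed_functional :: "('a::metric_space \<Rightarrow> ereal) \<Rightarrow> real \<Rightarrow> (real \<Rightarrow> 'a) \<Rightarrow> ereal" where
  "wed_functional \<phi> \<epsilon> u =
     ext_integral (wed_measure \<epsilon>) (\<lambda>t. ereal (\<epsilon> / 2 * (metric_deriv {0..} u t)\<^sup>2) + \<phi> (u t))"

definition wed_curves :: "real \<Rightarrow> 'a::metric_space \<Rightarrow> (real \<Rightarrow> 'a) set" where
  "wed_curves \<epsilon> x = {u \<in> AC_loc 2 {0..}. u 0 = x \<and>
     (\<integral>\<^sup>+ t. ennreal ((metric_deriv {0..} u t)\<^sup>2) \<partial>wed_measure \<epsilon>) < \<infinity>}"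

definition wed_minimizers ::
    "('a::metric_space \<Rightarrow> ereal) \<Rightarrow> real \<Rightarrow> 'a \<Rightarrow> (real \<Rightarrow> 'a) set" where
  "wed_minimizers \<phi> \<epsilon> x =
     {u \<in> wed_curves \<epsilon> x. \<forall>v \<in> wed_curves \<epsilon> x. wed_functional \<phi> \<epsilon> u \<le> wed_functional \<phi> \<epsilon> v}"

definition value_fun :: "('a::metric_space \<Rightarrow> ereal) \<Rightarrow> real \<Rightarrow> 'a \<Rightarrow> ereal" where
  "value_fun \<phi> \<epsilon> x = (INF u \<in> wed_curves \<epsilon> x. wed_functional \<phi> \<epsilon> u)"

definition value_dom :: "('a::metric_space \<Rightarrow> ereal) \<Rightarrow> real \<Rightarrow> 'a set" where
  "value_dom \<phi> \<epsilon> = {x. value_fun \<phi> \<epsilon> x < \<infinity>}"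

definition sqrt_ennreal :: "ennreal \<Rightarrow> ennreal" where
  "sqrt_ennreal x = (if x = \<infinity> then \<infinity> else ennreal (sqrt (enn2real x)))"

text \<open>The truncation of negative arguments by \<^const>\<open>e2ennreal\<close> is harmless:
  constant curves are competitors, so the value function never exceeds \<open>\<phi>\<close>.\<close>

definition value_slope :: "('a::metric_space \<Rightarrow> ereal) \<Rightarrow> real \<Rightarrow> 'a \<Rightarrow> ennreal" where
  "value_slope \<phi> \<epsilon> x =
     (if x \<in> value_dom \<phi> \<epsilon>
      then sqrt_ennreal (e2ennreal (2 * (\<phi> x - value_fun \<phi> \<epsilon> x) / ereal \<epsilon>))
      else \<infinity>)"

section \<open>Upper gradients and curves of maximal slope\<close>

definition speed_measure :: "real set \<Rightarrow> (real \<Rightarrow> 'a::metric_space) \<Rightarrow> real measure" where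
  "speed_measure I u = density (lebesgue_on I) (\<lambda>t. ennreal (metric_deriv I u t))"

text \<open>The estimate of \<open>\<bar>\<psi> (u t) - \<psi> (u s)\<bar>\<close> is written as two inequalities free of
  subtraction: if both values are \<open>\<infinity>\<close> (as on a constant curve outside the domain of \<open>\<psi>\<close>)
  the difference counts as \<open>0\<close>, whereas \<open>\<infinity> - \<infinity> = \<infinity>\<close> in \<^typ>\<open>ereal\<close>.
  The product in the integral obeys \<open>\<infinity> \<cdot> 0 = 0\<close>.\<close>

definition moderated_upper_gradient ::
    "ennreal \<Rightarrow> ('a::metric_space \<Rightarrow> ereal) \<Rightarrow> ('a \<Rightarrow> ennreal) \<Rightarrow> bool" where
  "moderated_upper_gradient p \<psi> g \<longleftrightarrow> (\<forall>x. \<psi> x \<noteq> -\<infinity>) \<and>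
     (\<forall>I u. is_interval I \<longrightarrow> u \<in> AC 1 I \<longrightarrow>
        Lp p (speed_measure I u) (\<lambda>t. \<psi> (u t)) \<longrightarrow>
        Lp 1 (speed_measure I u) (\<lambda>t. enn2ereal (g (u t))) \<longrightarrow>
        (\<forall>s\<in>I. \<forall>t\<in>I. s \<le> t \<longrightarrow>
           (let L = enn2ereal (\<integral>\<^sup>+ r\<in>{s..t}. (g (u r) * ennreal (metric_deriv I u r)) \<partial>lebesgue)
            in \<psi> (u t) \<le> \<psi> (u s) + L \<and> \<psi> (u s) \<le> \<psi> (u t) + L)))"

definition curve_of_maximal_slope ::
    "('a::metric_space \<Rightarrow> ereal) \<Rightarrow> ('a \<Rightarrow> ennreal) \<Rightarrow> (real \<Rightarrow> 'a) \<Rightarrow> bool" where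
  "curve_of_maximal_slope \<psi> g u \<longleftrightarrow>
     u \<in> AC_loc 2 {0..} \<and>
     (\<forall>T\<ge>0. \<exists>C::real. \<forall>t\<in>{0..T}. \<bar>\<psi> (u t)\<bar> \<le> ereal C) \<and>
     (AE t in lebesgue_on {0<..}.
        ((\<lambda>s. real_of_ereal (\<psi> (u s))) has_real_derivative - (metric_deriv {0..} u t)\<^sup>2) (at t) \<and>
        ennreal ((metric_deriv {0..} u t)\<^sup>2) = (g (u t))\<^sup>2)"

end

theory Submission
  imports Defs
begin

text \<open>Write \<open>V\<close> for the value function, \<open>G = sqrt (2 (\<phi> - V) / \<epsilon>)\<close> for the candidate slope, and measure the
cost of a curve by its action, the integral of \<open>exp (- t / \<epsilon>) (\<bar>u'\<bar>\<^sup>2 / 2 + \<phi>(u) / \<epsilon>)\<close>. The corollary follows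
from two statements about \<open>V\<close>, neither of which differentiates \<open>V\<close> in space.

The first is dynamic programming. Running along a curve \<open>y\<close> until time \<open>T\<close> and continuing with an almost
optimal curve from \<open>y T\<close> is admissible for \<open>y 0\<close>, so \<open>V (y 0)\<close> is at most the action of \<open>y\<close> on \<open>[0, T]\<close>
plus \<open>exp (- T / \<epsilon>) V (y T)\<close> (lemma \<open>dynamic_programming\<close>). Along a minimizer this is an equality
(lemma \<open>value_fun_along_optimal_curve\<close>), because the tail of a minimizer is again a competitor.

The second is the upper gradient inequality, obtained by choosing in dynamic programming the best speed
along a given path. Per unit of length, travelling with speed \<open>\<nu>\<close> costs \<open>\<nu> / 2 + \<phi> / (\<epsilon> \<nu>)\<close>, while the
discount returns \<open>V / (\<epsilon> \<nu>)\<close>; since \<open>\<phi> - V = \<epsilon> G\<^sup>2 / 2\<close>, the balance is \<open>(\<nu> + G\<^sup>2 / \<nu>) / 2\<close>, which is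
minimal, with value \<open>G\<close>, at \<open>\<nu> = G\<close>. Only the integrability of \<open>G\<close> along the path, not that of
\<open>G\<^sup>2\<close>, is available, so the speed has to follow \<open>G\<close> pointwise; the required
reparametrization with a merely measurable speed is \<open>monotone_time_change\<close>. Speeds are bounded below by
some \<open>\<delta> > 0\<close>, and the variation of \<open>V\<close> over a short piece of the path is absorbed into the left-hand side
(lemma \<open>value_fun_slope_bound_truncated\<close>); short pieces are then put together and \<open>\<delta>\<close> tends to \<open>0\<close>. The
reversed path gives the opposite inequality.

For a minimizer \<open>u\<close>, differentiating the dynamic programming identity yields
\<open>(V \<circ> u)' = - (G(u)\<^sup>2 + \<bar>u'\<bar>\<^sup>2) / 2\<close> almost everywhere, and the upper gradient inequality yields
\<open>(V \<circ> u)' \<ge> - G(u) \<bar>u'\<bar>\<close>. Together \<open>(G(u) - \<bar>u'\<bar>)\<^sup>2 \<le> 0\<close>, hence \<open>G(u) = \<bar>u'\<bar>\<close> and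
\<open>(V \<circ> u)' = - \<bar>u'\<bar>\<^sup>2\<close> (lemma \<open>optimal_curve_slope\<close>).

The analytic groundwork consists of the metric derivative theorem (lemma \<open>metric_deriv_speed\<close>), of the
measurability of \<open>\<phi>\<close> along curves, which holds because metric convergence implies convergence in \<open>\<sigma>\<close> and
\<open>\<phi>\<close> is thus lower semicontinuous for the metric, and of a Hardy inequality (lemma
\<open>Hardy_exponential\<close>), which lets the kinetic term of the action dominate the quadratic lower bound of
\<open>\<phi>\<close>, so that \<open>V\<close> never takes the value \<open>- \<infinity>\<close>.\<close>

section \<open>Real functions with an integrable speed bound\<close>

lemma AE_lborel_reflect:
  fixes P :: "real \<Rightarrow> bool"
  assumes "AE x in lborel. P x"
  shows "AE x in lborel. P (- x)"
proof (rule AE_distrD[where f = uminus and M' = borel])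
  show "uminus \<in> measurable lborel borel" by simp
  show "AE x in distr lborel borel uminus. P x"
    by (subst lborel_distr_uminus) (rule assms)
qed

lemma AE_lborel_not_in_negligible:
  assumes "negligible N"
  shows "AE x in lborel. x \<notin> N"
proof -
  have "AE x in lebesgue. x \<notin> N"
    unfolding eventually_ae_filter_negligible using assms by (intro exI[of _ N]) auto
  then show ?thesis by (simp add: AE_completion_iff)
qed

text \<open>The averages over \<open>[x, x + h]\<close> converge to \<open>f x\<close> almost everywhere, which is the right derivative; the same
statement for the reflected integrand supplies the left one.\<close>

lemma indefinite_integral_differentiable_ae:
  fixes f :: "real \<Rightarrow> real"
  assumes f: "f integrable_on {a..b}"
  shows "AE t in lborel. t \<in> {a<..<b} \<longrightarrow> ((\<lambda>x. integral {a..x} f) has_real_derivative f t) (at t)"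
proof -
  define F where "F = (\<lambda>x. if x \<in> {a..b} then f x else 0)"
  have Fint: "F integrable_on S" if "S = cbox c d" for S c d
  proof -
    have "F integrable_on UNIV"
      using f unfolding F_def by (simp only: integrable_restrict_UNIV)
    then show ?thesis
      using that integrable_on_subcbox by blast
  qed
  have Fint': "(\<lambda>x. F (- x)) integrable_on cbox c d" for c d
  proof -
    have "(\<lambda>x. F (- x)) integrable_on {- (-c).. - (-d)}"
      unfolding Henstock_Kurzweil_Integration.integrable_reflect_real by (rule Fint[of _ "-d" "-c"]) simp
    then show ?thesis by simp
  qed
  from integrable_ccontinuous_explicit[of F, OF Fint[OF refl]]
  obtain N1 where N1: "negligible N1" "\<And>x e. x \<notin> N1 \<Longrightarrow> 0 < e \<Longrightarrow>
     \<exists>d>0. \<forall>h. 0 < h \<and> h < d \<longrightarrow> norm (integral (cbox x (x + h *\<^sub>R One)) F /\<^sub>R h ^ DIM(real) - F x) < e"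
    by blast
  from integrable_ccontinuous_explicit[of "\<lambda>x. F (- x)", OF Fint']
  obtain N2 where N2: "negligible N2" "\<And>x e. x \<notin> N2 \<Longrightarrow> 0 < e \<Longrightarrow>
     \<exists>d>0. \<forall>h. 0 < h \<and> h < d \<longrightarrow>
        norm (integral (cbox x (x + h *\<^sub>R One)) (\<lambda>x. F (- x)) /\<^sub>R h ^ DIM(real) - F (- x)) < e"
    by blast
  have "AE t in lborel. - t \<notin> N2"
    using AE_lborel_reflect[OF AE_lborel_not_in_negligible[OF N2(1)]] .
  with AE_lborel_not_in_negligible[OF N1(1)] show ?thesis
  proof (eventually_elim, intro impI)
    fix t assume t1: "t \<notin> N1" and t2: "- t \<notin> N2" and "t \<in> {a<..<b}"
    then have tab: "a < t" "t < b" by auto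
    have Ft: "F t = f t"
      using tab by (simp add: F_def)
    have "\<exists>d>0. \<forall>h. h \<noteq> 0 \<and> norm (h - 0) < d \<longrightarrow>
       norm ((integral {a..t + h} f - integral {a..t} f) / h - f t) < e" if e: "e > 0" for e
    proof -
      obtain d1 where d1: "d1 > 0" "\<And>h. 0 < h \<Longrightarrow> h < d1 \<Longrightarrow> norm (integral {t..t + h} F / h - f t) < e"
        using N1(2)[OF t1 e] by (auto simp: Ft divide_inverse mult.commute)
      obtain d2 where d2: "d2 > 0" "\<And>h. 0 < h \<Longrightarrow> h < d2 \<Longrightarrow>
           norm (integral {- t..- t + h} (\<lambda>x. F (- x)) / h - f t) < e"
        using N2(2)[OF t2 e] by (auto simp: Ft divide_inverse mult.commute)
      define d where "d = Min {d1, d2, t - a, b - t}"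
      have "d > 0" using d1 d2 tab by (simp add: d_def)
      have dle: "d \<le> d1" "d \<le> d2" "d \<le> t - a" "d \<le> b - t"
        by (simp_all add: d_def)
      have "norm ((integral {a..t + h} f - integral {a..t} f) / h - f t) < e"
        if h: "h \<noteq> 0" "\<bar>h\<bar> < d" for h
      proof (cases "h > 0")
        case True
        have "integral {a..t} f + integral {t..t+h} f = integral {a..t+h} f"
          by (rule Henstock_Kurzweil_Integration.integral_combine)
            (use True h tab dle in \<open>auto intro: integrable_subinterval_real[OF f]\<close>)
        moreover have "integral {t..t+h} f = integral {t..t+h} F"
          by (rule integral_cong) (use True h tab dle in \<open>auto simp: F_def\<close>)
        ultimately have *: "integral {t..t+h} F = integral {a..t + h} f - integral {a..t} f"
          by simp
        show ?thesis
          using d1(2)[of h] True h dle unfolding * by simp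
      next
        case False
        then have h0: "h < 0" using h by simp
        have "integral {a..t+h} f + integral {t+h..t} f = integral {a..t} f"
          by (rule Henstock_Kurzweil_Integration.integral_combine)
            (use h0 h tab dle in \<open>auto intro: integrable_subinterval_real[OF f]\<close>)
        moreover have "integral {t+h..t} f = integral {t+h..t} F"
          by (rule integral_cong) (use h0 h tab dle in \<open>auto simp: F_def\<close>)
        moreover have "integral {- t..- (t + h)} (\<lambda>x. F (- x)) = integral {t+h..t} F"
          by (rule Henstock_Kurzweil_Integration.integral_reflect_real)
        ultimately have *: "integral {- t..- t + - h} (\<lambda>x. F (- x)) = integral {a..t} f - integral {a..t+h} f"
          by (simp add: algebra_simps)
        show ?thesis
          using d2(2)[of "-h"] h0 h dle unfolding * by (simp add: field_simps)
      qed
      with \<open>d > 0\<close> show ?thesis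
        by (intro exI[of _ d]) auto
    qed
    then show "((\<lambda>x. integral {a..x} f) has_real_derivative f t) (at t)"
      unfolding DERIV_def by (intro LIM_I) auto
  qed
qed

lemma AE_has_derivative_if_has_integral:
  fixes f g :: "real \<Rightarrow> real"
  assumes fg: "\<And>t. a \<le> t \<Longrightarrow> t \<le> b \<Longrightarrow> (g has_integral (f t - f a)) {a..t}"
  shows "AE t in lborel. t \<in> {a<..<b} \<longrightarrow> (f has_real_derivative g t) (at t)"
proof (cases "a < b")
  case True
  then have "g integrable_on {a..b}"
    using fg[of b] by auto
  from indefinite_integral_differentiable_ae[OF this] show ?thesis
  proof (eventually_elim, intro impI)
    fix t assume "t \<in> {a<..<b} \<longrightarrow> ((\<lambda>x. integral {a..x} g) has_real_derivative g t) (at t)"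
      and t: "t \<in> {a<..<b}"
    then have "((\<lambda>x. integral {a..x} g + f a) has_real_derivative g t) (at t)"
      by (auto intro!: derivative_eq_intros)
    then show "(f has_real_derivative g t) (at t)"
    proof (rule DERIV_cong_ev[THEN iffD1, rotated 3, OF _ refl _ refl])
      have "\<forall>\<^sub>F x in nhds t. x \<in> {a<..<b}"
        using t by (intro eventually_nhds_in_open) auto
      then show "\<forall>\<^sub>F x in nhds t. integral {a..x} g + f a = f x"
        by eventually_elim (use integral_unique[OF fg] in auto)
    qed
  qed
qed auto

text \<open>Half-open intervals suit the comparison with \<^const>\<open>interval_measure\<close>, whose values are known on these
sets, and unlike rays they have finite measure.\<close>

lemma measure_eqI_Ioc:
  fixes M N :: "real measure"
  assumes sets: "sets M = sets borel" "sets N = sets borel"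
    and eq: "\<And>x y. x \<le> y \<Longrightarrow> emeasure M {x<..y} = emeasure N {x<..y}"
    and fin: "\<And>x y. x \<le> y \<Longrightarrow> emeasure M {x<..y} \<noteq> \<infinity>"
  shows "M = N"
proof (rule measure_eqI_generator_eq_countable)
  let ?E = "range (\<lambda>(x, y). {x<..y::real})"
  let ?A = "(\<lambda>(x, y). {x<..y::real}) ` (\<rat> \<times> \<rat>)"
  show "Int_stable ?E"
    by (auto simp: Int_stable_def)
  show "?E \<subseteq> Pow UNIV" by auto
  show "sets M = sigma_sets UNIV ?E" "sets N = sigma_sets UNIV ?E"
    unfolding sets borel_sigma_sets_Ioc by auto
  have "emeasure M {x<..y} = emeasure N {x<..y}" for x y
    using eq[of x y] by (cases "x \<le> y") auto
  then show "X \<in> ?E \<Longrightarrow> emeasure M X = emeasure N X" for X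
    by auto
  have "emeasure M {x<..y} \<noteq> \<infinity>" for x y
    using fin[of x y] by (cases "x \<le> y") auto
  then show "a \<in> ?A \<Longrightarrow> emeasure M a \<noteq> \<infinity>" for a
    by auto
  show "?A \<subseteq> ?E" by auto
  show "\<Union> ?A = UNIV"
  proof (intro set_eqI iffI UNIV_I)
    fix z :: real
    obtain x y where "x \<in> \<rat>" "x < z" "y \<in> \<rat>" "z \<le> y"
      using Rats_no_bot_less[of z] Rats_no_top_le[of z] by blast
    then show "z \<in> \<Union> ?A" by force
  qed
  show "countable ?A"
    by (intro countable_image countable_SIGMA countable_rat)
qed

text \<open>With a primitive \<open>P\<close> of \<open>m\<close>, both \<open>P + f\<close> and \<open>P - f\<close> are nondecreasing, and their Stieltjes measures add up
to the measure with density \<open>2 m\<close>. Hence the Stieltjes measure of \<open>P + f\<close> is absolutely continuous, and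
its Radon-Nikodym density minus \<open>m\<close> is a density for \<open>f\<close>.\<close>

lemma real_function_has_density:
  fixes f m :: "real \<Rightarrow> real"
  assumes m_borel[measurable]: "m \<in> borel_measurable borel" and m_nonneg: "\<And>x. 0 \<le> m x"
    and m_int: "m integrable_on UNIV"
    and bound: "\<And>s t. s \<le> t \<Longrightarrow> \<bar>f t - f s\<bar> \<le> integral {s..t} m"
  obtains g where "\<And>s t. s \<le> t \<Longrightarrow> (g has_integral (f t - f s)) {s..t}"
proof -
  have m_abs: "m absolutely_integrable_on UNIV"
    using m_int m_nonneg by (simp add: nonnegative_absolutely_integrable_1)
  have m_on: "m integrable_on S" if "S \<in> sets lebesgue" for S
    using set_integrable_subset[OF m_abs that] by (simp add: absolutely_integrable_on_def)
  define P where "P t = integral {..t} m" for t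
  have P_diff: "P t - P s = integral {s..t} m" if "s \<le> t" for s t
  proof -
    have "integral ({..s} \<union> {s..t}) m = integral {..s} m + integral {s..t} m"
    proof (rule integral_Un)
      have "{..s} \<inter> {s..t} \<subseteq> {s}" by auto
      then show "negligible ({..s} \<inter> {s..t})"
        using negligible_subset negligible_sing by blast
    qed (auto intro: m_on)
    moreover have "{..s} \<union> {s..t} = {..t}" using that by auto
    ultimately show ?thesis by (simp add: P_def)
  qed
  have P_cont: "isCont P a" for a
  proof -
    have "continuous_on {a-1..a+1} (\<lambda>x. P (a - 1) + integral {a-1..x} m)"
      by (intro continuous_intros indefinite_integral_continuous_1 m_on) simp
    then have "continuous_on {a-1..a+1} P"
      by (rule continuous_on_cong[THEN iffD1, rotated 2]) (auto simp: P_diff[symmetric])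
    then show ?thesis
      using continuous_on_interior[of "{a-1..a+1}" P a] by auto
  qed
  have abs_f: "\<bar>f t - f s\<bar> \<le> \<bar>P t - P s\<bar>" for s t
    using bound[of s t] bound[of t s] P_diff[of s t] P_diff[of t s]
    by (cases "s \<le> t") (auto simp: abs_minus_commute)
  have f_cont: "isCont f a" for a
  proof -
    have "((\<lambda>x. P x - P a) \<longlongrightarrow> 0) (at a)"
      using P_cont[of a] by (simp add: isCont_def LIM_zero_iff)
    then have "((\<lambda>x. f x - f a) \<longlongrightarrow> 0) (at a)"
      by (rule Lim_null_comparison[rotated, OF tendsto_rabs_zero])
        (use abs_f in \<open>auto intro: always_eventually\<close>)
    then show ?thesis by (simp add: isCont_def LIM_zero_iff)
  qed
  define F where "F t = P t + f t" for t
  define H where "H t = P t - f t" for t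
  have mono: "F s \<le> F t" "H s \<le> H t" if "s \<le> t" for s t
    using bound[OF that] P_diff[OF that] by (auto simp: F_def H_def)
  have "isCont F a" "isCont H a" for a
    unfolding F_def H_def by (intro isCont_add isCont_diff P_cont f_cont)+
  then have cont: "continuous (at_right a) F" "continuous (at_right a) H" for a
    by (simp_all add: continuous_at_imp_continuous_at_within)
  define \<nu> where "\<nu> = density lborel (\<lambda>x. ennreal (2 * m x))"
  have \<nu>_Ioc: "emeasure \<nu> {x<..y} = ennreal (2 * (P y - P x))" if "x \<le> y" for x y
  proof -
    have "((\<lambda>x. 2 * m x) has_integral (2 * (P y - P x))) {x<..y}"
    proof (intro has_integral_mult_right)
      have "(m has_integral (P y - P x)) {x..y}"
        using m_on[of "{x..y}"] by (simp add: P_diff[OF that] integrable_integral)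
      moreover have "negligible {z \<in> {x..y} - {x<..y}. m z \<noteq> 0}" "negligible {z \<in> {x<..y} - {x..y}. m z \<noteq> 0}"
        by (auto intro: negligible_subset[of "{x}"])
      ultimately show "(m has_integral (P y - P x)) {x<..y}"
        using has_integral_spike_set_eq by blast
    qed
    then show ?thesis
      unfolding \<nu>_def
      by (subst emeasure_density) (auto intro!: nn_integral_has_integral_lebesgue' simp: m_nonneg)
  qed
  define K where "K = measure_of UNIV (sets borel)
     (\<lambda>A. emeasure (interval_measure F) A + emeasure (interval_measure H) A)"
  have sets_K: "sets K = sets borel"
    using sets.sets_measure_of_eq[of borel] by (simp add: K_def)
  have K: "emeasure K A = emeasure (interval_measure F) A + emeasure (interval_measure H) A"
    if "A \<in> sets borel" for A
  proof (rule emeasure_measure_of[OF K_def])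
    show "countably_additive (sets K) (\<lambda>A. emeasure (interval_measure F) A + emeasure (interval_measure H) A)"
    proof (rule countably_additiveI)
      fix A :: "nat \<Rightarrow> real set" assume A: "range A \<subseteq> sets K" "disjoint_family A"
      then have r: "range A \<subseteq> sets (interval_measure F)" "range A \<subseteq> sets (interval_measure H)"
        by (auto simp: sets_K)
      show "(\<Sum>i. emeasure (interval_measure F) (A i) + emeasure (interval_measure H) (A i)) =
        emeasure (interval_measure F) (\<Union> (range A)) + emeasure (interval_measure H) (\<Union> (range A))"
        using suminf_emeasure[OF r(1) A(2)] suminf_emeasure[OF r(2) A(2)]
        by (subst suminf_add[symmetric]) auto
    qed
    show "A \<in> sets K"
      using that by (simp add: sets_K)
  qed (auto simp: positive_def)
  have "K = \<nu>"
  proof (rule measure_eqI_Ioc)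
    show "sets K = sets borel" by (rule sets_K)
    show "sets \<nu> = sets borel" by (simp add: \<nu>_def)
    fix x y :: real assume xy: "x \<le> y"
    have "emeasure K {x<..y} = ennreal (F y - F x) + ennreal (H y - H x)"
      using mono cont xy by (simp add: K emeasure_interval_measure_Ioc)
    also have "\<dots> = ennreal (2 * (P y - P x))"
      using mono[OF xy] by (simp add: F_def H_def flip: ennreal_plus)
    finally show "emeasure K {x<..y} = emeasure \<nu> {x<..y}" "emeasure K {x<..y} \<noteq> \<infinity>"
      using \<nu>_Ioc[OF xy] by auto
  qed
  have ac: "absolutely_continuous lborel (interval_measure F)"
    unfolding absolutely_continuous_def
  proof
    fix N :: "real set" assume N: "N \<in> null_sets lborel"
    then have Nb: "N \<in> sets borel" by auto
    have "AE x in lborel. x \<in> N \<longrightarrow> ennreal (2 * m x) = 0"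
      using AE_not_in[OF N] by eventually_elim auto
    then have "N \<in> null_sets \<nu>"
      unfolding \<nu>_def using Nb by (subst null_sets_density_iff) auto
    then have "emeasure \<nu> N = 0" by auto
    then have "emeasure (interval_measure F) N = 0"
      using K[OF Nb] \<open>K = \<nu>\<close> by simp
    then show "N \<in> null_sets (interval_measure F)"
      using Nb by auto
  qed
  from sigma_finite_measure.Radon_Nikodym[OF sigma_finite_lborel ac]
  obtain h where h[measurable]: "h \<in> borel_measurable borel" and hF: "density lborel h = interval_measure F"
    by auto
  have h_Ioc: "(\<integral>\<^sup>+ z. h z * indicator {x<..y} z \<partial>lborel) = ennreal (F y - F x)" if "x \<le> y" for x y
  proof -
    have "emeasure (interval_measure F) {x<..y} = ennreal (F y - F x)"
      by (rule emeasure_interval_measure_Ioc) (use that mono cont in auto)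
    then show ?thesis
      unfolding hF[symmetric] by (subst (asm) emeasure_density) auto
  qed
  define g0 where "g0 z = enn2real (h z)" for z
  have g0: "(g0 has_integral (F y - F x)) {x..y}" if "x \<le> y" for x y
  proof -
    have "AE z in lborel. h z * indicator {x<..y} z \<noteq> \<infinity>"
      by (rule nn_integral_PInf_AE) (use h_Ioc[OF that] in auto)
    then have "AE z in lborel. h z * indicator {x<..y} z = ennreal (g0 z * indicator {x<..y} z)"
      by eventually_elim (auto simp: g0_def indicator_def less_top)
    then have "(\<integral>\<^sup>+ z. ennreal (g0 z * indicator {x<..y} z) \<partial>lborel) = ennreal (F y - F x)"
      using h_Ioc[OF that] nn_integral_cong_AE by fastforce
    then have "((\<lambda>z. g0 z * indicator {x<..y} z) has_integral (F y - F x)) UNIV"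
      using mono(1)[OF that] by (intro nn_integral_has_integral) (auto simp: g0_def[abs_def])
    then have "((\<lambda>z. if z \<in> {x<..y} then g0 z else 0) has_integral (F y - F x)) UNIV"
      by (rule has_integral_eq[rotated]) (auto simp: indicator_def)
    then have "(g0 has_integral (F y - F x)) {x<..y}"
      by (simp only: has_integral_restrict_UNIV)
    moreover have "negligible {z \<in> {x..y} - {x<..y}. g0 z \<noteq> 0}" "negligible {z \<in> {x<..y} - {x..y}. g0 z \<noteq> 0}"
      by (auto intro: negligible_subset[of "{x}"])
    ultimately show ?thesis
      using has_integral_spike_set_eq by blast
  qed
  show ?thesis
  proof (rule that)
    fix s t :: real assume st: "s \<le> t"
    have "(m has_integral (P t - P s)) {s..t}"
      using m_on[of "{s..t}"] by (simp add: P_diff[OF st] integrable_integral)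
    from has_integral_diff[OF g0[OF st] this]
    show "((\<lambda>z. g0 z - m z) has_integral (f t - f s)) {s..t}"
      by (simp add: F_def algebra_simps)
  qed
qed

section \<open>The metric derivative\<close>

text \<open>Stated for a symmetric \<open>D\<close> so as to cover both the distance along a curve and the increment of a real function.\<close>

lemma difference_quotient_mono:
  fixes D :: "real \<Rightarrow> real \<Rightarrow> real" and G :: "real \<Rightarrow> real"
  assumes D: "\<And>x y. a \<le> x \<Longrightarrow> x \<le> y \<Longrightarrow> y \<le> b \<Longrightarrow> D x y \<le> G y - G x"
    and sym: "D s t = D t s" and st: "s \<in> {a..b}" "t \<in> {a..b}"
  shows "D s t / \<bar>t - s\<bar> \<le> (G s - G t) / (s - t)"
proof -
  consider "s < t" | "s = t" | "s > t" by linarith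
  then show ?thesis
  proof cases
    case 1
    have "D s t / (t - s) \<le> (G t - G s) / (t - s)"
      using 1 st by (intro divide_right_mono D) auto
    also have "\<dots> = (G s - G t) / (s - t)"
      by (metis minus_diff_eq minus_divide_divide)
    finally show ?thesis using 1 by simp
  next
    case 3
    have "D t s / (s - t) \<le> (G s - G t) / (s - t)"
      using 3 st by (intro divide_right_mono D) auto
    then show ?thesis using 3 sym by simp
  qed auto
qed

text \<open>The distances \<open>f q\<close> to the points \<open>u q\<close> with rational \<open>q\<close> are real functions with densities \<open>h q\<close>, and by
continuity of \<open>u\<close> they determine all distances along the curve. The supremum \<open>g\<close> of the densities is therefore
an admissible speed. It is the limit of the difference quotients: each \<open>h q\<close> bounds their lower limit from
below, and as \<open>g\<close> is admissible, differentiating its integral bounds their upper limit from above.\<close>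

lemma metric_derivative_exists:
  fixes u :: "real \<Rightarrow> 'a::metric_space"
  assumes ab: "a \<le> b"
    and m_borel: "m \<in> borel_measurable borel" and m_nonneg: "\<And>x. 0 \<le> m x"
    and m_int: "m integrable_on UNIV"
    and bound: "\<And>s t. s \<le> t \<Longrightarrow> dist (u s) (u t) \<le> integral {s..t} m"
  obtains g where "g absolutely_integrable_on {a..b}"
    "\<And>t. \<bar>g t\<bar> \<le> m t"
    "\<And>s t. a \<le> s \<Longrightarrow> s \<le> t \<Longrightarrow> t \<le> b \<Longrightarrow> dist (u s) (u t) \<le> integral {s..t} g"
    "AE t in lborel. t \<in> {a<..<b} \<longrightarrow> ((\<lambda>s. dist (u s) (u t) / \<bar>t - s\<bar>) \<longlongrightarrow> g t) (at t)"
proof -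
  have m_abs: "m absolutely_integrable_on UNIV"
    using m_int m_nonneg by (simp add: nonnegative_absolutely_integrable_1)
  have m_on: "m absolutely_integrable_on S" if "S \<in> sets lebesgue" for S
    using set_integrable_subset[OF m_abs that] by simp
  have m_on': "m integrable_on {s..t}" for s t
    using m_on[of "{s..t}"] by (simp add: absolutely_integrable_on_def)
  define f where "f q t = dist (u t) (u q)" for q t
  have "\<exists>h. \<forall>s t. s \<le> t \<longrightarrow> (h has_integral (f q t - f q s)) {s..t}" for q
  proof -
    have "\<bar>f q t - f q s\<bar> \<le> integral {s..t} m" if "s \<le> t" for s t
    proof -
      have "\<bar>f q t - f q s\<bar> \<le> dist (u s) (u t)"
        unfolding f_def using dist_triangle[of "u t" "u q" "u s"] dist_triangle[of "u s" "u q" "u t"]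
        by (simp add: dist_commute)
      then show ?thesis using bound[OF that] by linarith
    qed
    then show ?thesis
      by (rule real_function_has_density[OF m_borel m_nonneg m_int]) blast+
  qed
  then obtain h where h: "\<And>q s t. s \<le> t \<Longrightarrow> (h q has_integral (f q t - f q s)) {s..t}"
    by metis
  have h_deriv: "AE t in lborel. t \<in> {a<..<b} \<longrightarrow> (f q has_real_derivative h q t) (at t)" for q
    by (rule AE_has_derivative_if_has_integral) (rule h)
  have m_deriv: "AE t in lborel. t \<in> {a<..<b} \<longrightarrow> ((\<lambda>x. integral {a..x} m) has_real_derivative m t) (at t)"
    by (rule indefinite_integral_differentiable_ae) (rule m_on')
  have h_le_m: "\<bar>h q t\<bar> \<le> m t"
    if t: "t \<in> {a<..<b}" and hq: "(f q has_real_derivative h q t) (at t)"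
      and mt: "((\<lambda>x. integral {a..x} m) has_real_derivative m t) (at t)" for q t
  proof (rule tendsto_le)
    show "((\<lambda>s. \<bar>(f q s - f q t) / (s - t)\<bar>) \<longlongrightarrow> \<bar>h q t\<bar>) (at t)"
      using hq by (intro tendsto_rabs) (simp add: has_field_derivative_iff)
    show "((\<lambda>s. (integral {a..s} m - integral {a..t} m) / (s - t)) \<longlongrightarrow> m t) (at t)"
      using mt by (simp add: has_field_derivative_iff)
    have "\<forall>\<^sub>F s in at t. s \<in> {a<..<b}"
      using t by (intro eventually_at_in_open') auto
    then show "\<forall>\<^sub>F s in at t. \<bar>(f q s - f q t) / (s - t)\<bar> \<le> (integral {a..s} m - integral {a..t} m) / (s - t)"
    proof eventually_elim
      case (elim s)
      have *: "\<bar>f q y - f q x\<bar> \<le> integral {a..y} m - integral {a..x} m"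
        if "a \<le> x" "x \<le> y" for x y
      proof -
        have "integral {a..x} m + integral {x..y} m = integral {a..y} m"
          using that by (intro Henstock_Kurzweil_Integration.integral_combine m_on') auto
        moreover have "\<bar>f q y - f q x\<bar> \<le> dist (u x) (u y)"
          unfolding f_def using dist_triangle[of "u x" "u q" "u y"] dist_triangle[of "u y" "u q" "u x"]
          by (simp add: dist_commute)
        ultimately show ?thesis using bound[OF that(2)] by linarith
      qed
      have "\<bar>f q t - f q s\<bar> / \<bar>t - s\<bar> \<le> (integral {a..s} m - integral {a..t} m) / (s - t)"
        by (rule difference_quotient_mono[where D = "\<lambda>x y. \<bar>f q y - f q x\<bar>" and a = a and b = b])
          (use * elim t in \<open>auto simp: abs_minus_commute\<close>)
      then show ?case
        by (simp add: abs_divide abs_minus_commute)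
    qed
  qed simp
  \<comment> \<open>The density \<open>h q\<close> is bounded by \<open>m\<close> only almost everywhere; the truncation, which changes it on a null
    set, makes the supremum finite at every point.\<close>
  define k where "k q t = max (- m t) (min (h q t) (m t))" for q t
  have k_bound: "\<bar>k q t\<bar> \<le> m t" for q t
    using m_nonneg[of t] by (auto simp: k_def)
  have bdd: "bdd_above ((\<lambda>q. k q t) ` \<rat>)" for t
    using k_bound by (intro bdd_aboveI[of _ "m t"]) (auto simp: abs_le_iff)
  define g where "g t = (SUP q\<in>\<rat>. k q t)" for t
  have Rats_ne: "(\<rat>::real set) \<noteq> {}" by (metis Rats_0 empty_iff)
  have k_le_g: "k q t \<le> g t" if "q \<in> \<rat>" for q t
    unfolding g_def by (rule cSUP_upper[OF that bdd])
  have g_le_m: "g t \<le> m t" for t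
    unfolding g_def using k_bound by (intro cSUP_least Rats_ne) (auto simp: abs_le_iff)
  have g_bound: "\<bar>g t\<bar> \<le> m t" for t
    using k_le_g[OF Rats_0, of t] k_bound[of 0 t] g_le_m[of t] by linarith
  have m_meas: "m \<in> borel_measurable (lebesgue_on {a..b})"
    using m_borel by (intro measurable_restrict_space1 measurable_completion) simp
  have h_meas: "h q \<in> borel_measurable (lebesgue_on {a..b})" for q
    using h[OF ab, of q] by (auto intro: integrable_imp_measurable)
  have g_meas: "g \<in> borel_measurable (lebesgue_on {a..b})"
    unfolding g_def
  proof (rule borel_measurable_cSUP)
    show "countable (\<rat>::real set)" by (rule countable_rat)
    show "k q \<in> borel_measurable (lebesgue_on {a..b})" for q
      unfolding k_def using m_meas h_meas by (intro borel_measurable_max borel_measurable_min) auto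
  qed (use bdd in auto)
  have g_abs: "g absolutely_integrable_on {a..b}"
    using g_meas m_on' g_bound
    by (intro measurable_bounded_by_integrable_imp_absolutely_integrable[where g = m]) auto
  have g_on: "g integrable_on {s..t}" if "a \<le> s" "t \<le> b" for s t
    by (rule integrable_subinterval_real[OF set_lebesgue_integral_eq_integral(1)[OF g_abs]])
      (use that in auto)
  have h_all: "AE t in lborel. \<forall>q\<in>\<rat>. t \<in> {a<..<b} \<longrightarrow> (f q has_real_derivative h q t) (at t)"
    by (rule AE_ball_countable'[OF h_deriv countable_rat])
  have k_eq_h: "AE t in lborel. \<forall>q\<in>\<rat>. t \<in> {a<..<b} \<longrightarrow> k q t = h q t"
    using h_all m_deriv
  proof eventually_elim
    case (elim t)
    then show ?case using h_le_m[of t] by (fastforce simp: k_def abs_le_iff)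
  qed
  \<comment> \<open>Continuity of \<open>u\<close> from the right suffices to approximate \<open>u s\<close> by points with rational parameters.\<close>
  have u_cont: "\<exists>q\<in>\<rat>. dist (u s) (u q) < e" if "e > 0" for s e
  proof -
    have "continuous_on {s..s+1} (\<lambda>x. integral {s..x} m)"
      by (intro indefinite_integral_continuous_1 m_on')
    then have "((\<lambda>x. integral {s..x} m) \<longlongrightarrow> integral {s..s} m) (at s within {s..s+1})"
      unfolding continuous_on_def by (rule bspec) simp
    then have "\<forall>\<^sub>F x in at s within {s..s+1}. integral {s..x} m < e"
      using order_tendstoD(2)[of _ 0 _ e] that by simp
    then obtain d where d: "d > 0" "\<And>x. x \<in> {s..s+1} \<Longrightarrow> x \<noteq> s \<Longrightarrow> dist x s < d \<Longrightarrow> integral {s..x} m < e"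
      unfolding eventually_at by blast
    obtain q where "q \<in> \<rat>" "s < q" "q < s + min d 1"
      using Rats_dense_in_real[of s "s + min d 1"] d(1) by auto
    then have "integral {s..q} m < e"
      by (intro d(2)) (auto simp: dist_real_def)
    then show ?thesis
      using bound[of s q] \<open>q \<in> \<rat>\<close> \<open>s < q\<close> by (intro bexI[of _ q]) auto
  qed
  have g_dist: "dist (u s) (u t) \<le> integral {s..t} g" if st: "a \<le> s" "s \<le> t" "t \<le> b" for s t
  proof (rule field_le_epsilon)
    fix e :: real assume e: "e > 0"
    then obtain q where q: "q \<in> \<rat>" "dist (u s) (u q) < e / 2"
      using u_cont[of "e/2" s] by auto
    have "f q t - f q s \<le> integral {s..t} g"
    proof -
      have "negligible {s, t}" by simp
      have ae: "AE x in lborel. x \<in> {s..t} \<longrightarrow> h q x = k q x"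
        using k_eq_h AE_lborel_singleton[of s] AE_lborel_singleton[of t]
        by eventually_elim (use st q in auto)
      have "(k q has_integral (f q t - f q s)) {s..t}"
        using h[of s t q] has_integral_AE[OF ae] st by auto
      moreover have "(g has_integral integral {s..t} g) {s..t}"
        using g_on st by (simp add: integrable_integral)
      ultimately show ?thesis
        by (rule has_integral_le) (rule k_le_g[OF q(1)])
    qed
    moreover have "dist (u s) (u t) \<le> f q t + dist (u s) (u q)"
      unfolding f_def using dist_triangle[of "u s" "u t" "u q"] by (simp add: dist_commute)
    ultimately show "dist (u s) (u t) \<le> integral {s..t} g + e"
      using q(2) by (simp add: f_def)
  qed
  have g_deriv: "AE t in lborel. t \<in> {a<..<b} \<longrightarrow> ((\<lambda>x. integral {a..x} g) has_real_derivative g t) (at t)"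
    by (rule indefinite_integral_differentiable_ae) (use g_on in auto)
  have "AE t in lborel. t \<in> {a<..<b} \<longrightarrow> ((\<lambda>s. dist (u s) (u t) / \<bar>t - s\<bar>) \<longlongrightarrow> g t) (at t)"
    using g_deriv h_all k_eq_h
  proof (eventually_elim, intro impI)
    fix t assume "t \<in> {a<..<b} \<longrightarrow> ((\<lambda>x. integral {a..x} g) has_real_derivative g t) (at t)"
      and hq: "\<forall>q\<in>\<rat>. t \<in> {a<..<b} \<longrightarrow> (f q has_real_derivative h q t) (at t)"
      and kh: "\<forall>q\<in>\<rat>. t \<in> {a<..<b} \<longrightarrow> k q t = h q t"
      and t: "t \<in> {a<..<b}"
    then have gt: "((\<lambda>s. (integral {a..s} g - integral {a..t} g) / (s - t)) \<longlongrightarrow> g t) (at t)"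
      by (simp add: has_field_derivative_iff)
    have ev: "\<forall>\<^sub>F s in at t. s \<in> {a<..<b}"
      using t by (intro eventually_at_in_open') auto
    have upper: "dist (u s) (u t) / \<bar>t - s\<bar> \<le> (integral {a..s} g - integral {a..t} g) / (s - t)"
      if s: "s \<in> {a<..<b}" for s
    proof (rule difference_quotient_mono[where D = "\<lambda>x y. dist (u x) (u y)" and a = a and b = b])
      fix x y assume xy: "a \<le> x" "x \<le> y" "y \<le> b"
      have "integral {a..x} g + integral {x..y} g = integral {a..y} g"
        using xy by (intro Henstock_Kurzweil_Integration.integral_combine g_on) auto
      then show "dist (u x) (u y) \<le> integral {a..y} g - integral {a..x} g"
        using g_dist[OF xy] by linarith
    qed (use s t in \<open>auto simp: dist_commute\<close>)
    show "((\<lambda>s. dist (u s) (u t) / \<bar>t - s\<bar>) \<longlongrightarrow> g t) (at t)"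
    proof (rule order_tendstoI)
      fix c assume "c < g t"
      then obtain q where q: "q \<in> \<rat>" "c < k q t"
        unfolding g_def by (subst (asm) less_cSUP_iff) (use Rats_ne bdd in auto)
      then have "(f q has_real_derivative k q t) (at t)"
        using hq kh t by auto
      then have "((\<lambda>s. (f q s - f q t) / (s - t)) \<longlongrightarrow> k q t) (at t)"
        by (simp add: has_field_derivative_iff)
      from order_tendstoD(1)[OF this q(2)]
      show "\<forall>\<^sub>F s in at t. c < dist (u s) (u t) / \<bar>t - s\<bar>"
      proof eventually_elim
        case (elim s)
        have "(f q s - f q t) / (s - t) \<le> \<bar>f q s - f q t\<bar> / \<bar>s - t\<bar>"
          by (metis abs_divide abs_ge_self)
        also have "\<bar>f q s - f q t\<bar> \<le> dist (u s) (u t)"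
          unfolding f_def using dist_triangle[of "u s" "u q" "u t"] dist_triangle[of "u t" "u q" "u s"]
          by (simp add: dist_commute)
        then have "\<bar>f q s - f q t\<bar> / \<bar>s - t\<bar> \<le> dist (u s) (u t) / \<bar>t - s\<bar>"
          by (simp add: divide_right_mono abs_minus_commute)
        finally show ?case using elim by linarith
      qed
    next
      fix c assume "g t < c"
      from order_tendstoD(2)[OF gt this] ev
      show "\<forall>\<^sub>F s in at t. dist (u s) (u t) / \<bar>t - s\<bar> < c"
        by eventually_elim (use upper in fastforce)
    qed
  qed
  then show ?thesis
    using that g_abs g_bound g_dist by blast
qed

text \<open>The metric derivative is the smallest admissible speed. The points \<open>a\<close> and \<open>b\<close> are negligible, and in between
limits within \<open>I\<close> are ordinary limits, so that any \<open>I\<close> containing \<open>{a..b}\<close> leads to the same result.\<close>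

lemma metric_deriv_speed:
  fixes u :: "real \<Rightarrow> 'a::metric_space"
  assumes ab: "a \<le> b" and sub: "{a..b} \<subseteq> I"
    and m: "m absolutely_integrable_on {a..b}"
    and bound: "\<And>s t. a \<le> s \<Longrightarrow> s \<le> t \<Longrightarrow> t \<le> b \<Longrightarrow> dist (u s) (u t) \<le> integral {s..t} m"
  shows "metric_deriv I u absolutely_integrable_on {a..b}" (is ?A)
    and "AE t in lborel. t \<in> {a..b} \<longrightarrow> 0 \<le> metric_deriv I u t \<and> metric_deriv I u t \<le> \<bar>m t\<bar>" (is ?B)
    and "\<And>s t. a \<le> s \<Longrightarrow> s \<le> t \<Longrightarrow> t \<le> b \<Longrightarrow> dist (u s) (u t) \<le> integral {s..t} (metric_deriv I u)" (is "PROP ?C")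
proof -
  have "(\<lambda>t. indicator {a..b} t *\<^sub>R \<bar>m t\<bar>) \<in> borel_measurable lebesgue"
    using set_integrable_abs[OF m] unfolding set_integrable_def by simp
  from completion_ex_borel_measurable_real[OF this] obtain m1
    where m1[measurable]: "m1 \<in> borel_measurable borel"
      and m1_eq: "AE t in lborel. indicator {a..b} t *\<^sub>R \<bar>m t\<bar> = m1 t"
    by auto
  \<comment> \<open>A Borel version of \<open>\<bar>m\<bar>\<close>, extended by \<open>0\<close>, is a speed on the whole line for the curve that rests outside
    \<open>{a..b}\<close>.\<close>
  define m0 where "m0 t = \<bar>m1 t\<bar>" for t
  have m0_eq: "AE t in lborel. indicator {a..b} t * \<bar>m t\<bar> = m0 t"
    using m1_eq
  proof eventually_elim
    case (elim t)
    have "0 \<le> m1 t" unfolding elim[symmetric] by (simp add: indicator_def)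
    then show ?case using elim by (simp add: m0_def)
  qed
  have "(\<lambda>t. indicator {a..b} t * \<bar>m t\<bar>) integrable_on UNIV"
    using set_integrable_abs[OF m] unfolding set_integrable_def
    by (simp add: integrable_on_lebesgue)
  then have m0_int: "m0 integrable_on UNIV"
    using has_integral_AE[of UNIV] m0_eq unfolding integrable_on_def by fastforce
  define c where "c t = max a (min b t)" for t
  have c: "a \<le> c t" "c t \<le> b" "t \<in> {a..b} \<Longrightarrow> c t = t" for t
    using ab by (auto simp: c_def)
  have m0_abs: "m0 absolutely_integrable_on UNIV"
    using m0_int by (intro nonnegative_absolutely_integrable_1) (auto simp: m0_def)
  have m0_on: "m0 integrable_on {s..t}" for s t
    using set_integrable_subset[OF m0_abs, of "{s..t}"]
    by (intro set_lebesgue_integral_eq_integral(1)) auto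
  have m_on: "m absolutely_integrable_on {s..t}" if "a \<le> s" "t \<le> b" for s t
    using set_integrable_subset[OF m, of "{s..t}"] that by auto
  have bound0: "dist (u (c s)) (u (c t)) \<le> integral {s..t} m0" if st: "s \<le> t" for s t
  proof (cases "s \<le> b \<and> a \<le> t")
    case True
    have cs: "s \<le> c s" "c s \<le> c t" "c t \<le> t"
      using True st ab by (auto simp: c_def)
    have "dist (u (c s)) (u (c t)) \<le> integral {c s..c t} m"
      using c cs by (intro bound) auto
    also have "\<dots> \<le> integral {c s..c t} (\<lambda>t. \<bar>m t\<bar>)"
      using m_on[of "c s" "c t"] c
      by (intro integral_le set_lebesgue_integral_eq_integral(1) set_integrable_abs) auto
    also have "\<dots> = integral {c s..c t} m0"
    proof -
      have "AE x in lborel. x \<in> {c s..c t} \<longrightarrow> \<bar>m x\<bar> = m0 x"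
        using m0_eq
      proof eventually_elim
        case (elim x)
        then show ?case using c(1)[of s] c(2)[of t] by (auto simp: indicator_def split: if_splits)
      qed
      then have "((\<lambda>x. \<bar>m x\<bar>) has_integral y) {c s..c t} \<longleftrightarrow> (m0 has_integral y) {c s..c t}" for y
        by (rule has_integral_AE)
      then show ?thesis unfolding integral_def integrable_on_def by presburger
    qed
    also have "\<dots> \<le> integral {s..t} m0"
      using cs by (intro integral_subset_le m0_on) (auto simp: m0_def)
    finally show ?thesis .
  next
    case False
    then have "c s = c t" using st ab by (auto simp: c_def)
    moreover have "0 \<le> integral {s..t} m0"
      by (intro integral_nonneg m0_on) (auto simp: m0_def)
    ultimately show ?thesis by simp
  qed
  obtain g where g: "g absolutely_integrable_on {a..b}" "\<And>t. \<bar>g t\<bar> \<le> m0 t"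
    "\<And>s t. a \<le> s \<Longrightarrow> s \<le> t \<Longrightarrow> t \<le> b \<Longrightarrow> dist (u (c s)) (u (c t)) \<le> integral {s..t} g"
    "AE t in lborel. t \<in> {a<..<b} \<longrightarrow> ((\<lambda>s. dist (u (c s)) (u (c t)) / \<bar>t - s\<bar>) \<longlongrightarrow> g t) (at t)"
  proof (rule metric_derivative_exists[OF ab _ _ m0_int, of "\<lambda>t. u (c t)"])
    show "m0 \<in> borel_measurable borel" "\<And>x. 0 \<le> m0 x"
      by (auto simp: m0_def[abs_def])
  qed (use bound0 in auto)
  have md: "AE t in lborel. t \<in> {a..b} \<longrightarrow> metric_deriv I u t = g t \<and> 0 \<le> g t"
    using g(4) AE_lborel_singleton[of a] AE_lborel_singleton[of b]
  proof (eventually_elim, intro impI)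
    fix t assume lim: "t \<in> {a<..<b} \<longrightarrow> ((\<lambda>s. dist (u (c s)) (u (c t)) / \<bar>t - s\<bar>) \<longlongrightarrow> g t) (at t)"
      and t': "t \<noteq> a" "t \<noteq> b" "t \<in> {a..b}"
    then have t: "t \<in> {a<..<b}" by auto
    have ev: "\<forall>\<^sub>F s in at t. s \<in> {a<..<b}"
      using t by (intro eventually_at_in_open') auto
    have "((\<lambda>s. dist (u s) (u t) / \<bar>t - s\<bar>) \<longlongrightarrow> g t) (at t)"
    proof (rule Lim_transform_eventually)
      show "((\<lambda>s. dist (u (c s)) (u (c t)) / \<bar>t - s\<bar>) \<longlongrightarrow> g t) (at t)"
        using lim t by simp
      show "\<forall>\<^sub>F s in at t. dist (u (c s)) (u (c t)) / \<bar>t - s\<bar> = dist (u s) (u t) / \<bar>t - s\<bar>"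
        using ev by eventually_elim (use c(3) t in auto)
    qed
    moreover have "at t within I = at t"
      using t interior_mono[OF sub] by (intro at_within_interior) auto
    ultimately have "metric_deriv I u t = g t"
      unfolding metric_deriv_def by (simp add: tendsto_Lim)
    moreover have "0 \<le> g t"
      by (rule tendsto_lowerbound[OF \<open>((\<lambda>s. dist (u s) (u t) / \<bar>t - s\<bar>) \<longlongrightarrow> g t) (at t)\<close>]) auto
    ultimately show "metric_deriv I u t = g t \<and> 0 \<le> g t" ..
  qed
  have md_has: "(g has_integral y) S \<longleftrightarrow> (metric_deriv I u has_integral y) S" if "S \<subseteq> {a..b}" for S y
  proof (rule has_integral_AE)
    show "AE x in lborel. x \<in> S \<longrightarrow> g x = metric_deriv I u x"
      using md by eventually_elim (use that in auto)
  qed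
  show ?B
    using md m0_eq
  proof eventually_elim
    case (elim t)
    then show ?case using g(2)[of t] by (auto simp: abs_le_iff)
  qed
  show ?A
  proof -
    have "(\<lambda>t. \<bar>g t\<bar>) integrable_on {a..b}"
      using g(1) by (intro set_lebesgue_integral_eq_integral(1) set_integrable_abs)
    moreover have "((\<lambda>t. \<bar>g t\<bar>) has_integral y) {a..b} \<longleftrightarrow> ((\<lambda>t. \<bar>metric_deriv I u t\<bar>) has_integral y) {a..b}" for y
      by (rule has_integral_AE) (use md in \<open>eventually_elim, auto\<close>)
    moreover have "g integrable_on {a..b}"
      using g(1) by (rule set_lebesgue_integral_eq_integral(1))
    ultimately show ?thesis
      using md_has[of "{a..b}"] unfolding absolutely_integrable_on_def integrable_on_def real_norm_def by auto
  qed
  fix s t assume st: "a \<le> s" "s \<le> t" "t \<le> b"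
  have "integral {s..t} (metric_deriv I u) = integral {s..t} g"
    using md_has[of "{s..t}"] st unfolding integral_def integrable_on_def by auto
  moreover have "dist (u s) (u t) \<le> integral {s..t} g"
    using g(3)[OF st] c(3) st by simp
  ultimately show "dist (u s) (u t) \<le> integral {s..t} (metric_deriv I u)" by simp
qed


lemma AC_1_speed:
  fixes u :: "real \<Rightarrow> 'a::metric_space"
  assumes u: "u \<in> AC 1 I" and I: "is_interval I" and sub: "{a..b} \<subseteq> I"
  obtains m where "m absolutely_integrable_on {a..b}"
    "\<And>s t. a \<le> s \<Longrightarrow> s \<le> t \<Longrightarrow> t \<le> b \<Longrightarrow> dist (u s) (u t) \<le> integral {s..t} m"
proof -
  have I_sets: "I \<in> sets lebesgue"
    using real_interval_borel_measurable[OF I] by simp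
  from u obtain m :: "real \<Rightarrow> real" where m: "Lp 1 (lebesgue_on I) (\<lambda>r. ereal (m r))"
    and mb: "\<And>s t. s \<in> I \<Longrightarrow> t \<in> I \<Longrightarrow> s \<le> t \<Longrightarrow> dist (u s) (u t) \<le> (LINT r:{s..t}|lebesgue. m r)"
    unfolding AC_def by auto
  have "m \<in> borel_measurable (lebesgue_on I)"
    using m unfolding Lp_def by (simp add: borel_measurable_ereal_iff)
  moreover have "(\<integral>\<^sup>+ x. ennreal (norm (m x)) \<partial>lebesgue_on I) < \<infinity>"
    using m unfolding Lp_def by simp
  ultimately have "integrable (lebesgue_on I) m"
    by (rule integrableI_bounded)
  then have mI: "m absolutely_integrable_on I"
    using I_sets by (simp add: integrable_restrict_space set_integrable_def)
  have m_on: "m absolutely_integrable_on {s..t}" if "a \<le> s" "t \<le> b" for s t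
    proof -
    have "{s..t} \<subseteq> I" using that sub by auto
    then show ?thesis using set_integrable_subset[OF mI, of "{s..t}"] by simp
  qed
  show ?thesis
  proof (rule that[of m])
    fix s t assume st: "a \<le> s" "s \<le> t" "t \<le> b"
    then have "s \<in> I" "t \<in> I" using sub by auto
    then show "dist (u s) (u t) \<le> integral {s..t} m"
      using st mb[of s t] set_lebesgue_integral_eq_integral(2)[OF m_on[of s t]] by auto
  qed (use m_on in auto)
qed

text \<open>On a bounded interval \<open>\<bar>m\<bar> \<le> 1 + m\<^sup>2\<close> makes the square integrable \<open>m\<close> integrable.\<close>

lemma AC_2_speed:
  fixes u :: "real \<Rightarrow> 'a::metric_space"
  assumes u: "u \<in> AC 2 {a..b}"
  obtains m where "m absolutely_integrable_on {a..b}" "(\<lambda>t. (m t)\<^sup>2) absolutely_integrable_on {a..b}"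
    "\<And>s t. a \<le> s \<Longrightarrow> s \<le> t \<Longrightarrow> t \<le> b \<Longrightarrow> dist (u s) (u t) \<le> integral {s..t} m"
proof -
  from u obtain m :: "real \<Rightarrow> real" where m: "Lp 2 (lebesgue_on {a..b}) (\<lambda>r. ereal (m r))"
    and mb: "\<And>s t. s \<in> {a..b} \<Longrightarrow> t \<in> {a..b} \<Longrightarrow> s \<le> t \<Longrightarrow> dist (u s) (u t) \<le> (LINT r:{s..t}|lebesgue. m r)"
    unfolding AC_def by auto
  have m_meas: "m \<in> borel_measurable (lebesgue_on {a..b})"
    using m unfolding Lp_def by (simp add: borel_measurable_ereal_iff)
  have "(\<integral>\<^sup>+ x. ennreal (norm ((m x)\<^sup>2)) \<partial>lebesgue_on {a..b}) < \<infinity>"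
    using m unfolding Lp_def by (simp add: powr_numeral)
  with m_meas have "integrable (lebesgue_on {a..b}) (\<lambda>t. (m t)\<^sup>2)"
    by (intro integrableI_bounded) auto
  then have m2: "(\<lambda>t. (m t)\<^sup>2) absolutely_integrable_on {a..b}"
    by (simp add: integrable_restrict_space set_integrable_def)
  have mI: "m absolutely_integrable_on {a..b}"
  proof (rule measurable_bounded_by_integrable_imp_absolutely_integrable[OF m_meas])
    show "(\<lambda>t. 1 + (m t)\<^sup>2) integrable_on {a..b}"
      using set_lebesgue_integral_eq_integral(1)[OF m2] by (intro integrable_add) auto
    show "norm (m x) \<le> 1 + (m x)\<^sup>2" for x
      using sum_squares_bound[of 1 "\<bar>m x\<bar>"] by simp
  qed simp
  have m_on: "m absolutely_integrable_on {s..t}" if "a \<le> s" "t \<le> b" for s t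
    using set_integrable_subset[OF mI, of "{s..t}"] that by auto
  show ?thesis
  proof (rule that[of m])
    fix s t assume st: "a \<le> s" "s \<le> t" "t \<le> b"
    then show "dist (u s) (u t) \<le> integral {s..t} m"
      using mb[of s t] set_lebesgue_integral_eq_integral(2)[OF m_on[of s t]] by auto
  qed (use m_on m2 in auto)
qed

lemma AC_2_I:
  fixes u :: "real \<Rightarrow> 'a::metric_space"
  assumes m: "m absolutely_integrable_on {a..b}" and m2: "(\<lambda>t. (m t)\<^sup>2) absolutely_integrable_on {a..b}"
    and bound: "\<And>s t. a \<le> s \<Longrightarrow> s \<le> t \<Longrightarrow> t \<le> b \<Longrightarrow> dist (u s) (u t) \<le> integral {s..t} m"
  shows "u \<in> AC 2 {a..b}"
proof -
  have i1: "integrable (lebesgue_on {a..b}) m" and i2: "integrable (lebesgue_on {a..b}) (\<lambda>t. (m t)\<^sup>2)"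
    using m m2 by (simp_all add: integrable_restrict_space set_integrable_def)
  have m_on: "m absolutely_integrable_on {s..t}" if "a \<le> s" "t \<le> b" for s t
    using set_integrable_subset[OF m, of "{s..t}"] that by auto
  have "Lp 2 (lebesgue_on {a..b}) (\<lambda>r. ereal (m r))"
    using i1 i2 unfolding Lp_def integrable_iff_bounded by (simp add: powr_numeral borel_measurable_ereal_iff)
  then show ?thesis
    unfolding AC_def using bound set_lebesgue_integral_eq_integral(2)[OF m_on] by (auto intro!: exI[of _ m])
qed

text \<open>An arbitrary interval is a countable union of compact ones: rational end points suffice, once a minimum
or maximum of the interval, should it exist, is added to them.\<close>

lemma borel_measurable_on_interval:
  fixes f :: "real \<Rightarrow> real"
  assumes I: "is_interval I"
    and f: "\<And>a b. a \<le> b \<Longrightarrow> {a..b} \<subseteq> I \<Longrightarrow> f \<in> borel_measurable (lebesgue_on {a..b})"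
  shows "f \<in> borel_measurable (lebesgue_on I)"
proof -
  define D where "D = {r \<in> I. r \<in> \<rat> \<or> (\<forall>x\<in>I. r \<le> x) \<or> (\<forall>x\<in>I. x \<le> r)}"
  have "r \<in> \<rat> \<union> {Inf I, Sup I}" if "r \<in> D" for r
    using that cInf_eq_minimum[of r I] cSup_eq_maximum[of r I] by (auto simp: D_def)
  then have "countable D"
    by (intro countable_subset[of D "\<rat> \<union> {Inf I, Sup I}"]) (auto simp: countable_rat)
  have lower: "\<exists>p\<in>D. p \<le> x" if x: "x \<in> I" for x
  proof (cases "\<forall>y\<in>I. x \<le> y")
    case False
    then obtain y where y: "y \<in> I" "y < x" by force
    then obtain p where p: "p \<in> \<rat>" "y < p" "p < x" using Rats_dense_in_real by blast
    then have "p \<in> I" using I x y unfolding is_interval_1 by (meson less_imp_le)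
    then show ?thesis using p by (auto simp: D_def)
  qed (use x in \<open>auto simp: D_def\<close>)
  have upper: "\<exists>q\<in>D. x \<le> q" if x: "x \<in> I" for x
  proof (cases "\<forall>y\<in>I. y \<le> x")
    case False
    then obtain y where y: "y \<in> I" "x < y" by force
    then obtain p where p: "p \<in> \<rat>" "x < p" "p < y" using Rats_dense_in_real by blast
    then have "p \<in> I" using I x y unfolding is_interval_1 by (meson less_imp_le)
    then show ?thesis using p by (auto simp: D_def)
  qed (use x in \<open>auto simp: D_def\<close>)
  have sub: "{p..q} \<subseteq> I" if "p \<in> D" "q \<in> D" for p q
  proof -
    have "p \<in> I" "q \<in> I" using that by (simp_all add: D_def)
    then show ?thesis using I unfolding is_interval_1 by (meson atLeastAtMost_iff subsetI)
  qed
  show ?thesis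
  proof (rule measurable_piecewise_restrict)
    show "countable ((\<lambda>(p, q). {p..q}) ` (D \<times> D))"
      using \<open>countable D\<close> by (intro countable_image countable_SIGMA)
    show "\<Omega> \<inter> space (lebesgue_on I) \<in> sets (lebesgue_on I)" if "\<Omega> \<in> (\<lambda>(p, q). {p..q}) ` (D \<times> D)" for \<Omega>
      using that real_interval_borel_measurable[OF I]
      by (auto simp: sets_restrict_space_iff Int_commute)
    show "space (lebesgue_on I) \<subseteq> \<Union> ((\<lambda>(p, q). {p..q}) ` (D \<times> D))"
    proof
      fix x assume "x \<in> space (lebesgue_on I)"
      then have "x \<in> I" by simp
      from lower[OF this] upper[OF this] show "x \<in> \<Union> ((\<lambda>(p, q). {p..q}) ` (D \<times> D))" by force
    qed
    show "f \<in> borel_measurable (restrict_space (lebesgue_on I) \<Omega>)" if Om: "\<Omega> \<in> (\<lambda>(p, q). {p..q}) ` (D \<times> D)" for \<Omega>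
    proof -
      obtain p q where pq: "p \<in> D" "q \<in> D" "\<Omega> = {p..q}" using Om by auto
      have "restrict_space (lebesgue_on I) \<Omega> = lebesgue_on {p..q}"
        using sub[OF pq(1,2)] real_interval_borel_measurable[OF I] pq(3)
        by (simp add: restrict_restrict_space Int_absorb1)
      then show ?thesis
        using f[OF _ sub[OF pq(1,2)]] by (cases "p \<le> q") (auto simp: measurable_def space_restrict_space)
    qed
  qed
qed

text \<open>Integrability for the speed measure is ordinary integrability of the product with the speed on compact parts.
The maximum with \<open>0\<close> removes the unspecified values of the metric derivative and, as \<^const>\<open>ennreal\<close>
truncates in the same way, does not change the measure.\<close>

lemma Lp_1_speed_measure:
  fixes F :: "real \<Rightarrow> ereal" and u :: "real \<Rightarrow> 'a::metric_space"
  assumes F: "Lp 1 (speed_measure I u) F" and I: "I \<in> sets lebesgue"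
    and md: "metric_deriv I u \<in> borel_measurable (lebesgue_on I)" and sub: "{s..t} \<subseteq> I"
  defines "m \<equiv> \<lambda>r. max 0 (metric_deriv I u r)"
  shows "(\<lambda>r. real_of_ereal (F r)) \<in> borel_measurable (lebesgue_on {s..t})"
    and "(\<lambda>r. real_of_ereal (F r) * m r) absolutely_integrable_on {s..t}"
    and "AE r in lborel. r \<in> {s..t} \<longrightarrow> 0 < m r \<longrightarrow> \<bar>F r\<bar> \<noteq> \<infinity>"
proof -
  have F_meas: "F \<in> borel_measurable (lebesgue_on I)"
    and F_AE: "AE r in speed_measure I u. \<bar>F r\<bar> \<noteq> \<infinity>"
    and F_fin: "(\<integral>\<^sup>+ r. ennreal \<bar>real_of_ereal (F r)\<bar> \<partial>speed_measure I u) < \<infinity>"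
    using F unfolding Lp_def by (auto simp: speed_measure_def)
  have f_meas: "(\<lambda>r. real_of_ereal (F r)) \<in> borel_measurable (lebesgue_on I)"
    using F_meas by simp
  then show "(\<lambda>r. real_of_ereal (F r)) \<in> borel_measurable (lebesgue_on {s..t})"
    using sub by (rule measurable_restrict_mono)
  have em: "ennreal (m r) = ennreal (metric_deriv I u r)" for r
    by (simp add: m_def ennreal_max_0)
  have m_meas: "m \<in> borel_measurable (lebesgue_on I)"
    unfolding m_def using md by (intro borel_measurable_max) auto
  have dens: "speed_measure I u = density (lebesgue_on I) (\<lambda>r. ennreal (m r))"
    unfolding speed_measure_def em ..
  have "(\<integral>\<^sup>+ r. ennreal \<bar>real_of_ereal (F r)\<bar> \<partial>speed_measure I u) =
      (\<integral>\<^sup>+ r. ennreal (m r) * ennreal \<bar>real_of_ereal (F r)\<bar> \<partial>lebesgue_on I)"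
    unfolding dens
    by (rule nn_integral_density[OF measurable_compose[OF m_meas measurable_ennreal]
          measurable_compose[OF borel_measurable_abs[OF f_meas] measurable_ennreal]])
  also have "\<dots> = (\<integral>\<^sup>+ r. ennreal (norm (real_of_ereal (F r) * m r)) \<partial>lebesgue_on I)"
  proof (rule nn_integral_cong)
    fix r
    have "0 \<le> m r" by (simp add: m_def)
    then have "norm (real_of_ereal (F r) * m r) = m r * \<bar>real_of_ereal (F r)\<bar>"
      unfolding real_norm_def abs_mult by (simp only: abs_of_nonneg mult.commute)
    then show "ennreal (m r) * ennreal \<bar>real_of_ereal (F r)\<bar> = ennreal (norm (real_of_ereal (F r) * m r))"
      using \<open>0 \<le> m r\<close> by (simp only: ennreal_mult abs_ge_zero)
  qed
  finally have "(\<integral>\<^sup>+ r. ennreal (norm (real_of_ereal (F r) * m r)) \<partial>lebesgue_on I) < \<infinity>"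
    using F_fin by simp
  then have "integrable (lebesgue_on I) (\<lambda>r. real_of_ereal (F r) * m r)"
    using m_meas f_meas by (intro integrableI_bounded borel_measurable_times)
  then have "(\<lambda>r. real_of_ereal (F r) * m r) absolutely_integrable_on I"
    using I by (simp add: integrable_restrict_space set_integrable_def)
  then show "(\<lambda>r. real_of_ereal (F r) * m r) absolutely_integrable_on {s..t}"
    by (rule set_integrable_subset) (use sub in auto)
  have "AE r in lebesgue_on I. 0 < ennreal (m r) \<longrightarrow> \<bar>F r\<bar> \<noteq> \<infinity>"
    using F_AE m_meas unfolding dens by (subst (asm) AE_density) auto
  then have "AE r in lborel. r \<in> I \<longrightarrow> 0 < ennreal (m r) \<longrightarrow> \<bar>F r\<bar> \<noteq> \<infinity>"
    using I by (subst (asm) AE_restrict_space_iff) (auto simp: AE_completion_iff)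
  then show "AE r in lborel. r \<in> {s..t} \<longrightarrow> 0 < m r \<longrightarrow> \<bar>F r\<bar> \<noteq> \<infinity>"
    by eventually_elim (use sub in auto)
qed

section \<open>Lower semicontinuous energies along curves\<close>

text \<open>A neighbourhood \<open>U\<close> of \<open>u\<close> contains all points at small distance from some smaller neighbourhood of \<open>u\<close>, and
hence all points at small distance from \<open>u\<close>.\<close>

lemma limitin_if_tendsto:
  fixes \<sigma> :: "'a::metric_space topology"
  assumes \<sigma>: "compatible_topology \<sigma>" and x: "x \<longlonglongrightarrow> u"
  shows "limitin \<sigma> x u sequentially"
  unfolding limitin_def
proof (intro conjI allI impI)
  show "u \<in> topspace \<sigma>"
    using \<sigma> by (simp add: compatible_topology_def)
  fix U assume U: "openin \<sigma> U \<and> u \<in> U"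
  have "\<forall>U x. openin \<sigma> U \<longrightarrow> x \<in> U \<longrightarrow>
        (\<exists>V \<delta>. openin \<sigma> V \<and> x \<in> V \<and> \<delta> > 0 \<and> (\<forall>y. infdist y V < \<delta> \<longrightarrow> y \<in> U))"
    using \<sigma> unfolding compatible_topology_def by (elim conjE)
  from this[rule_format, of U u] U obtain V \<delta> where V: "u \<in> V" "\<delta> > 0" "\<And>y. infdist y V < \<delta> \<Longrightarrow> y \<in> U"
    by auto
  have "\<forall>\<^sub>F n in sequentially. dist (x n) u < \<delta>"
    using x V(2) by (rule tendstoD)
  then show "\<forall>\<^sub>F n in sequentially. x n \<in> U"
  proof eventually_elim
    case (elim n)
    then show ?case using infdist_le[OF V(1), of "x n"] by (intro V(3)) simp
  qed
qed

lemma closed_sublevel: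
  fixes \<phi> :: "'a::metric_space \<Rightarrow> ereal"
  assumes \<sigma>: "compatible_topology \<sigma>" and \<phi>: "LSCC_lsc \<sigma> \<phi>"
  shows "closed {x. \<phi> x \<le> y}"
  unfolding closed_sequential_limits
proof (intro allI impI, elim conjE)
  fix x u assume xy: "\<forall>n. x n \<in> {x. \<phi> x \<le> y}" and x: "x \<longlonglongrightarrow> u"
  have "bounded (range x)"
    using x by (intro convergent_imp_bounded)
  then have "\<phi> u \<le> liminf (\<lambda>n. \<phi> (x n))"
    using \<phi> limitin_if_tendsto[OF \<sigma> x] unfolding LSCC_lsc_def by blast
  also have "\<dots> \<le> liminf (\<lambda>n. y)"
    using xy by (intro Liminf_mono always_eventually) auto
  also have "\<dots> = y" by (simp add: Liminf_const)
  finally show "u \<in> {x. \<phi> x \<le> y}" by simp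
qed

text \<open>Sublevel sets pull back to closed sets of parameters.\<close>

lemma borel_measurable_lsc_along_curve:
  fixes c :: "real \<Rightarrow> 'a::metric_space" and \<phi> :: "'a::metric_space \<Rightarrow> ereal"
  assumes \<phi>: "\<And>y. closed {x. \<phi> x \<le> y}" and c: "continuous_on T c" and T: "closed T"
  shows "(\<lambda>t. \<phi> (c t)) \<in> borel_measurable (restrict_space borel T)"
proof (rule borel_measurableI_le)
  fix y
  have "closed (T \<inter> c -` {x. \<phi> x \<le> y})"
    using continuous_closed_preimage[OF c T \<phi>] .
  then have "T \<inter> c -` {x. \<phi> x \<le> y} \<in> sets (restrict_space borel T)"
    using T by (subst sets_restrict_space_iff) auto
  moreover have "T \<inter> c -` {x. \<phi> x \<le> y} = {t \<in> space (restrict_space borel T). \<phi> (c t) \<le> y}"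
    by (auto simp: space_restrict_space)
  ultimately show "{t \<in> space (restrict_space borel T). \<phi> (c t) \<le> y} \<in> sets (restrict_space borel T)"
    by simp
qed

lemma continuous_on_if_speed:
  fixes c :: "real \<Rightarrow> 'a::metric_space"
  assumes k: "k integrable_on {a..b}"
    and bound: "\<And>s t. a \<le> s \<Longrightarrow> s \<le> t \<Longrightarrow> t \<le> b \<Longrightarrow> dist (c s) (c t) \<le> integral {s..t} k"
  shows "continuous_on {a..b} c"
  unfolding continuous_on_def
proof
  fix t assume t: "t \<in> {a..b}"
  have "continuous_on {a..b} (\<lambda>x. integral {a..x} k)"
    by (rule indefinite_integral_continuous_1[OF k])
  then have "((\<lambda>x. integral {a..x} k) \<longlongrightarrow> integral {a..t} k) (at t within {a..b})"
    using t by (auto simp: continuous_on_def)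
  then have 0: "((\<lambda>x. \<bar>integral {a..x} k - integral {a..t} k\<bar>) \<longlongrightarrow> 0) (at t within {a..b})"
    by (intro tendsto_rabs_zero) (simp add: LIM_zero_iff)
  have diff: "dist (c x) (c y) \<le> \<bar>integral {a..x} k - integral {a..y} k\<bar>"
    if "a \<le> x" "x \<le> y" "y \<le> b" for x y
  proof -
    have "integral {a..x} k + integral {x..y} k = integral {a..y} k"
      using that by (intro Henstock_Kurzweil_Integration.integral_combine)
        (auto intro: integrable_subinterval_real[OF k])
    then show ?thesis using bound[OF that] by linarith
  qed
  have "\<forall>\<^sub>F x in at t within {a..b}. x \<in> {a..b}"
    by (simp add: eventually_at_filter)
  then have "\<forall>\<^sub>F x in at t within {a..b}. dist (c x) (c t) \<le> \<bar>integral {a..x} k - integral {a..t} k\<bar>"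
  proof eventually_elim
    case (elim x)
    then show ?case
      using diff[of x t] diff[of t x] t by (cases "x \<le> t") (auto simp: dist_commute abs_minus_commute)
  qed
  then have "((\<lambda>x. dist (c x) (c t)) \<longlongrightarrow> 0) (at t within {a..b})"
    by (intro tendsto_sandwich[OF _ _ tendsto_const 0]) auto
  then show "(c \<longlongrightarrow> c t) (at t within {a..b})"
    by (rule iffD2[OF tendsto_dist_iff])
qed

section \<open>Exponentially weighted integrals and a Hardy inequality\<close>

lemma absolutely_integrable_if_nn_integral_le:
  fixes f :: "real \<Rightarrow> real"
  assumes f: "f \<in> borel_measurable (lebesgue_on S)" and S: "S \<in> sets lebesgue"
    and nonneg: "\<And>t. t \<in> S \<Longrightarrow> 0 \<le> f t" and C: "0 \<le> C"
    and le: "(\<integral>\<^sup>+ t. ennreal (f t) * indicator S t \<partial>lborel) \<le> ennreal C"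
  shows "f absolutely_integrable_on S" and "integral S f \<le> C"
proof -
  have "(\<integral>\<^sup>+ t. ennreal (norm (indicator S t *\<^sub>R f t)) \<partial>lebesgue) =
      (\<integral>\<^sup>+ t. ennreal (f t) * indicator S t \<partial>lborel)"
    unfolding nn_integral_completion by (intro nn_integral_cong) (auto simp: indicator_def nonneg)
  moreover have "(\<lambda>t. indicator S t *\<^sub>R f t) \<in> borel_measurable lebesgue"
    using f S by (simp add: borel_measurable_restrict_space_iff)
  ultimately show abs: "f absolutely_integrable_on S"
    unfolding set_integrable_def using le by (intro integrableI_bounded) (auto simp: le_less_trans)
  have "ennreal (integral S f) = (\<integral>\<^sup>+ t. ennreal (f t) * indicator S t \<partial>lborel)"
    using nn_integral_has_integral_lebesgue'[OF nonneg integrable_integral[OF set_lebesgue_integral_eq_integral(1)[OF abs]]]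
    by simp
  with le C show "integral S f \<le> C"
    by (metis ennreal_le_iff)
qed

lemma nn_integral_eq_integral_if_nonneg:
  fixes f :: "real \<Rightarrow> real"
  assumes f: "f absolutely_integrable_on S" and nonneg: "\<And>t. t \<in> S \<Longrightarrow> 0 \<le> f t"
  shows "(\<integral>\<^sup>+ t. ennreal (f t) * indicator S t \<partial>lborel) = ennreal (integral S f)"
  by (rule nn_integral_has_integral_lebesgue'[OF nonneg integrable_integral[OF set_lebesgue_integral_eq_integral(1)[OF f]]])

lemma measurable_on_if_absolutely_integrable:
  fixes f :: "real \<Rightarrow> real"
  assumes "f absolutely_integrable_on S" "S \<in> sets lebesgue"
  shows "f \<in> borel_measurable (lebesgue_on S)"
  using absolutely_integrable_imp_integrable[OF assms] by (rule borel_measurable_integrable)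

text \<open>The admissible speeds of finite kinetic energy.\<close>

definition weighted_L2 :: "real \<Rightarrow> (real \<Rightarrow> real) \<Rightarrow> bool" where
  "weighted_L2 \<epsilon> k \<longleftrightarrow> (\<forall>t. 0 \<le> k t) \<and> (\<lambda>t. exp (- t / \<epsilon>) * (k t)\<^sup>2) absolutely_integrable_on {0..}"

text \<open>The integrand determines \<open>k\<close> because \<open>k\<close> is nonnegative.\<close>

lemma weighted_L2_measurable:
  assumes k: "weighted_L2 \<epsilon> k" and \<epsilon>: "\<epsilon> > 0"
  shows "k \<in> borel_measurable (lebesgue_on {0..})"
proof -
  have E: "(\<lambda>t. exp (- t / \<epsilon>) * (k t)\<^sup>2) \<in> borel_measurable (lebesgue_on {0..})"
    using k by (intro measurable_on_if_absolutely_integrable) (auto simp: weighted_L2_def)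
  have e: "(\<lambda>t. exp (t / \<epsilon>)) \<in> borel_measurable (lebesgue_on {0..})"
    by (intro continuous_imp_measurable_on_sets_lebesgue continuous_on_exp continuous_on_divide
        continuous_on_id continuous_on_const) (use \<epsilon> in auto)
  have "(\<lambda>t. sqrt (exp (t / \<epsilon>) * (exp (- t / \<epsilon>) * (k t)\<^sup>2))) \<in> borel_measurable (lebesgue_on {0..})"
    using measurable_compose[OF borel_measurable_times[OF e E], of sqrt borel] by simp
  moreover have "sqrt (exp (t / \<epsilon>) * (exp (- t / \<epsilon>) * (k t)\<^sup>2)) = k t" for t
  proof -
    have "exp (t / \<epsilon>) * exp (- t / \<epsilon>) = 1" by (simp flip: exp_add)
    then have eq: "exp (t / \<epsilon>) * (exp (- t / \<epsilon>) * (k t)\<^sup>2) = (k t)\<^sup>2"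
      by (simp only: mult.assoc[symmetric] mult_1)
    show ?thesis unfolding eq using k by (simp add: weighted_L2_def)
  qed
  ultimately show ?thesis by simp
qed

lemma weighted_L2_local:
  assumes k: "weighted_L2 \<epsilon> k" and \<epsilon>: "\<epsilon> > 0" and a: "0 \<le> a"
  shows "(\<lambda>t. (k t)\<^sup>2) absolutely_integrable_on {a..b}" "k absolutely_integrable_on {a..b}"
proof -
  have sub: "{a..b} \<subseteq> {0..}" using a by auto
  have meas: "k \<in> borel_measurable (lebesgue_on {a..b})"
    using measurable_restrict_mono[OF weighted_L2_measurable[OF k \<epsilon>] sub] .
  have E: "(\<lambda>t. exp (- t / \<epsilon>) * (k t)\<^sup>2) absolutely_integrable_on {a..b}"
    using k sub unfolding weighted_L2_def by (auto intro: set_integrable_subset)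
  have E': "(\<lambda>t. exp (b / \<epsilon>) * (exp (- t / \<epsilon>) * (k t)\<^sup>2)) integrable_on {a..b}"
    using set_lebesgue_integral_eq_integral(1)[OF E] by (rule integrable_on_mult_right)
  show k2: "(\<lambda>t. (k t)\<^sup>2) absolutely_integrable_on {a..b}"
  proof (rule measurable_bounded_by_integrable_imp_absolutely_integrable[OF _ _ E'])
    fix t assume t: "t \<in> {a..b}"
    have "1 \<le> exp (b / \<epsilon>) * exp (- t / \<epsilon>)"
      using t \<epsilon> by (simp add: divide_right_mono flip: exp_add diff_divide_distrib)
    then have "1 * (k t)\<^sup>2 \<le> (exp (b / \<epsilon>) * exp (- t / \<epsilon>)) * (k t)\<^sup>2"
      by (rule mult_right_mono) simp
    then show "norm ((k t)\<^sup>2) \<le> exp (b / \<epsilon>) * (exp (- t / \<epsilon>) * (k t)\<^sup>2)"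
      by (simp add: mult.assoc)
  qed (use meas in auto)
  show "k absolutely_integrable_on {a..b}"
  proof (rule measurable_bounded_by_integrable_imp_absolutely_integrable[OF meas])
    show "(\<lambda>t. 1 + (k t)\<^sup>2) integrable_on {a..b}"
      using set_lebesgue_integral_eq_integral(1)[OF k2] by (intro integrable_add) auto
    show "norm (k x) \<le> 1 + (k x)\<^sup>2" for x
      using sum_squares_bound[of 1 "\<bar>k x\<bar>"] by simp
  qed simp
qed

lemma exponential_tail:
  fixes a c :: real
  assumes c: "c > 0"
  shows "(\<integral>\<^sup>+ t. ennreal (exp (- t / c)) * indicator {a..} t \<partial>lborel) = ennreal (c * exp (- a / c))"
proof -
  have "((\<lambda>t. - c * exp (- t / c)) \<longlongrightarrow> - c * 0) at_top"
  proof (intro tendsto_mult tendsto_const filterlim_compose[OF exp_at_bot])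
    have "filterlim (\<lambda>t. (1 / c) * t) at_top at_top"
      using c by (intro filterlim_tendsto_pos_mult_at_top[OF tendsto_const]) (auto simp: filterlim_ident)
    then show "filterlim (\<lambda>t. - t / c) at_bot at_top"
      by (simp add: filterlim_uminus_at_bot)
  qed
  then have "(\<integral>\<^sup>+ t. ennreal (exp (- t / c)) * indicator {a..} t \<partial>lborel) = ennreal (0 - (- c * exp (- a / c)))"
    using c by (intro nn_integral_FTC_atLeast) (auto intro!: derivative_eq_intros)
  then show ?thesis by simp
qed

text \<open>Cauchy-Schwarz with the weights \<open>exp (\<mp> s / (4 \<epsilon>))\<close> bounds the squared inner integral by
\<open>2 \<epsilon> exp (t / (2 \<epsilon>))\<close> times the integral of \<open>exp (- s / (2 \<epsilon>)) K\<^sup>2\<close> over \<open>[0, t]\<close>. After exchanging the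
order of integration the integral in \<open>t\<close> over \<open>[s, \<infinity>)\<close> is \<open>4 \<epsilon>\<^sup>2 exp (- s / (2 \<epsilon>))\<close>, which completes the
weight.\<close>

lemma Hardy_exponential_nn:
  fixes K :: "real \<Rightarrow> ennreal"
  assumes K[measurable]: "K \<in> borel_measurable borel" and \<epsilon>: "\<epsilon> > 0"
  shows "(\<integral>\<^sup>+ t. ennreal (exp (- t / \<epsilon>)) * (\<integral>\<^sup>+ s. K s * indicator {0..t} s \<partial>lborel)\<^sup>2 * indicator {0..} t \<partial>lborel)
    \<le> ennreal (4 * \<epsilon>\<^sup>2) * (\<integral>\<^sup>+ s. ennreal (exp (- s / \<epsilon>)) * (K s)\<^sup>2 * indicator {0..} s \<partial>lborel)"
proof -
  define F where "F s t = ennreal (2 * \<epsilon> * exp (- t / (2 * \<epsilon>))) * ennreal (exp (- s / (2 * \<epsilon>))) * (K s)\<^sup>2 *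
     indicator {(s, t). 0 \<le> s \<and> s \<le> t} (s, t)" for s t :: real
  have F_meas: "(\<lambda>(s, t). F s t) \<in> borel_measurable (lborel \<Otimes>\<^sub>M lborel)"
  proof -
    have "{p::real \<times> real. 0 \<le> fst p \<and> fst p \<le> snd p} \<in> sets borel"
      by (intro borel_closed closed_Collect_conj closed_Collect_le continuous_intros)
    moreover have "{p::real \<times> real. 0 \<le> fst p \<and> fst p \<le> snd p} = {(s, t). 0 \<le> s \<and> s \<le> t}"
      by auto
    ultimately have [measurable]: "{(s, t). 0 \<le> s \<and> s \<le> (t::real)} \<in> sets (borel \<Otimes>\<^sub>M borel)"
      by (subst borel_prod) simp
    have "(\<lambda>(s, t). F s t) = (\<lambda>p. ennreal (2 * \<epsilon> * exp (- snd p / (2 * \<epsilon>))) *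
        ennreal (exp (- fst p / (2 * \<epsilon>))) * (K (fst p))\<^sup>2 * indicator {(s, t). 0 \<le> s \<and> s \<le> t} p)"
      by (auto simp: F_def fun_eq_iff)
    moreover have "\<dots> \<in> borel_measurable (lborel \<Otimes>\<^sub>M lborel)"
      by measurable
    ultimately show ?thesis by simp
  qed
  have "ennreal (exp (- t / \<epsilon>)) * (\<integral>\<^sup>+ s. K s * indicator {0..t} s \<partial>lborel)\<^sup>2 \<le> (\<integral>\<^sup>+ s. F s t \<partial>lborel)"
    if t: "0 \<le> t" for t
  proof -
    define f where "f s = ennreal (exp (- s / (4 * \<epsilon>))) * K s * indicator {0..t} s" for s
    define g where "g s = ennreal (exp (s / (4 * \<epsilon>))) * indicator {0..t} s" for s
    have [measurable]: "f \<in> borel_measurable lborel" "g \<in> borel_measurable lborel"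
      unfolding f_def g_def by measurable
    have fg: "f s * g s = K s * indicator {0..t} s" for s
    proof -
      have "ennreal (exp (- s / (4 * \<epsilon>))) * ennreal (exp (s / (4 * \<epsilon>))) = 1"
        by (simp flip: ennreal_mult exp_add)
      then show ?thesis
        unfolding f_def g_def by (auto simp: indicator_def mult_ac)
    qed
    have f2: "(f s)\<^sup>2 = ennreal (exp (- s / (2 * \<epsilon>))) * (K s)\<^sup>2 * indicator {0..t} s" for s
    proof -
      have "(ennreal (exp (- s / (4 * \<epsilon>))))\<^sup>2 = ennreal (exp (- s / (2 * \<epsilon>)))"
        by (simp add: ennreal_power flip: exp_double)
      then show ?thesis
        unfolding f_def by (auto simp: indicator_def power_mult_distrib)
    qed
    have g2: "(\<integral>\<^sup>+ s. (g s)\<^sup>2 \<partial>lborel) \<le> ennreal (2 * \<epsilon> * exp (t / (2 * \<epsilon>)))"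
    proof -
      have "(ennreal (exp (s / (4 * \<epsilon>))))\<^sup>2 = ennreal (exp (s / (2 * \<epsilon>)))" for s
        by (simp add: ennreal_power flip: exp_double)
      then have "(\<integral>\<^sup>+ s. (g s)\<^sup>2 \<partial>lborel) = (\<integral>\<^sup>+ s. ennreal (exp (s / (2 * \<epsilon>))) * indicator {0..t} s \<partial>lborel)"
        unfolding g_def by (intro nn_integral_cong) (auto simp: indicator_def)
      also have "\<dots> = ennreal (2 * \<epsilon> * exp (t / (2 * \<epsilon>)) - 2 * \<epsilon> * exp (0 / (2 * \<epsilon>)))"
      proof (rule nn_integral_FTC_Icc)
        show "((\<lambda>s. 2 * \<epsilon> * exp (s / (2 * \<epsilon>))) has_real_derivative exp (x / (2 * \<epsilon>))) (at x)" for x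
          using \<epsilon> by (auto intro!: derivative_eq_intros)
      qed (use t in auto)
      also have "\<dots> \<le> ennreal (2 * \<epsilon> * exp (t / (2 * \<epsilon>)))"
        using \<epsilon> by (intro ennreal_leI) simp
      finally show ?thesis .
    qed
    have "(\<integral>\<^sup>+ s. K s * indicator {0..t} s \<partial>lborel)\<^sup>2 \<le> (\<integral>\<^sup>+ s. (f s)\<^sup>2 \<partial>lborel) * (\<integral>\<^sup>+ s. (g s)\<^sup>2 \<partial>lborel)"
      using Cauchy_Schwarz_nn_integral[of f lborel g] by (simp add: fg)
    also have "\<dots> \<le> (\<integral>\<^sup>+ s. (f s)\<^sup>2 \<partial>lborel) * ennreal (2 * \<epsilon> * exp (t / (2 * \<epsilon>)))"
      by (rule mult_left_mono[OF g2]) simp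
    finally have "ennreal (exp (- t / \<epsilon>)) * (\<integral>\<^sup>+ s. K s * indicator {0..t} s \<partial>lborel)\<^sup>2
        \<le> ennreal (exp (- t / \<epsilon>)) * ((\<integral>\<^sup>+ s. (f s)\<^sup>2 \<partial>lborel) * ennreal (2 * \<epsilon> * exp (t / (2 * \<epsilon>))))"
      by (rule mult_left_mono) simp
    also have "\<dots> = ennreal (2 * \<epsilon> * exp (- t / (2 * \<epsilon>))) * (\<integral>\<^sup>+ s. (f s)\<^sup>2 \<partial>lborel)"
    proof -
      have "exp (- t / \<epsilon>) * (2 * \<epsilon> * exp (t / (2 * \<epsilon>))) = 2 * \<epsilon> * exp (- t / (2 * \<epsilon>))"
        using \<epsilon> by (simp add: field_simps flip: exp_add)
      then have e: "ennreal (exp (- t / \<epsilon>)) * ennreal (2 * \<epsilon> * exp (t / (2 * \<epsilon>))) = ennreal (2 * \<epsilon> * exp (- t / (2 * \<epsilon>)))"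
        using \<epsilon> by (simp flip: ennreal_mult)
      show ?thesis unfolding e[symmetric] by (simp only: mult_ac)
    qed
    also have "\<dots> = (\<integral>\<^sup>+ s. F s t \<partial>lborel)"
      unfolding f2 F_def
      by (subst nn_integral_cmult[symmetric]) (auto intro!: nn_integral_cong simp: indicator_def mult_ac)
    finally show ?thesis .
  qed
  then have "(\<integral>\<^sup>+ t. ennreal (exp (- t / \<epsilon>)) * (\<integral>\<^sup>+ s. K s * indicator {0..t} s \<partial>lborel)\<^sup>2 * indicator {0..} t \<partial>lborel)
     \<le> (\<integral>\<^sup>+ t. (\<integral>\<^sup>+ s. F s t \<partial>lborel) \<partial>lborel)"
    by (intro nn_integral_mono) (auto split: split_indicator)
  also have "\<dots> = (\<integral>\<^sup>+ s. (\<integral>\<^sup>+ t. F s t \<partial>lborel) \<partial>lborel)"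
    by (rule lborel_pair.Fubini'[OF F_meas])
  also have "\<dots> = (\<integral>\<^sup>+ s. ennreal (4 * \<epsilon>\<^sup>2) * (ennreal (exp (- s / \<epsilon>)) * (K s)\<^sup>2 * indicator {0..} s) \<partial>lborel)"
  proof (rule nn_integral_cong)
    fix s :: real
    show "(\<integral>\<^sup>+ t. F s t \<partial>lborel) = ennreal (4 * \<epsilon>\<^sup>2) * (ennreal (exp (- s / \<epsilon>)) * (K s)\<^sup>2 * indicator {0..} s)"
    proof (cases "0 \<le> s")
      case True
      have "(\<integral>\<^sup>+ t. F s t \<partial>lborel) = (\<integral>\<^sup>+ t. (ennreal (2 * \<epsilon> * exp (- s / (2 * \<epsilon>))) * (K s)\<^sup>2) *
          (ennreal (exp (- t / (2 * \<epsilon>))) * indicator {s..} t) \<partial>lborel)"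
        unfolding F_def using True \<epsilon>
        by (intro nn_integral_cong) (auto simp: indicator_def ennreal_mult mult_ac)
      also have "\<dots> = (ennreal (2 * \<epsilon> * exp (- s / (2 * \<epsilon>))) * (K s)\<^sup>2) * ennreal (2 * \<epsilon> * exp (- s / (2 * \<epsilon>)))"
        using \<epsilon> exponential_tail[of "2 * \<epsilon>" s] by (subst nn_integral_cmult) auto
      also have "\<dots> = ennreal ((2 * \<epsilon> * exp (- s / (2 * \<epsilon>))) * (2 * \<epsilon> * exp (- s / (2 * \<epsilon>)))) * (K s)\<^sup>2"
        using \<epsilon> by (subst ennreal_mult) (auto simp: mult_ac)
      also have "(2 * \<epsilon> * exp (- s / (2 * \<epsilon>))) * (2 * \<epsilon> * exp (- s / (2 * \<epsilon>))) = 4 * \<epsilon>\<^sup>2 * exp (- s / \<epsilon>)"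
        using \<epsilon> by (simp add: power2_eq_square mult_ac flip: exp_add)
      finally show ?thesis using True \<epsilon> by (simp add: ennreal_mult mult_ac)
    qed (auto simp: F_def)
  qed
  also have "\<dots> = ennreal (4 * \<epsilon>\<^sup>2) * (\<integral>\<^sup>+ s. ennreal (exp (- s / \<epsilon>)) * (K s)\<^sup>2 * indicator {0..} s \<partial>lborel)"
    by (rule nn_integral_cmult) simp
  finally show ?thesis .
qed

text \<open>The function \<open>D\<close> stands for the distance from the starting point of a curve with speed \<open>k\<close>.\<close>

lemma Hardy_exponential:
  assumes k: "weighted_L2 \<epsilon> k" and \<epsilon>: "\<epsilon> > 0"
    and D_cont: "continuous_on {0..} D" and D_nonneg: "\<And>t. 0 \<le> t \<Longrightarrow> 0 \<le> D t"
    and D_le: "\<And>t. 0 \<le> t \<Longrightarrow> D t \<le> integral {0..t} k"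
  shows "(\<lambda>t. exp (- t / \<epsilon>) * (D t)\<^sup>2) absolutely_integrable_on {0..}"
    and "integral {0..} (\<lambda>t. exp (- t / \<epsilon>) * (D t)\<^sup>2) \<le> 4 * \<epsilon>\<^sup>2 * integral {0..} (\<lambda>t. exp (- t / \<epsilon>) * (k t)\<^sup>2)"
proof -
  let ?E = "\<lambda>t. exp (- t / \<epsilon>) * (k t)\<^sup>2"
  have k_nonneg: "0 \<le> k t" for t
    using k by (simp add: weighted_L2_def)
  have E: "?E absolutely_integrable_on {0..}"
    using k by (simp add: weighted_L2_def)
  have "(\<lambda>t. indicator {0..} t *\<^sub>R k t) \<in> borel_measurable lebesgue"
    using weighted_L2_measurable[OF k \<epsilon>] by (simp add: borel_measurable_restrict_space_iff)
  from completion_ex_borel_measurable_real[OF this] obtain k'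
    where k'[measurable]: "k' \<in> borel_measurable borel" and k'_eq: "AE t in lborel. indicator {0..} t *\<^sub>R k t = k' t"
    by auto
  define K where "K t = ennreal (k' t)" for t
  have K[measurable]: "K \<in> borel_measurable borel" unfolding K_def by measurable
  have K_eq: "AE t in lborel. 0 \<le> t \<longrightarrow> K t = ennreal (k t)"
    using k'_eq by eventually_elim (auto simp: K_def)
  have int_K: "(\<integral>\<^sup>+ s. K s * indicator {0..t} s \<partial>lborel) = ennreal (integral {0..t} k)" for t
  proof -
    have "(\<integral>\<^sup>+ s. K s * indicator {0..t} s \<partial>lborel) = (\<integral>\<^sup>+ s. ennreal (k s) * indicator {0..t} s \<partial>lborel)"
      by (rule nn_integral_cong_AE) (use K_eq in \<open>eventually_elim, auto simp: indicator_def\<close>)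
    then show ?thesis
      using nn_integral_eq_integral_if_nonneg[OF weighted_L2_local(2)[OF k \<epsilon>, of 0 t]] k_nonneg by simp
  qed
  have int_E: "(\<integral>\<^sup>+ s. ennreal (exp (- s / \<epsilon>)) * (K s)\<^sup>2 * indicator {0..} s \<partial>lborel) = ennreal (integral {0..} ?E)"
  proof -
    have "(\<integral>\<^sup>+ s. ennreal (exp (- s / \<epsilon>)) * (K s)\<^sup>2 * indicator {0..} s \<partial>lborel) =
        (\<integral>\<^sup>+ s. ennreal (?E s) * indicator {0..} s \<partial>lborel)"
      by (rule nn_integral_cong_AE)
        (use K_eq in \<open>eventually_elim, auto simp: indicator_def ennreal_power ennreal_mult k_nonneg\<close>)
    then show ?thesis
      using nn_integral_eq_integral_if_nonneg[OF E] by simp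
  qed
  have "(\<integral>\<^sup>+ t. ennreal (exp (- t / \<epsilon>) * (D t)\<^sup>2) * indicator {0..} t \<partial>lborel) \<le>
     (\<integral>\<^sup>+ t. ennreal (exp (- t / \<epsilon>)) * (\<integral>\<^sup>+ s. K s * indicator {0..t} s \<partial>lborel)\<^sup>2 * indicator {0..} t \<partial>lborel)"
  proof (rule nn_integral_mono)
    fix t :: real
    show "ennreal (exp (- t / \<epsilon>) * (D t)\<^sup>2) * indicator {0..} t \<le>
      ennreal (exp (- t / \<epsilon>)) * (\<integral>\<^sup>+ s. K s * indicator {0..t} s \<partial>lborel)\<^sup>2 * indicator {0..} t"
    proof (cases "0 \<le> t")
      case True
      have "(D t)\<^sup>2 \<le> (integral {0..t} k)\<^sup>2"
        using D_nonneg D_le True by (intro power_mono) auto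
      moreover have "0 \<le> integral {0..t} k"
        using D_nonneg D_le True by force
      ultimately show ?thesis
        using True by (simp add: int_K ennreal_power ennreal_mult[symmetric] ennreal_leI)
    qed simp
  qed
  also have "\<dots> \<le> ennreal (4 * \<epsilon>\<^sup>2) * ennreal (integral {0..} ?E)"
    using Hardy_exponential_nn[OF K \<epsilon>] unfolding int_E .
  also have "\<dots> = ennreal (4 * \<epsilon>\<^sup>2 * integral {0..} ?E)"
    by (simp add: ennreal_mult')
  finally have le: "(\<integral>\<^sup>+ t. ennreal (exp (- t / \<epsilon>) * (D t)\<^sup>2) * indicator {0..} t \<partial>lborel) \<le>
    ennreal (4 * \<epsilon>\<^sup>2 * integral {0..} ?E)" .
  have D_meas: "(\<lambda>t. exp (- t / \<epsilon>) * (D t)\<^sup>2) \<in> borel_measurable (lebesgue_on {0..})"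
    using D_cont \<epsilon> by (intro continuous_imp_measurable_on_sets_lebesgue continuous_intros) auto
  have "0 \<le> integral {0..} ?E"
    using E by (intro integral_nonneg set_lebesgue_integral_eq_integral(1)) auto
  then have C: "0 \<le> 4 * \<epsilon>\<^sup>2 * integral {0..} ?E" by simp
  show "(\<lambda>t. exp (- t / \<epsilon>) * (D t)\<^sup>2) absolutely_integrable_on {0..}"
    and "integral {0..} (\<lambda>t. exp (- t / \<epsilon>) * (D t)\<^sup>2) \<le> 4 * \<epsilon>\<^sup>2 * integral {0..} ?E"
    using absolutely_integrable_if_nn_integral_le[OF D_meas _ _ C le] by auto
qed

lemma AE_lborel_shift:
  fixes P :: "real \<Rightarrow> bool"
  assumes "AE x in lborel. P x"
  shows "AE x in lborel. P (x + a)"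
proof -
  have "AE x in lborel. P (a + x)"
  proof (rule AE_distrD[where f = "\<lambda>x. a + x" and M' = borel])
    show "(\<lambda>x. a + x) \<in> measurable lborel borel" by simp
    show "AE x in distr lborel borel (\<lambda>x. a + x). P x"
      by (subst lborel_distr_plus) (rule assms)
  qed
  then show ?thesis by (simp add: add.commute)
qed

lemma absolutely_integrable_shift:
  fixes f :: "real \<Rightarrow> real"
  assumes S: "S \<in> sets lebesgue" and f: "f absolutely_integrable_on (\<lambda>t. t + a) ` S"
  shows "(\<lambda>t. f (t + a)) absolutely_integrable_on S"
    and "integral S (\<lambda>t. f (t + a)) = integral ((\<lambda>t. t + a) ` S) f"
proof -
  have "(\<lambda>t. \<bar>1\<bar> * f (t + a)) absolutely_integrable_on S \<and>
     integral S (\<lambda>t. \<bar>1\<bar> * f (t + a)) = integral ((\<lambda>t. t + a) ` S) f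
    \<longleftrightarrow> f absolutely_integrable_on (\<lambda>t. t + a) ` S \<and> integral ((\<lambda>t. t + a) ` S) f = integral ((\<lambda>t. t + a) ` S) f"
    by (rule has_absolute_integral_change_of_variables_1'[OF S]) (auto intro!: derivative_eq_intros simp: inj_on_def)
  then show "(\<lambda>t. f (t + a)) absolutely_integrable_on S"
    "integral S (\<lambda>t. f (t + a)) = integral ((\<lambda>t. t + a) ` S) f"
    using f by auto
qed

lemma image_shift_atLeast: "(\<lambda>t. t + a) ` {b..} = {b + a::real..}"
proof (intro equalityI subsetI)
  fix x assume "x \<in> {b + a..}"
  then show "x \<in> (\<lambda>t. t + a) ` {b..}"
    by (intro image_eqI[of _ _ "x - a"]) auto
qed auto

lemma absolutely_integrable_halfline_combine:
  fixes f :: "real \<Rightarrow> real"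
  assumes T: "a \<le> T" and f1: "f absolutely_integrable_on {a..T}" and f2: "f absolutely_integrable_on {T..}"
  shows "f absolutely_integrable_on {a..}" "integral {a..} f = integral {a..T} f + integral {T..} f"
proof -
  have U: "{a..T} \<union> {T..} = {a..}" using T by auto
  show "f absolutely_integrable_on {a..}"
    using set_integrable_Un[OF f1 f2] by (simp add: U)
  have "integral ({a..T} \<union> {T..}) f = integral {a..T} f + integral {T..} f"
  proof (rule integral_Un)
    show "negligible ({a..T} \<inter> {T..})"
      by (rule negligible_subset[of "{T}"]) auto
  qed (use f1 f2 in \<open>auto intro: set_lebesgue_integral_eq_integral(1)\<close>)
  then show "integral {a..} f = integral {a..T} f + integral {T..} f"
    by (simp add: U)
qed

text \<open>Curves glued at time \<open>a\<close> agree with a translated curve only after \<open>a\<close>.\<close>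

lemma absolutely_integrable_spike_point:
  fixes f g :: "real \<Rightarrow> real"
  assumes f: "f absolutely_integrable_on S" and eq: "\<And>t. t \<in> S \<Longrightarrow> t \<noteq> a \<Longrightarrow> g t = f t"
  shows "g absolutely_integrable_on S" "integral S g = integral S f"
proof -
  have N: "negligible {a}" by simp
  show "g absolutely_integrable_on S"
    by (rule absolutely_integrable_spike[OF f N]) (use eq in auto)
  show "integral S g = integral S f"
    by (rule integral_spike[OF N]) (use eq in auto)
qed

lemma absolutely_integrable_exp_mult:
  fixes f :: "real \<Rightarrow> real"
  assumes f: "f absolutely_integrable_on {0..T}" and \<epsilon>: "\<epsilon> > 0"
  shows "(\<lambda>t. exp (- t / \<epsilon>) * f t) absolutely_integrable_on {0..T}"
proof (rule measurable_bounded_by_integrable_imp_absolutely_integrable)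
  have "(\<lambda>t. exp (- t / \<epsilon>)) \<in> borel_measurable (lebesgue_on {0..T})"
    by (intro continuous_imp_measurable_on_sets_lebesgue continuous_on_exp continuous_on_divide
      continuous_on_id continuous_on_const continuous_on_minus) (use \<epsilon> in auto)
  then show "(\<lambda>t. exp (- t / \<epsilon>) * f t) \<in> borel_measurable (lebesgue_on {0..T})"
    using measurable_on_if_absolutely_integrable[OF f] by (intro borel_measurable_times) auto
  show "(\<lambda>t. \<bar>f t\<bar>) integrable_on {0..T}"
    using f by (intro set_lebesgue_integral_eq_integral(1) set_integrable_abs)
  show "norm (exp (- t / \<epsilon>) * f t) \<le> \<bar>f t\<bar>" if "t \<in> {0..T}" for t
  proof -
    have "exp (- t / \<epsilon>) \<le> 1" using that \<epsilon> by simp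
    then have "exp (- t / \<epsilon>) * \<bar>f t\<bar> \<le> 1 * \<bar>f t\<bar>" by (rule mult_right_mono) simp
    then show ?thesis by (simp add: abs_mult)
  qed
qed simp

section \<open>The weighted measure and its extended integral\<close>

lemma ext_integral_mono_AE:
  assumes "AE x in M. f x \<le> g x"
  shows "ext_integral M f \<le> ext_integral M g"
  unfolding ext_integral_def
proof (rule ereal_minus_mono)
  show "enn2ereal (\<integral>\<^sup>+ x. e2ennreal (f x) \<partial>M) \<le> enn2ereal (\<integral>\<^sup>+ x. e2ennreal (g x) \<partial>M)"
    unfolding less_eq_ennreal.rep_eq[symmetric]
    by (rule nn_integral_mono_AE) (use assms in eventually_elim, auto intro: e2ennreal_mono)
  show "enn2ereal (\<integral>\<^sup>+ x. e2ennreal (- g x) \<partial>M) \<le> enn2ereal (\<integral>\<^sup>+ x. e2ennreal (- f x) \<partial>M)"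
    unfolding less_eq_ennreal.rep_eq[symmetric]
    by (rule nn_integral_mono_AE) (use assms in eventually_elim, auto intro: e2ennreal_mono)
qed

lemma ext_integral_eq_integral:
  assumes fin: "AE x in M. \<bar>f x\<bar> \<noteq> \<infinity>" and int: "integrable M (\<lambda>x. real_of_ereal (f x))"
  shows "ext_integral M f = ereal (\<integral>x. real_of_ereal (f x) \<partial>M)"
proof -
  have pos: "(\<integral>\<^sup>+ x. e2ennreal (f x) \<partial>M) = (\<integral>\<^sup>+ x. ennreal (real_of_ereal (f x)) \<partial>M)"
    by (rule nn_integral_cong_AE) (use fin in eventually_elim, metis e2ennreal_ereal ereal_real')
  have neg: "(\<integral>\<^sup>+ x. e2ennreal (- f x) \<partial>M) = (\<integral>\<^sup>+ x. ennreal (- real_of_ereal (f x)) \<partial>M)"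
    by (rule nn_integral_cong_AE)
      (use fin in eventually_elim, metis e2ennreal_ereal ereal_real' uminus_ereal.simps(1))
  obtain r q where rq: "0 \<le> r" "0 \<le> q" "(\<integral>\<^sup>+ x. ennreal (real_of_ereal (f x)) \<partial>M) = ennreal r"
    "(\<integral>\<^sup>+ x. ennreal (- real_of_ereal (f x)) \<partial>M) = ennreal q"
    "(\<integral>x. real_of_ereal (f x) \<partial>M) = r - q"
    using integrableE[OF int] by metis
  show ?thesis
    unfolding ext_integral_def pos neg rq using rq(1,2) by simp
qed

text \<open>Under the convention \<open>\<infinity> - \<infinity> = \<infinity>\<close> a finite value excludes an infinite positive part.\<close>

lemma integrable_if_ext_integral_finite:
  assumes meas: "f \<in> borel_measurable M"
    and neg: "(\<integral>\<^sup>+ x. e2ennreal (- f x) \<partial>M) < \<infinity>"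
    and fin: "ext_integral M f < \<infinity>"
  shows "AE x in M. \<bar>f x\<bar> \<noteq> \<infinity>" "integrable M (\<lambda>x. real_of_ereal (f x))"
proof -
  have em: "(\<lambda>x. e2ennreal (f x)) \<in> borel_measurable M" "(\<lambda>x. e2ennreal (- f x)) \<in> borel_measurable M"
    using meas by (auto intro!: measurable_compose[OF _ measurable_e2ennreal])
  have pos: "(\<integral>\<^sup>+ x. e2ennreal (f x) \<partial>M) < \<infinity>"
  proof (rule ccontr)
    assume "\<not> (\<integral>\<^sup>+ x. e2ennreal (f x) \<partial>M) < \<infinity>"
    then have "enn2ereal (\<integral>\<^sup>+ x. e2ennreal (f x) \<partial>M) = \<infinity>"
      by (simp add: less_top[symmetric])
    then have "ext_integral M f = \<infinity>"
      unfolding ext_integral_def by simp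
    then show False using fin by simp
  qed
  have "AE x in M. e2ennreal (f x) \<noteq> \<infinity>" "AE x in M. e2ennreal (- f x) \<noteq> \<infinity>"
    by (rule nn_integral_PInf_AE[OF em(1)], use pos in simp) (rule nn_integral_PInf_AE[OF em(2)], use neg in simp)
  then show ae: "AE x in M. \<bar>f x\<bar> \<noteq> \<infinity>"
    by eventually_elim (auto simp: abs_ereal.simps elim!: ereal_infinity_cases)
  show "integrable M (\<lambda>x. real_of_ereal (f x))"
    unfolding integrable_iff_bounded
  proof (intro conjI)
    show "(\<lambda>x. real_of_ereal (f x)) \<in> borel_measurable M"
      using meas by simp
    have "(\<integral>\<^sup>+ x. ennreal (norm (real_of_ereal (f x))) \<partial>M) =
        (\<integral>\<^sup>+ x. e2ennreal (f x) + e2ennreal (- f x) \<partial>M)"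
    proof (rule nn_integral_cong_AE)
      show "AE x in M. ennreal (norm (real_of_ereal (f x))) = e2ennreal (f x) + e2ennreal (- f x)"
        using ae
      proof eventually_elim
        case (elim x)
        then obtain r where "f x = ereal r" by auto
        then show ?case by (cases "r \<ge> 0") (auto simp: ennreal_neg)
      qed
    qed
    also have "\<dots> < \<infinity>"
      using pos neg by (subst nn_integral_add[OF em]) (auto simp: less_top)
    finally show "(\<integral>\<^sup>+ x. ennreal (norm (real_of_ereal (f x))) \<partial>M) < \<infinity>" .
  qed
qed

lemma lebesgue_on_Ioi_AE:
  "(AE t in lebesgue_on {0<..}. P t) \<longleftrightarrow> (AE t in lborel. (0::real) \<le> t \<longrightarrow> P t)"
proof -
  have "(AE t in lebesgue_on {0<..}. P t) \<longleftrightarrow> (AE t in lborel. 0 < t \<longrightarrow> P t)"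
    by (subst AE_restrict_space_iff) (auto simp: AE_completion_iff)
  also have "\<dots> \<longleftrightarrow> (AE t in lborel. 0 \<le> t \<longrightarrow> P t)"
  proof
    assume "AE t in lborel. 0 < t \<longrightarrow> P t"
    with AE_lborel_singleton[of 0] show "AE t in lborel. 0 \<le> t \<longrightarrow> P t"
      by eventually_elim auto
  next
    assume "AE t in lborel. 0 \<le> t \<longrightarrow> P t"
    then show "AE t in lborel. 0 < t \<longrightarrow> P t"
      by eventually_elim auto
  qed
  finally show ?thesis .
qed

lemma measurable_lebesgue_on_Ioi:
  "f \<in> borel_measurable (lebesgue_on {0..}) \<Longrightarrow> f \<in> borel_measurable (lebesgue_on {0::real<..})"
  by (rule measurable_restrict_mono) auto

lemma wed_weight_measurable:
  assumes "\<epsilon> > 0"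
  shows "(\<lambda>t. exp (- t / \<epsilon>) / \<epsilon>) \<in> borel_measurable (lebesgue_on {0::real<..})"
  by (intro continuous_imp_measurable_on_sets_lebesgue continuous_on_exp continuous_on_divide
      continuous_on_id continuous_on_const continuous_on_minus) (use assms in auto)

lemma AE_wed_measure:
  assumes "\<epsilon> > 0"
  shows "(AE t in wed_measure \<epsilon>. P t) \<longleftrightarrow> (AE t in lborel. 0 \<le> t \<longrightarrow> P t)"
  unfolding wed_measure_def
  using wed_weight_measurable[OF assms] assms
  by (subst AE_density) (auto simp: lebesgue_on_Ioi_AE)

lemma borel_measurable_wed_measure:
  "borel_measurable (wed_measure \<epsilon>) = borel_measurable (lebesgue_on {0<..})"
  by (rule measurable_cong_sets) (auto simp: wed_measure_def)


lemma wed_measure_integral: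
  fixes f :: "real \<Rightarrow> real"
  assumes \<epsilon>: "\<epsilon> > 0" and f: "f \<in> borel_measurable (lebesgue_on {0<..})"
  shows "integrable (wed_measure \<epsilon>) f \<longleftrightarrow> (\<lambda>t. exp (- t / \<epsilon>) / \<epsilon> * f t) absolutely_integrable_on {0..}"
    and "integrable (wed_measure \<epsilon>) f \<Longrightarrow>
      (\<integral>t. f t \<partial>wed_measure \<epsilon>) = integral {0..} (\<lambda>t. exp (- t / \<epsilon>) / \<epsilon> * f t)"
proof -
  let ?w = "\<lambda>t. exp (- t / \<epsilon>) / \<epsilon> * f t"
  have neg: "negligible {x \<in> {0..} - {0<..}. ?w x \<noteq> 0}" "negligible {x \<in> {0<..} - {0..}. ?w x \<noteq> 0}"
    by (auto intro: negligible_subset[of "{0}"])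
  have 1: "integrable (wed_measure \<epsilon>) f \<longleftrightarrow> integrable (lebesgue_on {0<..}) ?w"
    unfolding wed_measure_def using \<epsilon> wed_weight_measurable[OF \<epsilon>] f
    by (subst integrable_density) auto
  also have "\<dots> \<longleftrightarrow> ?w absolutely_integrable_on {0<..}"
    by (simp add: integrable_restrict_space set_integrable_def)
  finally show "integrable (wed_measure \<epsilon>) f \<longleftrightarrow> ?w absolutely_integrable_on {0..}"
    using absolutely_integrable_spike_set_eq[OF neg] by simp
  assume "integrable (wed_measure \<epsilon>) f"
  then have "integrable (lebesgue_on {0<..}) ?w" using 1 by simp
  then have "(\<integral>t. ?w t \<partial>lebesgue_on {0<..}) = integral {0<..} ?w"
    by (rule lebesgue_integral_eq_integral) simp
  moreover have "(\<integral>t. f t \<partial>wed_measure \<epsilon>) = (\<integral>t. ?w t \<partial>lebesgue_on {0<..})"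
    unfolding wed_measure_def using \<epsilon> wed_weight_measurable[OF \<epsilon>] f
    by (subst integral_density) auto
  moreover have "integral {0<..} ?w = integral {0..} ?w"
    by (rule integral_spike_set[OF neg(2,1)])
  ultimately show "(\<integral>t. f t \<partial>wed_measure \<epsilon>) = integral {0..} ?w" by (simp only:)
qed

lemma exp_decay_integral:
  fixes \<epsilon> :: real
  assumes \<epsilon>: "\<epsilon> > 0"
  shows "((\<lambda>t. exp (- t / \<epsilon>)) has_integral \<epsilon> * exp (- a / \<epsilon>)) {a..}"
    and "(\<lambda>t. exp (- t / \<epsilon>)) absolutely_integrable_on {a..}"
proof -
  show 1: "((\<lambda>t. exp (- t / \<epsilon>)) has_integral \<epsilon> * exp (- a / \<epsilon>)) {a..}"
    using has_integral_exp_minus_to_infinity[of "1 / \<epsilon>" a] \<epsilon> by (simp add: mult.commute)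
  then show "(\<lambda>t. exp (- t / \<epsilon>)) absolutely_integrable_on {a..}"
    by (intro nonnegative_absolutely_integrable_1) auto
qed

text \<open>The absolute value and the value \<open>0\<close> at negative times make the metric derivative nonnegative everywhere
without changing its square where it matters.\<close>

lemma wed_curves_weighted_L2:
  fixes c :: "real \<Rightarrow> 'a::metric_space"
  assumes \<epsilon>: "\<epsilon> > 0" and c: "c \<in> wed_curves \<epsilon> x"
  defines "k \<equiv> \<lambda>t. if 0 \<le> t then \<bar>metric_deriv {0..} c t\<bar> else 0"
  shows "c 0 = x" "weighted_L2 \<epsilon> k"
    "\<And>s t. 0 \<le> s \<Longrightarrow> s \<le> t \<Longrightarrow> dist (c s) (c t) \<le> integral {s..t} k"
proof -
  show "c 0 = x" using c by (simp add: wed_curves_def)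
  have loc: "c \<in> AC 2 {a..b}" if "0 \<le> a" "a \<le> b" for a b
    using c that by (auto simp: wed_curves_def AC_loc_def)
  have md: "metric_deriv {0..} c absolutely_integrable_on {0..b} \<and>
     (\<forall>s t. 0 \<le> s \<longrightarrow> s \<le> t \<longrightarrow> t \<le> b \<longrightarrow> dist (c s) (c t) \<le> integral {s..t} (metric_deriv {0..} c))"
    if b: "0 \<le> b" for b
  proof -
    obtain m where m: "m absolutely_integrable_on {0..b}"
      "\<And>s t. 0 \<le> s \<Longrightarrow> s \<le> t \<Longrightarrow> t \<le> b \<Longrightarrow> dist (c s) (c t) \<le> integral {s..t} m"
      by (rule AC_2_speed[OF loc[OF order_refl b]]) (rule that)
    have "{0..b} \<subseteq> {0..}" by auto
    from metric_deriv_speed(1,3)[OF b this m] show ?thesis by blast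
  qed
  have k_abs: "k absolutely_integrable_on {a..b}" if "0 \<le> a" "a \<le> b" for a b
  proof -
    have "metric_deriv {0..} c absolutely_integrable_on {a..b}"
      by (rule set_integrable_subset[OF conjunct1[OF md[of b]]]) (use that in auto)
    then have "(\<lambda>t. \<bar>metric_deriv {0..} c t\<bar>) absolutely_integrable_on {a..b}"
      by (rule set_integrable_abs)
    then show ?thesis
      by (rule set_integrable_cong[THEN iffD1, rotated 3]) (use that in \<open>auto simp: k_def\<close>)
  qed
  show "dist (c s) (c t) \<le> integral {s..t} k" if st: "0 \<le> s" "s \<le> t" for s t
  proof -
    have "dist (c s) (c t) \<le> integral {s..t} (metric_deriv {0..} c)"
      using md[of t] st by auto
    also have "\<dots> \<le> integral {s..t} k"
    proof (rule integral_le)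
      have "metric_deriv {0..} c absolutely_integrable_on {s..t}"
        by (intro set_integrable_subset[OF conjunct1[OF md[of t]]]) (use st in auto)
      then show "metric_deriv {0..} c integrable_on {s..t}"
        by (rule set_lebesgue_integral_eq_integral(1))
      show "k integrable_on {s..t}"
        using k_abs[OF st] by (rule set_lebesgue_integral_eq_integral(1))
    qed (use st in \<open>auto simp: k_def\<close>)
    finally show ?thesis .
  qed
  have k_meas: "k \<in> borel_measurable lebesgue"
  proof (rule borel_measurable_LIMSEQ_real)
    show "(\<lambda>t. indicator {0..real n} t *\<^sub>R k t) \<in> borel_measurable lebesgue" for n
      using k_abs[of 0 "real n"] unfolding set_integrable_def by auto
    show "(\<lambda>n. indicator {0..real n} t *\<^sub>R k t) \<longlonglongrightarrow> k t" for t
    proof (rule tendsto_eventually)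
      obtain N where N: "t \<le> real N" using real_arch_simple by blast
      show "\<forall>\<^sub>F n in sequentially. indicator {0..real n} t *\<^sub>R k t = k t"
        using eventually_ge_at_top[of N]
      proof eventually_elim
        case (elim n)
        then have "t \<le> real n" using N by linarith
        then show ?case by (auto simp: indicator_def k_def)
      qed
    qed
  qed
  have k_Ioi: "k \<in> borel_measurable (lebesgue_on S)" for S
    using k_meas by (rule measurable_restrict_space1)
  have eq: "\<And>t. t \<in> {0<..} \<Longrightarrow> (metric_deriv {0..} c t)\<^sup>2 = (k t)\<^sup>2"
    by (auto simp: k_def)
  have sp: "space (wed_measure \<epsilon>) = {0<..}" by (simp add: wed_measure_def)
  have "(\<integral>\<^sup>+ t. ennreal ((k t)\<^sup>2) \<partial>wed_measure \<epsilon>) = (\<integral>\<^sup>+ t. ennreal ((metric_deriv {0..} c t)\<^sup>2) \<partial>wed_measure \<epsilon>)"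
    by (rule nn_integral_cong) (simp add: sp eq)
  also have "\<dots> < \<infinity>" using c by (simp add: wed_curves_def)
  finally have "integrable (wed_measure \<epsilon>) (\<lambda>t. (k t)\<^sup>2)"
    by (intro integrableI_bounded) (use k_Ioi in \<open>auto simp: borel_measurable_wed_measure\<close>)
  then have "(\<lambda>t. exp (- t / \<epsilon>) / \<epsilon> * (k t)\<^sup>2) absolutely_integrable_on {0..}"
    using k_Ioi by (subst (asm) wed_measure_integral(1)[OF \<epsilon>]) auto
  then have "(\<lambda>t. \<epsilon> * (exp (- t / \<epsilon>) / \<epsilon> * (k t)\<^sup>2)) absolutely_integrable_on {0..}"
    by (rule set_integrable_mult_right)
  then show "weighted_L2 \<epsilon> k"
    using \<epsilon> by (simp add: weighted_L2_def k_def)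
qed

lemma wed_curves_I:
  fixes c :: "real \<Rightarrow> 'a::metric_space"
  assumes \<epsilon>: "\<epsilon> > 0" and c0: "c 0 = x" and k: "weighted_L2 \<epsilon> k"
    and bound: "\<And>s t. 0 \<le> s \<Longrightarrow> s \<le> t \<Longrightarrow> dist (c s) (c t) \<le> integral {s..t} k"
  shows "c \<in> wed_curves \<epsilon> x"
    and "AE t in lborel. 0 \<le> t \<longrightarrow> 0 \<le> metric_deriv {0..} c t \<and> metric_deriv {0..} c t \<le> k t"
proof -
  have "AE t in lborel. \<forall>n::nat. t \<in> {0..real n} \<longrightarrow> 0 \<le> metric_deriv {0..} c t \<and> metric_deriv {0..} c t \<le> \<bar>k t\<bar>"
    unfolding AE_all_countable
  proof
    fix n :: nat
    show "AE t in lborel. t \<in> {0..real n} \<longrightarrow> 0 \<le> metric_deriv {0..} c t \<and> metric_deriv {0..} c t \<le> \<bar>k t\<bar>"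
      by (rule metric_deriv_speed(2)) (use weighted_L2_local(2)[OF k \<epsilon>] bound in auto)
  qed
  then show md: "AE t in lborel. 0 \<le> t \<longrightarrow> 0 \<le> metric_deriv {0..} c t \<and> metric_deriv {0..} c t \<le> k t"
  proof eventually_elim
    case (elim t)
    obtain n where "t \<le> real n" using real_arch_simple by blast
    moreover have "\<bar>k t\<bar> = k t" using k by (simp add: weighted_L2_def)
    ultimately show ?case using elim by auto
  qed
  have k_Ioi: "k \<in> borel_measurable (lebesgue_on {0<..})"
    using weighted_L2_measurable[OF k \<epsilon>] by (rule measurable_lebesgue_on_Ioi)
  have "(\<integral>\<^sup>+ t. ennreal ((metric_deriv {0..} c t)\<^sup>2) \<partial>wed_measure \<epsilon>) \<le> (\<integral>\<^sup>+ t. ennreal ((k t)\<^sup>2) \<partial>wed_measure \<epsilon>)"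
  proof (rule nn_integral_mono_AE)
    show "AE t in wed_measure \<epsilon>. ennreal ((metric_deriv {0..} c t)\<^sup>2) \<le> ennreal ((k t)\<^sup>2)"
      unfolding AE_wed_measure[OF \<epsilon>] using md
      by eventually_elim (auto intro!: ennreal_leI power_mono)
  qed
  also have "\<dots> < \<infinity>"
  proof -
    have "(\<lambda>t. 1 / \<epsilon> * (exp (- t / \<epsilon>) * (k t)\<^sup>2)) absolutely_integrable_on {0..}"
      using k by (intro set_integrable_mult_right) (simp add: weighted_L2_def)
    then have "integrable (wed_measure \<epsilon>) (\<lambda>t. (k t)\<^sup>2)"
      using k_Ioi by (subst wed_measure_integral(1)[OF \<epsilon>]) auto
    then show ?thesis
      by (simp add: integrable_iff_bounded)
  qed
  finally have fin: "(\<integral>\<^sup>+ t. ennreal ((metric_deriv {0..} c t)\<^sup>2) \<partial>wed_measure \<epsilon>) < \<infinity>" .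
  have "c \<in> AC_loc 2 {0..}"
    unfolding AC_loc_def
  proof (clarify)
    fix a b :: real assume ab: "a \<le> b" "{a..b} \<subseteq> {0..}"
    then have a: "0 \<le> a" by auto
    show "c \<in> AC 2 {a..b}"
      by (rule AC_2_I[OF weighted_L2_local(2,1)[OF k \<epsilon> a]]) (use bound a in auto)
  qed
  then show "c \<in> wed_curves \<epsilon> x"
    using c0 fin by (simp add: wed_curves_def)
qed

section \<open>Monotone time changes\<close>

lemma borel_version_on:
  fixes f :: "real \<Rightarrow> real"
  assumes "f \<in> borel_measurable (lebesgue_on {a..b})"
  obtains f' where "f' \<in> borel_measurable borel" "AE r in lborel. r \<in> {a..b} \<longrightarrow> f r = f' r"
proof -
  have "(\<lambda>t. indicator {a..b} t *\<^sub>R f t) \<in> borel_measurable lebesgue"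
    using assms by (simp add: borel_measurable_restrict_space_iff)
  from completion_ex_borel_measurable_real[OF this] obtain f'
    where f': "f' \<in> borel_measurable borel" "AE t in lborel. indicator {a..b} t *\<^sub>R f t = f' t"
    by auto
  show ?thesis
    by (rule that[OF f'(1)]) (use f'(2) in \<open>eventually_elim, auto\<close>)
qed

text \<open>The primitive \<open>\<theta>\<close> of \<open>w\<close> may be constant on intervals, so \<open>\<rho>\<close> is its smallest right inverse
\<open>\<rho> \<tau> = min {r. \<tau> \<le> \<theta> r}\<close>. It is characterised by the Galois connection \<open>\<rho> \<tau> \<le> r \<longleftrightarrow> \<tau> \<le> \<theta> r\<close>, which says that
the image under \<open>\<rho>\<close> of Lebesgue measure on \<open>[0, \<theta> b]\<close> and the measure with density \<open>w\<close> on \<open>[a, b]\<close> have the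
same distribution function. The substitution rule is the equality of these two measures.\<close>

lemma monotone_time_change:
  fixes w :: "real \<Rightarrow> real"
  assumes ab: "a \<le> b" and w_borel[measurable]: "w \<in> borel_measurable borel" and w_nonneg: "\<And>r. 0 \<le> w r"
    and w_int: "w integrable_on {a..b}"
  defines "\<theta> \<equiv> \<lambda>r. integral {a..r} w"
  obtains \<rho> :: "real \<Rightarrow> real" where "\<rho> \<in> borel_measurable borel" "\<And>\<tau>. \<rho> \<tau> \<in> {a..b}"
    "\<And>\<tau> r. \<tau> \<in> {0..\<theta> b} \<Longrightarrow> r \<in> {a..b} \<Longrightarrow> \<rho> \<tau> \<le> r \<longleftrightarrow> \<tau> \<le> \<theta> r"
    "\<And>\<sigma> \<tau>. 0 \<le> \<sigma> \<Longrightarrow> \<sigma> < \<tau> \<Longrightarrow> \<tau> \<le> \<theta> b \<Longrightarrow> \<rho> \<sigma> < \<rho> \<tau>"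
    "\<And>h :: real \<Rightarrow> ennreal. h \<in> borel_measurable borel \<Longrightarrow>
       (\<integral>\<^sup>+ \<tau>. h (\<rho> \<tau>) * indicator {0..\<theta> b} \<tau> \<partial>lborel) = (\<integral>\<^sup>+ r. h r * ennreal (w r) * indicator {a..b} r \<partial>lborel)"
proof -
  have w_on: "w integrable_on {s..t}" if "a \<le> s" "t \<le> b" for s t
    by (rule integrable_subinterval_real[OF w_int]) (use that in auto)
  have \<theta>_a: "\<theta> a = 0" by (simp add: \<theta>_def)
  have \<theta>_diff: "\<theta> t - \<theta> s = integral {s..t} w" if "a \<le> s" "s \<le> t" "t \<le> b" for s t
  proof -
    have "integral {a..s} w + integral {s..t} w = integral {a..t} w"
      using that by (intro Henstock_Kurzweil_Integration.integral_combine w_on) auto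
    then show ?thesis by (simp add: \<theta>_def)
  qed
  have \<theta>_mono: "\<theta> s \<le> \<theta> t" if "a \<le> s" "s \<le> t" "t \<le> b" for s t
    using \<theta>_diff[OF that] integral_nonneg[OF w_on[of s t]] w_nonneg that by auto
  have \<theta>_cont: "continuous_on {a..b} \<theta>"
    unfolding \<theta>_def by (rule indefinite_integral_continuous_1[OF w_int])
  \<comment> \<open>The minimum with \<open>\<theta> b\<close> keeps the set nonempty, and \<open>\<rho>\<close> monotone, for all real arguments.\<close>
  define S where "S \<tau> = {r \<in> {a..b}. min \<tau> (\<theta> b) \<le> \<theta> r}" for \<tau>
  define \<rho> where "\<rho> \<tau> = Inf (S \<tau>)" for \<tau>
  have S_closed: "closed (S \<tau>)" for \<tau>
  proof -
    have "S \<tau> = {a..b} \<inter> \<theta> -` {min \<tau> (\<theta> b)..}"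
      by (auto simp: S_def)
    then show ?thesis
      using continuous_closed_preimage[OF \<theta>_cont, of "{min \<tau> (\<theta> b)..}"] by simp
  qed
  have b_S: "b \<in> S \<tau>" for \<tau>
    using ab by (auto simp: S_def)
  have S_bdd: "bdd_below (S \<tau>)" for \<tau>
    by (rule bdd_belowI[of _ a]) (auto simp: S_def)
  have \<rho>_S: "\<rho> \<tau> \<in> S \<tau>" for \<tau>
    unfolding \<rho>_def using b_S by (intro closed_contains_Inf S_bdd S_closed) auto
  have \<rho>_ab: "\<rho> \<tau> \<in> {a..b}" for \<tau>
    using \<rho>_S[of \<tau>] by (simp add: S_def)
  have \<rho>_le: "\<rho> \<tau> \<le> r" if "r \<in> S \<tau>" for \<tau> r
    unfolding \<rho>_def using that by (rule cInf_lower[OF _ S_bdd])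
  have galois: "\<rho> \<tau> \<le> r \<longleftrightarrow> \<tau> \<le> \<theta> r" if "\<tau> \<in> {0..\<theta> b}" "r \<in> {a..b}" for \<tau> r
  proof
    assume "\<rho> \<tau> \<le> r"
    then have "\<theta> (\<rho> \<tau>) \<le> \<theta> r"
      using \<rho>_ab[of \<tau>] that by (intro \<theta>_mono) auto
    then show "\<tau> \<le> \<theta> r" using \<rho>_S[of \<tau>] that by (auto simp: S_def)
  next
    assume "\<tau> \<le> \<theta> r"
    then show "\<rho> \<tau> \<le> r" using that by (intro \<rho>_le) (auto simp: S_def)
  qed
  have \<theta>_\<rho>: "\<theta> (\<rho> \<tau>) = \<tau>" if \<tau>: "\<tau> \<in> {0..\<theta> b}" for \<tau>
  proof (rule antisym)
    show "\<tau> \<le> \<theta> (\<rho> \<tau>)" using \<rho>_S[of \<tau>] \<tau> by (auto simp: S_def)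
    have "continuous_on {a..\<rho> \<tau>} \<theta>"
      by (rule continuous_on_subset[OF \<theta>_cont]) (use \<rho>_ab[of \<tau>] in auto)
    then obtain r where r: "a \<le> r" "r \<le> \<rho> \<tau>" "\<theta> r = \<tau>"
      using IVT'[of \<theta> a \<tau> "\<rho> \<tau>"] \<theta>_a \<tau> \<open>\<tau> \<le> \<theta> (\<rho> \<tau>)\<close> \<rho>_ab[of \<tau>] by auto
    then have "\<rho> \<tau> \<le> r" using galois[OF \<tau>, of r] \<rho>_ab[of \<tau>] by auto
    then show "\<theta> (\<rho> \<tau>) \<le> \<tau>" using r by simp
  qed
  have strict: "\<rho> \<sigma> < \<rho> \<tau>" if "0 \<le> \<sigma>" "\<sigma> < \<tau>" "\<tau> \<le> \<theta> b" for \<sigma> \<tau>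
  proof (rule ccontr)
    assume "\<not> \<rho> \<sigma> < \<rho> \<tau>"
    then have "\<tau> \<le> \<theta> (\<rho> \<sigma>)" using galois[of \<tau> "\<rho> \<sigma>"] \<rho>_ab[of \<sigma>] that by auto
    then show False using \<theta>_\<rho>[of \<sigma>] that by auto
  qed
  have "mono \<rho>"
    by (rule monoI, rule \<rho>_le) (use \<rho>_S in \<open>fastforce simp: S_def\<close>)
  then have \<rho>_borel[measurable]: "\<rho> \<in> borel_measurable borel"
    by (rule borel_measurable_mono)
  define M where "M = distr (density lborel (indicator {0..\<theta> b})) borel \<rho>"
  define N where "N = density lborel (\<lambda>r. ennreal (w r) * indicator {a..b} r)"
  have "M = N"
  proof (rule measure_eqI_lessThan)
    show "sets M = sets borel" "sets N = sets borel"
      by (simp_all add: M_def N_def)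
    fix x :: real
    define x' where "x' = max a (min b x)"
    have x': "a \<le> x'" "x' \<le> b" using ab by (auto simp: x'_def)
    have "emeasure M {x<..} = emeasure (density lborel (indicator {0..\<theta> b})) (\<rho> -` {x<..})"
      unfolding M_def by (subst emeasure_distr) auto
    also have "\<dots> = emeasure lborel ({0..\<theta> b} \<inter> \<rho> -` {x<..})"
      by (subst emeasure_density)
        (auto simp: measurable_sets_borel[OF \<rho>_borel] simp flip: indicator_inter_arith
          intro!: trans[OF nn_integral_indicator])
    also have "\<dots> = ennreal (\<theta> b - \<theta> x')"
    proof (cases "x < a")
      case True
      have "x < \<rho> \<tau>" for \<tau> using \<rho>_ab[of \<tau>] True by auto
      then have "{0..\<theta> b} \<inter> \<rho> -` {x<..} = {0..\<theta> b}" by auto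
      moreover have "0 \<le> \<theta> b" using \<theta>_mono[of a b] \<theta>_a ab by simp
      ultimately show ?thesis using True \<theta>_a ab by (simp add: x'_def)
    next
      case False
      then have "{0..\<theta> b} \<inter> \<rho> -` {x<..} = {\<theta> x'<..\<theta> b}"
      proof (cases "x \<le> b")
        case True
        then have "x' = x" "x \<in> {a..b}" using False by (auto simp: x'_def)
        then have g: "\<tau> \<in> {0..\<theta> b} \<Longrightarrow> \<rho> \<tau> \<le> x \<longleftrightarrow> \<tau> \<le> \<theta> x'" for \<tau>
          using galois[of \<tau> x] by simp
        have p: "0 \<le> \<theta> x'" using \<theta>_mono[of a x'] \<theta>_a x' by simp
        show ?thesis
        proof (rule set_eqI)
          fix \<tau>
          show "\<tau> \<in> {0..\<theta> b} \<inter> \<rho> -` {x<..} \<longleftrightarrow> \<tau> \<in> {\<theta> x'<..\<theta> b}"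
            using g[of \<tau>] p by (cases "\<tau> \<in> {0..\<theta> b}") (auto simp: not_le[symmetric])
        qed
      next
        case b: False
        then have "x' = b" using ab by (simp add: x'_def)
        moreover have "\<rho> \<tau> < x" for \<tau> using \<rho>_ab[of \<tau>] b by auto
        ultimately show ?thesis by (auto simp: not_less less_imp_le intro: less_asym)
      qed
      then show ?thesis using \<theta>_mono[of x' b] x' by simp
    qed
    finally have M: "emeasure M {x<..} = ennreal (\<theta> b - \<theta> x')" .
    have "emeasure N {x<..} = (\<integral>\<^sup>+ r. ennreal (w r) * indicator {a..b} r * indicator {x<..} r \<partial>lborel)"
      unfolding N_def by (subst emeasure_density) auto
    also have "\<dots> = (\<integral>\<^sup>+ r. ennreal (w r) * indicator {x'..b} r \<partial>lborel)"
      by (rule nn_integral_cong_AE)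
        (use AE_lborel_singleton[of x'] AE_lborel_singleton[of b] in \<open>eventually_elim, auto simp: indicator_def x'_def\<close>)
    also have "\<dots> = ennreal (integral {x'..b} w)"
      by (rule nn_integral_has_integral_lebesgue'[OF _ integrable_integral[OF w_on]]) (use w_nonneg x' in auto)
    also have "\<dots> = ennreal (\<theta> b - \<theta> x')"
      using \<theta>_diff[of x' b] x' by simp
    finally show "emeasure M {x<..} = emeasure N {x<..}" "emeasure M {x<..} < \<infinity>"
      using M by simp_all
  qed
  have push: "(\<integral>\<^sup>+ \<tau>. h (\<rho> \<tau>) * indicator {0..\<theta> b} \<tau> \<partial>lborel) = (\<integral>\<^sup>+ r. h r * ennreal (w r) * indicator {a..b} r \<partial>lborel)"
    if h[measurable]: "h \<in> borel_measurable borel" for h :: "real \<Rightarrow> ennreal"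
  proof -
    have "(\<integral>\<^sup>+ \<tau>. h (\<rho> \<tau>) * indicator {0..\<theta> b} \<tau> \<partial>lborel) = (\<integral>\<^sup>+ r. h r \<partial>M)"
      unfolding M_def by (subst nn_integral_distr) (auto simp: nn_integral_density mult.commute)
    also have "\<dots> = (\<integral>\<^sup>+ r. h r * ennreal (w r) * indicator {a..b} r \<partial>lborel)"
      unfolding \<open>M = N\<close> N_def by (subst nn_integral_density) (auto simp: mult_ac)
    finally show ?thesis .
  qed
  show ?thesis
    by (rule that[OF \<rho>_borel \<rho>_ab galois strict push])
qed

lemma integrable_on_if_borel_bound:
  fixes f :: "real \<Rightarrow> real"
  assumes f: "f \<in> borel_measurable borel" and F: "F integrable_on {a..b}"
    and le: "\<And>r. r \<in> {a..b} \<Longrightarrow> \<bar>f r\<bar> \<le> F r"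
  shows "f integrable_on {a..b}"
proof (rule set_lebesgue_integral_eq_integral(1))
  show "f absolutely_integrable_on {a..b}"
    by (rule measurable_bounded_by_integrable_imp_absolutely_integrable[OF _ _ F])
      (use f le in \<open>auto intro!: measurable_restrict_space1 measurable_completion\<close>)
qed

section \<open>The value function as an infimum of actions\<close>

text \<open>The hypotheses in the form in which they are used: lower semicontinuity for the metric, and a coercivity
constant small enough for the kinetic term to compensate the Hardy constant \<open>4 \<epsilon>\<^sup>2\<close>.\<close>

locale wed_setting =
  fixes \<phi> :: "'a::metric_space \<Rightarrow> ereal" and u0 :: 'a and A B \<epsilon> :: real
  assumes closed_sublevels: "\<And>y. closed {x. \<phi> x \<le> y}"
    and not_MInf: "\<And>x. \<phi> x \<noteq> - \<infinity>"
    and B_nonneg: "0 \<le> B"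
    and coercive: "\<And>u v. \<phi> u \<ge> ereal (- B * (dist u v)\<^sup>2 - (B * (dist v u0)\<^sup>2 + A))"
    and eps_pos: "\<epsilon> > 0"
    and B_small: "8 * \<epsilon> * B \<le> 1"
begin

definition Q :: "'a \<Rightarrow> real" where "Q v = B * (dist v u0)\<^sup>2 + A"

text \<open>The factor \<open>1 / \<epsilon>\<close> of the weight is distributed over the bracket, so that the action of a curve with its metric
derivative equals the functional.\<close>

definition lagrangian :: "(real \<Rightarrow> 'a) \<Rightarrow> (real \<Rightarrow> real) \<Rightarrow> real \<Rightarrow> real" where
  "lagrangian c k t = exp (- t / \<epsilon>) * ((k t)\<^sup>2 / 2 + real_of_ereal (\<phi> (c t)) / \<epsilon>)"

text \<open>A competitor is a curve together with any bound for its speed. Since the action increases with the speed,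
the infimum over such pairs is the value function, and metric derivatives of composite curves need not be
computed.\<close>

definition speed_majorant :: "(real \<Rightarrow> 'a) \<Rightarrow> (real \<Rightarrow> real) \<Rightarrow> bool" where
  "speed_majorant c k \<longleftrightarrow> weighted_L2 \<epsilon> k \<and>
     (\<forall>s t. 0 \<le> s \<longrightarrow> s \<le> t \<longrightarrow> dist (c s) (c t) \<le> integral {s..t} k)"

definition finite_action :: "(real \<Rightarrow> 'a) \<Rightarrow> (real \<Rightarrow> real) \<Rightarrow> bool" where
  "finite_action c k \<longleftrightarrow> speed_majorant c k \<and>
     (AE t in lborel. 0 \<le> t \<longrightarrow> \<bar>\<phi> (c t)\<bar> \<noteq> \<infinity>) \<and>
     lagrangian c k absolutely_integrable_on {0..}"

definition action :: "(real \<Rightarrow> 'a) \<Rightarrow> (real \<Rightarrow> real) \<Rightarrow> real" where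
  "action c k = integral {0..} (lagrangian c k)"

text \<open>Continuity holds on every \<open>[0, b]\<close> and is a local property.\<close>

lemma speed_majorant_continuous:
  assumes "speed_majorant c k"
  shows "continuous_on {0..} c"
proof -
  have "continuous_on {0..b} c" if "0 \<le> b" for b
  proof (rule continuous_on_if_speed)
    show "k integrable_on {0..b}"
      using assms weighted_L2_local(2)[OF _ eps_pos order_refl, of k b]
      by (auto simp: speed_majorant_def intro: set_lebesgue_integral_eq_integral(1))
  qed (use assms in \<open>auto simp: speed_majorant_def\<close>)
  then have "continuous (at t within {0..t+1}) c" if "0 \<le> t" for t
    using that by (auto simp: continuous_on_eq_continuous_within)
  moreover have "at t within {0..t+1} = at t within {0..}" for t :: real
    by (rule at_within_nhd[of t "{..<t+1}"]) auto
  ultimately show ?thesis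
    by (auto simp: continuous_on_eq_continuous_within)
qed

lemma phi_measurable:
  fixes c :: "real \<Rightarrow> 'a"
  assumes "continuous_on {0..} c"
  shows "(\<lambda>t. \<phi> (c t)) \<in> borel_measurable (lebesgue_on {0..})"
proof -
  have "(\<lambda>t. \<phi> (c t)) \<in> borel_measurable (restrict_space borel {0..})"
    by (rule borel_measurable_lsc_along_curve[OF _ assms]) (auto simp: closed_sublevels)
  moreover have "id \<in> measurable (lebesgue_on {0..}) (restrict_space borel {0..})"
    by (intro measurable_restrict_space3) (auto simp: id_def intro!: measurable_completion)
  ultimately show ?thesis
    using measurable_compose[of id "lebesgue_on {0..}" "restrict_space borel {0..}" "\<lambda>t. \<phi> (c t)" borel]
    by simp
qed

definition integrand :: "(real \<Rightarrow> 'a) \<Rightarrow> (real \<Rightarrow> real) \<Rightarrow> real \<Rightarrow> ereal" where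
  "integrand c k t = ereal (\<epsilon> / 2 * (k t)\<^sup>2) + \<phi> (c t)"

lemma wed_functional_eq: "wed_functional \<phi> \<epsilon> c = ext_integral (wed_measure \<epsilon>) (integrand c (metric_deriv {0..} c))"
  unfolding wed_functional_def integrand_def ..

lemma integrand_measurable:
  assumes c: "speed_majorant c k"
  shows "integrand c k \<in> borel_measurable (lebesgue_on {0<..})"
proof -
  have "k \<in> borel_measurable (lebesgue_on {0..})"
    using c weighted_L2_measurable[OF _ eps_pos] by (auto simp: speed_majorant_def)
  moreover have "(\<lambda>t. \<phi> (c t)) \<in> borel_measurable (lebesgue_on {0..})"
    by (rule phi_measurable[OF speed_majorant_continuous[OF c]])
  ultimately have "integrand c k \<in> borel_measurable (lebesgue_on {0..})"
    unfolding integrand_def by measurable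
  then show ?thesis by (rule measurable_lebesgue_on_Ioi)
qed

lemma phi_lower_bound: "ereal (- (B * (dist u v)\<^sup>2 + Q v)) \<le> \<phi> u"
proof -
  have "- B * (dist u v)\<^sup>2 - (B * (dist v u0)\<^sup>2 + A) = - (B * (dist u v)\<^sup>2 + Q v)"
    by (simp add: Q_def)
  then show ?thesis using coercive[of u v] by (simp only:)
qed

lemma exp_dist_integrable:
  assumes c: "speed_majorant c k"
  shows "(\<lambda>t. exp (- t / \<epsilon>) * (dist (c t) (c 0))\<^sup>2) absolutely_integrable_on {0..}"
    and "integral {0..} (\<lambda>t. exp (- t / \<epsilon>) * (dist (c t) (c 0))\<^sup>2)
       \<le> 4 * \<epsilon>\<^sup>2 * integral {0..} (\<lambda>t. exp (- t / \<epsilon>) * (k t)\<^sup>2)"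
proof -
  have k: "weighted_L2 \<epsilon> k" using c by (simp add: speed_majorant_def)
  have cont: "continuous_on {0..} (\<lambda>t. dist (c t) (c 0))"
    by (intro continuous_intros speed_majorant_continuous[OF c])
  have le: "dist (c t) (c 0) \<le> integral {0..t} k" if "0 \<le> t" for t
    using c that unfolding speed_majorant_def by (metis dist_commute order_refl)
  show "(\<lambda>t. exp (- t / \<epsilon>) * (dist (c t) (c 0))\<^sup>2) absolutely_integrable_on {0..}"
    "integral {0..} (\<lambda>t. exp (- t / \<epsilon>) * (dist (c t) (c 0))\<^sup>2)
       \<le> 4 * \<epsilon>\<^sup>2 * integral {0..} (\<lambda>t. exp (- t / \<epsilon>) * (k t)\<^sup>2)"
    using Hardy_exponential[OF k eps_pos cont _ le] by auto
qed

text \<open>The coercivity bound with \<open>v = c 0\<close> is quadratic in the distance from the starting point, whose weighted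
square is integrable by the Hardy inequality.\<close>

lemma integrand_negative_part:
  assumes c: "speed_majorant c k"
  shows "(\<integral>\<^sup>+ t. e2ennreal (- integrand c k t) \<partial>wed_measure \<epsilon>) < \<infinity>"
proof -
  define h where "h t = B * (dist (c t) (c 0))\<^sup>2 + \<bar>Q (c 0)\<bar>" for t
  have "(\<lambda>t. B / \<epsilon> * (exp (- t / \<epsilon>) * (dist (c t) (c 0))\<^sup>2) + \<bar>Q (c 0)\<bar> / \<epsilon> * exp (- t / \<epsilon>)) absolutely_integrable_on {0..}"
    by (intro set_integral_add(1) set_integrable_mult_right exp_dist_integrable(1)[OF c] exp_decay_integral(2) eps_pos)
  then have "(\<lambda>t. exp (- t / \<epsilon>) / \<epsilon> * h t) absolutely_integrable_on {0..}"
    by (simp add: h_def algebra_simps)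
  moreover have "h \<in> borel_measurable (lebesgue_on {0<..})"
    unfolding h_def
    by (intro measurable_lebesgue_on_Ioi continuous_imp_measurable_on_sets_lebesgue continuous_intros
        speed_majorant_continuous[OF c]) auto
  ultimately have h: "integrable (wed_measure \<epsilon>) h"
    by (subst wed_measure_integral(1)[OF eps_pos])
  have "(\<integral>\<^sup>+ t. e2ennreal (- integrand c k t) \<partial>wed_measure \<epsilon>) \<le> (\<integral>\<^sup>+ t. ennreal (norm (h t)) \<partial>wed_measure \<epsilon>)"
  proof (rule nn_integral_mono)
    fix t
    have "ereal (- h t) \<le> ereal (- (B * (dist (c t) (c 0))\<^sup>2 + Q (c 0)))"
      by (simp add: h_def)
    also have "\<dots> \<le> \<phi> (c t)" by (rule phi_lower_bound)
    also have "\<dots> \<le> integrand c k t"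
      unfolding integrand_def using eps_pos by (cases "\<phi> (c t)") auto
    finally have "- integrand c k t \<le> ereal (h t)"
      using ereal_uminus_le_reorder by fastforce
    also have "\<dots> \<le> ereal (norm (h t))" by simp
    finally have "e2ennreal (- integrand c k t) \<le> e2ennreal (ereal (norm (h t)))"
      by (rule e2ennreal_mono)
    then show "e2ennreal (- integrand c k t) \<le> ennreal (norm (h t))"
      by simp
  qed
  also have "\<dots> < \<infinity>" using h by (simp only: integrable_iff_bounded)
  finally show ?thesis .
qed

lemma integrand_lagrangian:
  assumes "\<bar>\<phi> (c t)\<bar> \<noteq> \<infinity>"
  shows "exp (- t / \<epsilon>) / \<epsilon> * real_of_ereal (integrand c k t) = lagrangian c k t"
proof -
  obtain r where "\<phi> (c t) = ereal r" using assms by auto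
  then show ?thesis
    using eps_pos by (simp add: integrand_def lagrangian_def field_simps)
qed

lemma ext_integral_if_finite_action:
  assumes c: "finite_action c k"
  shows "ext_integral (wed_measure \<epsilon>) (integrand c k) = ereal (action c k)"
proof -
  have sm: "speed_majorant c k" and fin: "AE t in lborel. 0 \<le> t \<longrightarrow> \<bar>\<phi> (c t)\<bar> \<noteq> \<infinity>"
    and lag: "lagrangian c k absolutely_integrable_on {0..}"
    using c by (simp_all add: finite_action_def)
  have fin': "AE t in wed_measure \<epsilon>. \<bar>integrand c k t\<bar> \<noteq> \<infinity>"
    unfolding AE_wed_measure[OF eps_pos] using fin
    by eventually_elim (auto simp: integrand_def)
  have meas: "(\<lambda>t. real_of_ereal (integrand c k t)) \<in> borel_measurable (lebesgue_on {0<..})"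
    using integrand_measurable[OF sm] by simp
  have eq: "AE t in lborel. t \<in> {0..} \<longrightarrow> lagrangian c k t = exp (- t / \<epsilon>) / \<epsilon> * real_of_ereal (integrand c k t)"
    using fin by eventually_elim (metis atLeast_iff integrand_lagrangian)
  have "(\<lambda>t. exp (- t / \<epsilon>) / \<epsilon> * real_of_ereal (integrand c k t)) absolutely_integrable_on {0..}"
    and int_eq: "integral {0..} (\<lambda>t. exp (- t / \<epsilon>) / \<epsilon> * real_of_ereal (integrand c k t)) = action c k"
  proof -
    have eq': "AE t in lborel. t \<in> {0..} \<longrightarrow> \<bar>lagrangian c k t\<bar> = \<bar>exp (- t / \<epsilon>) / \<epsilon> * real_of_ereal (integrand c k t)\<bar>"
      using eq by eventually_elim auto
    show "(\<lambda>t. exp (- t / \<epsilon>) / \<epsilon> * real_of_ereal (integrand c k t)) absolutely_integrable_on {0..}"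
      using lag has_integral_AE[OF eq] has_integral_AE[OF eq']
      unfolding absolutely_integrable_on_def integrable_on_def real_norm_def by blast
    show "integral {0..} (\<lambda>t. exp (- t / \<epsilon>) / \<epsilon> * real_of_ereal (integrand c k t)) = action c k"
      unfolding action_def
      using has_integral_AE[OF eq, THEN iffD1, OF integrable_integral[OF set_lebesgue_integral_eq_integral(1)[OF lag]]]
      by (rule integral_unique)
  qed
  then have int: "integrable (wed_measure \<epsilon>) (\<lambda>t. real_of_ereal (integrand c k t))"
    by (subst wed_measure_integral(1)[OF eps_pos meas])
  show ?thesis
    using ext_integral_eq_integral[OF fin' int] wed_measure_integral(2)[OF eps_pos meas int] int_eq by simp
qed

lemma finite_action_if_ext_integral_finite:
  assumes c: "speed_majorant c k" and fin: "ext_integral (wed_measure \<epsilon>) (integrand c k) < \<infinity>"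
  shows "finite_action c k"
proof -
  have meas: "integrand c k \<in> borel_measurable (wed_measure \<epsilon>)"
    using integrand_measurable[OF c] by (simp add: borel_measurable_wed_measure)
  note int = integrable_if_ext_integral_finite[OF meas integrand_negative_part[OF c] fin]
  have ae: "AE t in lborel. 0 \<le> t \<longrightarrow> \<bar>\<phi> (c t)\<bar> \<noteq> \<infinity>"
    using int(1) unfolding AE_wed_measure[OF eps_pos]
    by eventually_elim (auto simp: integrand_def)
  have meas': "(\<lambda>t. real_of_ereal (integrand c k t)) \<in> borel_measurable (lebesgue_on {0<..})"
    using integrand_measurable[OF c] by simp
  have abs: "(\<lambda>t. exp (- t / \<epsilon>) / \<epsilon> * real_of_ereal (integrand c k t)) absolutely_integrable_on {0..}"
    using int(2) by (subst (asm) wed_measure_integral(1)[OF eps_pos meas'])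
  have eq: "AE t in lborel. t \<in> {0..} \<longrightarrow> exp (- t / \<epsilon>) / \<epsilon> * real_of_ereal (integrand c k t) = lagrangian c k t"
    using ae by eventually_elim (metis atLeast_iff integrand_lagrangian)
  have eq': "AE t in lborel. t \<in> {0..} \<longrightarrow> \<bar>exp (- t / \<epsilon>) / \<epsilon> * real_of_ereal (integrand c k t)\<bar> = \<bar>lagrangian c k t\<bar>"
    using eq by eventually_elim auto
  have "lagrangian c k absolutely_integrable_on {0..}"
    using abs has_integral_AE[OF eq] has_integral_AE[OF eq']
    unfolding absolutely_integrable_on_def integrable_on_def real_norm_def by blast
  with c ae show ?thesis by (simp add: finite_action_def)
qed

text \<open>The metric derivative is the smallest admissible speed, so the functional is at most the action.\<close>

lemma value_fun_le_action:
  assumes c: "finite_action c k" and c0: "c 0 = x"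
  shows "value_fun \<phi> \<epsilon> x \<le> ereal (action c k)"
proof -
  have k: "weighted_L2 \<epsilon> k" and bound: "\<And>s t. 0 \<le> s \<Longrightarrow> s \<le> t \<Longrightarrow> dist (c s) (c t) \<le> integral {s..t} k"
    using c by (simp_all add: finite_action_def speed_majorant_def)
  have W: "c \<in> wed_curves \<epsilon> x"
    "AE t in lborel. 0 \<le> t \<longrightarrow> 0 \<le> metric_deriv {0..} c t \<and> metric_deriv {0..} c t \<le> k t"
    using wed_curves_I[where c = c and x = x and k = k and \<epsilon> = \<epsilon>] eps_pos c0 k bound by blast+
  have "value_fun \<phi> \<epsilon> x \<le> wed_functional \<phi> \<epsilon> c"
    unfolding value_fun_def using W(1) by (rule INF_lower)
  also have "\<dots> \<le> ext_integral (wed_measure \<epsilon>) (integrand c k)"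
    unfolding wed_functional_eq
  proof (rule ext_integral_mono_AE)
    show "AE t in wed_measure \<epsilon>. integrand c (metric_deriv {0..} c) t \<le> integrand c k t"
      unfolding AE_wed_measure[OF eps_pos] using W(2)
    proof eventually_elim
      case (elim t)
      show ?case
      proof
        assume "0 \<le> t"
        then have "(metric_deriv {0..} c t)\<^sup>2 \<le> (k t)\<^sup>2"
          using elim by (intro power_mono) auto
        then have "ereal (\<epsilon> / 2 * (metric_deriv {0..} c t)\<^sup>2) \<le> ereal (\<epsilon> / 2 * (k t)\<^sup>2)"
          using eps_pos by simp
        then show "integrand c (metric_deriv {0..} c) t \<le> integrand c k t"
          unfolding integrand_def by (rule add_right_mono)
      qed
    qed
  qed
  also have "\<dots> = ereal (action c k)" by (rule ext_integral_if_finite_action[OF c])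
  finally show ?thesis .
qed

definition curve_speed :: "(real \<Rightarrow> 'a) \<Rightarrow> real \<Rightarrow> real" where
  "curve_speed c t = (if 0 \<le> t then \<bar>metric_deriv {0..} c t\<bar> else 0)"

lemma wed_curve_finite_action:
  assumes c: "c \<in> wed_curves \<epsilon> x" and fin: "wed_functional \<phi> \<epsilon> c < \<infinity>"
  shows "finite_action c (curve_speed c)" "wed_functional \<phi> \<epsilon> c = ereal (action c (curve_speed c))" "c 0 = x"
proof -
  note W = wed_curves_weighted_L2[OF eps_pos c, folded curve_speed_def]
  show "c 0 = x" by (rule W(1))
  have sm: "speed_majorant c (curve_speed c)"
    unfolding speed_majorant_def using W(2,3) by blast
  have "AE t in wed_measure \<epsilon>. integrand c (metric_deriv {0..} c) t = integrand c (curve_speed c) t"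
    unfolding AE_wed_measure[OF eps_pos] by (simp add: integrand_def curve_speed_def)
  then have "AE t in wed_measure \<epsilon>. integrand c (metric_deriv {0..} c) t \<le> integrand c (curve_speed c) t"
    "AE t in wed_measure \<epsilon>. integrand c (curve_speed c) t \<le> integrand c (metric_deriv {0..} c) t"
    by auto
  then have eq: "wed_functional \<phi> \<epsilon> c = ext_integral (wed_measure \<epsilon>) (integrand c (curve_speed c))"
    unfolding wed_functional_eq by (intro antisym ext_integral_mono_AE)
  show fa: "finite_action c (curve_speed c)"
    using finite_action_if_ext_integral_finite[OF sm] fin eq by simp
  show "wed_functional \<phi> \<epsilon> c = ereal (action c (curve_speed c))"
    using ext_integral_if_finite_action[OF fa] eq by simp
qed

lemma value_fun_approx:
  assumes "value_fun \<phi> \<epsilon> x < z"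
  obtains c k where "finite_action c k" "c 0 = x" "ereal (action c k) < z"
proof -
  obtain c where c: "c \<in> wed_curves \<epsilon> x" "wed_functional \<phi> \<epsilon> c < z"
    using assms unfolding value_fun_def by (auto simp: INF_less_iff)
  then have fin: "wed_functional \<phi> \<epsilon> c < \<infinity>"
    using less_le_trans[of "wed_functional \<phi> \<epsilon> c" z \<infinity>] by simp
  show ?thesis
    using that[OF wed_curve_finite_action(1)[OF c(1) fin] wed_curve_finite_action(3)[OF c(1) fin]]
      wed_curve_finite_action(2)[OF c(1) fin] c(2) by simp
qed

text \<open>The Hardy inequality turns the lower bound for \<open>\<phi>\<close> into at most \<open>4 \<epsilon> B\<close> times the integral of
\<open>exp (- t / \<epsilon>) k\<^sup>2\<close>, and \<open>4 \<epsilon> B \<le> 1 / 2\<close> is the factor of the kinetic term.\<close>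

lemma action_lower_bound:
  assumes c: "finite_action c k"
  shows "- Q (c 0) \<le> action c k"
proof -
  have sm: "speed_majorant c k" and fin: "AE t in lborel. 0 \<le> t \<longrightarrow> \<bar>\<phi> (c t)\<bar> \<noteq> \<infinity>"
    and lag: "lagrangian c k absolutely_integrable_on {0..}"
    using c by (simp_all add: finite_action_def)
  let ?E = "\<lambda>t. exp (- t / \<epsilon>) * (k t)\<^sup>2" and ?D = "\<lambda>t. exp (- t / \<epsilon>) * (dist (c t) (c 0))\<^sup>2"
  have E: "(?E has_integral integral {0..} ?E) {0..}"
    using sm by (intro integrable_integral set_lebesgue_integral_eq_integral(1))
      (simp add: speed_majorant_def weighted_L2_def)
  have D: "(?D has_integral integral {0..} ?D) {0..}"
    by (intro integrable_integral set_lebesgue_integral_eq_integral(1) exp_dist_integrable(1)[OF sm])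
  have L: "(lagrangian c k has_integral action c k) {0..}"
    unfolding action_def by (intro integrable_integral set_lebesgue_integral_eq_integral(1) lag)
  \<comment> \<open>The lower bound for the action density that results from coercivity.\<close>
  define low where "low t = 1 / 2 * ?E t - B / \<epsilon> * ?D t - Q (c 0) / \<epsilon> * exp (- t / \<epsilon>)" for t
  have low: "(low has_integral (1 / 2 * integral {0..} ?E - B / \<epsilon> * integral {0..} ?D -
      Q (c 0) / \<epsilon> * (\<epsilon> * exp (- 0 / \<epsilon>)))) {0..}"
    unfolding low_def
    by (intro has_integral_diff has_integral_mult_right E D exp_decay_integral(1) eps_pos)
  \<comment> \<open>Where \<open>\<phi> (c t)\<close> is infinite the lower bound is replaced by the density itself, on a null set.\<close>
  define low' where "low' t = (if \<bar>\<phi> (c t)\<bar> \<noteq> \<infinity> then low t else lagrangian c k t)" for t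
  have "AE t in lborel. t \<in> {0..} \<longrightarrow> low t = low' t"
    using fin by eventually_elim (auto simp: low'_def)
  then have "(low' has_integral (1 / 2 * integral {0..} ?E - B / \<epsilon> * integral {0..} ?D -
      Q (c 0) / \<epsilon> * (\<epsilon> * exp (- 0 / \<epsilon>)))) {0..}"
    using low has_integral_AE by blast
  then have "1 / 2 * integral {0..} ?E - B / \<epsilon> * integral {0..} ?D - Q (c 0) / \<epsilon> * (\<epsilon> * exp (- 0 / \<epsilon>))
      \<le> action c k"
    using L
  proof (rule has_integral_le)
    fix t :: real
    show "low' t \<le> lagrangian c k t"
    proof (cases "\<bar>\<phi> (c t)\<bar> \<noteq> \<infinity>")
      case True
      then obtain r where r: "\<phi> (c t) = ereal r" by auto
      have "- (B * (dist (c t) (c 0))\<^sup>2 + Q (c 0)) \<le> r"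
        using phi_lower_bound[of "c t" "c 0"] r by simp
      then have "- (B * (dist (c t) (c 0))\<^sup>2 + Q (c 0)) / \<epsilon> \<le> r / \<epsilon>"
        using eps_pos by (intro divide_right_mono) auto
      then have "exp (- t / \<epsilon>) * ((k t)\<^sup>2 / 2 + - (B * (dist (c t) (c 0))\<^sup>2 + Q (c 0)) / \<epsilon>)
          \<le> exp (- t / \<epsilon>) * ((k t)\<^sup>2 / 2 + r / \<epsilon>)"
        by (intro mult_left_mono) auto
      moreover have "exp (- t / \<epsilon>) * ((k t)\<^sup>2 / 2 + - (B * (dist (c t) (c 0))\<^sup>2 + Q (c 0)) / \<epsilon>) = low t"
        unfolding low_def by (simp add: algebra_simps diff_divide_distrib)
      ultimately have "low t \<le> exp (- t / \<epsilon>) * ((k t)\<^sup>2 / 2 + r / \<epsilon>)"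
        by linarith
      then show ?thesis using True r by (simp add: low'_def lagrangian_def)
    qed (simp add: low'_def)
  qed
  moreover have "B / \<epsilon> * integral {0..} ?D \<le> 1 / 2 * integral {0..} ?E"
  proof -
    have "B / \<epsilon> * integral {0..} ?D \<le> B / \<epsilon> * (4 * \<epsilon>\<^sup>2 * integral {0..} ?E)"
      using B_nonneg eps_pos by (intro mult_left_mono exp_dist_integrable(2)[OF sm]) auto
    also have "\<dots> = (8 * \<epsilon> * B) * (1 / 2 * integral {0..} ?E)"
      using eps_pos by (simp add: power2_eq_square)
    also have "\<dots> \<le> 1 * (1 / 2 * integral {0..} ?E)"
      using has_integral_nonneg[OF E] by (intro mult_right_mono B_small) auto
    finally show ?thesis by simp
  qed
  ultimately show ?thesis using eps_pos by simp
qed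

lemma value_fun_lower_bound: "ereal (- Q x) \<le> value_fun \<phi> \<epsilon> x"
proof (rule ccontr)
  assume "\<not> ereal (- Q x) \<le> value_fun \<phi> \<epsilon> x"
  then have "value_fun \<phi> \<epsilon> x < ereal (- Q x)" by simp
  then show False
  proof (rule value_fun_approx)
    fix c k assume "finite_action c k" "c 0 = x" "ereal (action c k) < ereal (- Q x)"
    then show False using action_lower_bound[of c k] by simp
  qed
qed

lemma value_fun_not_MInf: "value_fun \<phi> \<epsilon> x \<noteq> - \<infinity>"
  using value_fun_lower_bound[of x] by auto

text \<open>The constant curve is a competitor with action \<open>\<phi> x\<close>.\<close>

lemma value_fun_le_phi: "value_fun \<phi> \<epsilon> x \<le> \<phi> x"
proof (cases "\<phi> x = \<infinity>")
  case False
  then obtain r where r: "\<phi> x = ereal r"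
    using not_MInf[of x] by (cases "\<phi> x") auto
  have L: "lagrangian (\<lambda>_. x) (\<lambda>_. 0) = (\<lambda>t. r / \<epsilon> * exp (- t / \<epsilon>))"
    by (simp add: lagrangian_def fun_eq_iff r)
  have "finite_action (\<lambda>_. x) (\<lambda>_. 0)"
    unfolding finite_action_def speed_majorant_def weighted_L2_def L
    by (simp add: r set_integrable_mult_right exp_decay_integral(2)[OF eps_pos, simplified])
  moreover have "action (\<lambda>_. x) (\<lambda>_. 0) = r"
    unfolding action_def L
    using integral_unique[OF has_integral_mult_right[OF exp_decay_integral(1)[OF eps_pos, of 0], of "r / \<epsilon>"]] eps_pos
    by simp
  ultimately show ?thesis
    using value_fun_le_action[of "\<lambda>_. x" "\<lambda>_. 0" x] r by simp
qed simp

section \<open>Dynamic programming\<close>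

text \<open>The discount \<open>exp (- t / \<epsilon>)\<close> factorises at time \<open>T\<close>, so that the second curve contributes its own action times
\<open>exp (- T / \<epsilon>)\<close>.\<close>

lemma value_fun_le_concatenation:
  assumes T: "0 \<le> T"
    and k: "k absolutely_integrable_on {0..T}" "(\<lambda>t. (k t)\<^sup>2) absolutely_integrable_on {0..T}"
      "\<And>t. 0 \<le> k t"
    and y: "\<And>s t. 0 \<le> s \<Longrightarrow> s \<le> t \<Longrightarrow> t \<le> T \<Longrightarrow> dist (y s) (y t) \<le> integral {s..t} k"
    and fin: "AE t in lborel. t \<in> {0..T} \<longrightarrow> \<bar>\<phi> (y t)\<bar> \<noteq> \<infinity>"
    and lag: "lagrangian y k absolutely_integrable_on {0..T}"
    and w: "finite_action w kw" "w 0 = y T"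
  shows "value_fun \<phi> \<epsilon> (y 0) \<le> ereal (integral {0..T} (lagrangian y k) + exp (- T / \<epsilon>) * action w kw)"
proof -
  define c where "c t = (if t \<le> T then y t else w (t - T))" for t
  define kc where "kc t = (if t \<le> T then k t else kw (t - T))" for t
  have wS: "weighted_L2 \<epsilon> kw" "\<And>s t. 0 \<le> s \<Longrightarrow> s \<le> t \<Longrightarrow> dist (w s) (w t) \<le> integral {s..t} kw"
    and w_fin: "AE t in lborel. 0 \<le> t \<longrightarrow> \<bar>\<phi> (w t)\<bar> \<noteq> \<infinity>"
    and w_lag: "lagrangian w kw absolutely_integrable_on {0..}"
    using w(1) by (simp_all add: finite_action_def speed_majorant_def)
  have shift_img: "(\<lambda>t. t + - T) ` {T..} = {0..}" "(\<lambda>t. t + - T) ` {T..t} = {0..t - T}" for t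
    by (simp_all only: image_shift_atLeast image_add_atLeastAtMost') simp_all
  have kc_left: "kc absolutely_integrable_on {s..t}" "integral {s..t} kc = integral {s..t} k"
    if "0 \<le> s" "t \<le> T" for s t
  proof -
    have "k absolutely_integrable_on {s..t}"
      by (rule set_integrable_subset[OF k(1)]) (use that in auto)
    then show "kc absolutely_integrable_on {s..t}"
      by (rule set_integrable_cong[THEN iffD1, rotated 3]) (use that in \<open>auto simp: kc_def\<close>)
    show "integral {s..t} kc = integral {s..t} k"
      by (rule integral_cong) (use that in \<open>auto simp: kc_def\<close>)
  qed
  have kc_right: "kc absolutely_integrable_on {T..t}" "integral {T..t} kc = integral {0..t - T} kw" for t
  proof -
    have "kw absolutely_integrable_on (\<lambda>t. t + - T) ` {T..t}"
      unfolding shift_img by (rule weighted_L2_local(2)[OF wS(1) eps_pos order_refl])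
    note sh = absolutely_integrable_shift[OF _ this]
    have eq: "kc r = kw (r + - T)" if "r \<in> {T..t}" "r \<noteq> T" for r
      using that by (auto simp: kc_def)
    show "kc absolutely_integrable_on {T..t}"
      by (rule absolutely_integrable_spike_point(1)[OF sh(1) eq]) auto
    have "integral {T..t} kc = integral {T..t} (\<lambda>r. kw (r + - T))"
      by (rule absolutely_integrable_spike_point(2)[OF sh(1) eq]) auto
    also have "\<dots> = integral {0..t - T} kw"
      using sh(2) unfolding shift_img by simp
    finally show "integral {T..t} kc = integral {0..t - T} kw" .
  qed
  have "weighted_L2 \<epsilon> kc"
    unfolding weighted_L2_def
  proof (intro conjI allI)
    show "0 \<le> kc t" for t
      using k(3) wS(1) by (auto simp: kc_def weighted_L2_def)
    show "(\<lambda>t. exp (- t / \<epsilon>) * (kc t)\<^sup>2) absolutely_integrable_on {0..}"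
    proof (rule absolutely_integrable_halfline_combine(1)[OF T])
      show "(\<lambda>t. exp (- t / \<epsilon>) * (kc t)\<^sup>2) absolutely_integrable_on {0..T}"
        by (rule set_integrable_cong[THEN iffD1, rotated 3, OF absolutely_integrable_exp_mult[OF k(2) eps_pos]])
          (auto simp: kc_def)
      have "(\<lambda>t. exp (- t / \<epsilon>) * (kw t)\<^sup>2) absolutely_integrable_on (\<lambda>t. t + - T) ` {T..}"
        using wS(1) unfolding shift_img by (simp add: weighted_L2_def)
      from absolutely_integrable_shift(1)[OF _ this]
      have "(\<lambda>t. exp (- T / \<epsilon>) * (exp (- (t + - T) / \<epsilon>) * (kw (t + - T))\<^sup>2)) absolutely_integrable_on {T..}"
        by (intro set_integrable_mult_right) auto
      then show "(\<lambda>t. exp (- t / \<epsilon>) * (kc t)\<^sup>2) absolutely_integrable_on {T..}"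
      proof (rule absolutely_integrable_spike_point(1)[where a = T])
        fix t assume t: "t \<in> {T..}" "t \<noteq> T"
        have "exp (- t / \<epsilon>) = exp (- T / \<epsilon>) * exp (- (t + - T) / \<epsilon>)"
          by (simp add: diff_divide_distrib flip: exp_add)
        then show "exp (- t / \<epsilon>) * (kc t)\<^sup>2 = exp (- T / \<epsilon>) * (exp (- (t + - T) / \<epsilon>) * (kw (t + - T))\<^sup>2)"
          using t by (simp add: kc_def)
      qed
    qed
  qed
  moreover have "dist (c s) (c t) \<le> integral {s..t} kc" if st: "0 \<le> s" "s \<le> t" for s t
  proof -
    consider "t \<le> T" | "T \<le> s" | "s \<le> T" "T \<le> t" by linarith
    then show ?thesis
    proof cases
      case 1
      then show ?thesis using y[of s t] st kc_left(2)[of s t] by (simp add: c_def)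
    next
      case 2
      have "integral {T..s} kc + integral {s..t} kc = integral {T..t} kc"
        by (rule Henstock_Kurzweil_Integration.integral_combine)
          (use 2 st kc_right(1) in \<open>auto intro: set_lebesgue_integral_eq_integral(1)\<close>)
      moreover have "integral {0..s - T} kw + integral {s - T..t - T} kw = integral {0..t - T} kw"
        by (rule Henstock_Kurzweil_Integration.integral_combine)
          (use 2 st weighted_L2_local(2)[OF wS(1) eps_pos order_refl] in \<open>auto intro: set_lebesgue_integral_eq_integral(1)\<close>)
      moreover have "c r = w (r - T)" if "T \<le> r" for r
        using that w(2) by (cases "r = T") (auto simp: c_def)
      ultimately show ?thesis
        using wS(2)[of "s - T" "t - T"] 2 st by (simp add: kc_right(2))
    next
      case 3
      have "kc absolutely_integrable_on {s..t}"
      proof -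
        have "{s..T} \<union> {T..t} = {s..t}" using 3 by auto
        then show ?thesis using set_integrable_Un[OF kc_left(1)[of s T] kc_right(1)[of t]] st by auto
      qed
      then have "integral {s..T} kc + integral {T..t} kc = integral {s..t} kc"
        using 3 by (intro Henstock_Kurzweil_Integration.integral_combine set_lebesgue_integral_eq_integral(1))
      moreover have "dist (c s) (c t) \<le> dist (y s) (y T) + dist (w 0) (w (t - T))"
      proof -
        have "c t = w (t - T)" "c s = y s" using 3 w(2) by (auto simp: c_def)
        then show ?thesis using dist_triangle[of "y s" "w (t - T)" "y T"] w(2) by simp
      qed
      ultimately show ?thesis
        using y[of s T] wS(2)[of 0 "t - T"] 3 st kc_left(2)[of s T] by (simp add: kc_right(2))
    qed
  qed
  ultimately have sm: "speed_majorant c kc"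
    by (simp add: speed_majorant_def)
  have c_fin: "AE t in lborel. 0 \<le> t \<longrightarrow> \<bar>\<phi> (c t)\<bar> \<noteq> \<infinity>"
    using fin AE_lborel_shift[OF w_fin, of "- T"]
    by eventually_elim (auto simp: c_def)
  have lag1: "lagrangian c kc absolutely_integrable_on {0..T}" "integral {0..T} (lagrangian c kc) = integral {0..T} (lagrangian y k)"
  proof -
    show "lagrangian c kc absolutely_integrable_on {0..T}"
      by (rule set_integrable_cong[THEN iffD1, rotated 3, OF lag]) (auto simp: kc_def c_def lagrangian_def)
    show "integral {0..T} (lagrangian c kc) = integral {0..T} (lagrangian y k)"
      by (rule integral_cong) (auto simp: kc_def c_def lagrangian_def)
  qed
  have lag2: "lagrangian c kc absolutely_integrable_on {T..}"
    "integral {T..} (lagrangian c kc) = exp (- T / \<epsilon>) * action w kw"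
  proof -
    have "lagrangian w kw absolutely_integrable_on (\<lambda>t. t + - T) ` {T..}"
      unfolding shift_img by (rule w_lag)
    note sh = absolutely_integrable_shift[OF _ this]
    have abs: "(\<lambda>t. exp (- T / \<epsilon>) * lagrangian w kw (t + - T)) absolutely_integrable_on {T..}"
      by (intro set_integrable_mult_right sh(1)) auto
    have eq: "lagrangian c kc t = exp (- T / \<epsilon>) * lagrangian w kw (t + - T)" if t: "t \<in> {T..}" "t \<noteq> T" for t
    proof -
      have "exp (- t / \<epsilon>) = exp (- T / \<epsilon>) * exp (- (t + - T) / \<epsilon>)"
        by (simp add: diff_divide_distrib flip: exp_add)
      then show ?thesis using t by (simp add: kc_def c_def lagrangian_def)
    qed
    show "lagrangian c kc absolutely_integrable_on {T..}"
      by (rule absolutely_integrable_spike_point(1)[OF abs eq]) auto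
    have "integral {T..} (lagrangian c kc) = integral {T..} (\<lambda>t. exp (- T / \<epsilon>) * lagrangian w kw (t + - T))"
      by (rule absolutely_integrable_spike_point(2)[OF abs eq]) auto
    also have "\<dots> = exp (- T / \<epsilon>) * integral {0..} (lagrangian w kw)"
      using sh(2) by (simp add: shift_img del: add_uminus_conv_diff)
    finally show "integral {T..} (lagrangian c kc) = exp (- T / \<epsilon>) * action w kw"
      by (simp add: action_def)
  qed
  have "finite_action c kc"
    using sm c_fin absolutely_integrable_halfline_combine(1)[OF T lag1(1) lag2(1)]
    by (simp add: finite_action_def)
  moreover have "action c kc = integral {0..T} (lagrangian y k) + exp (- T / \<epsilon>) * action w kw"
    unfolding action_def[of c kc]
    using absolutely_integrable_halfline_combine(2)[OF T lag1(1) lag2(1)] lag1(2) lag2(2) by simp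
  moreover have "c 0 = y 0" using T by (simp add: c_def)
  ultimately show ?thesis
    using value_fun_le_action[of c kc "y 0"] by simp
qed

lemma dynamic_programming:
  assumes T: "0 \<le> T"
    and k: "k absolutely_integrable_on {0..T}" "(\<lambda>t. (k t)\<^sup>2) absolutely_integrable_on {0..T}"
      "\<And>t. 0 \<le> k t"
    and y: "\<And>s t. 0 \<le> s \<Longrightarrow> s \<le> t \<Longrightarrow> t \<le> T \<Longrightarrow> dist (y s) (y t) \<le> integral {s..t} k"
    and fin: "AE t in lborel. t \<in> {0..T} \<longrightarrow> \<bar>\<phi> (y t)\<bar> \<noteq> \<infinity>"
    and lag: "lagrangian y k absolutely_integrable_on {0..T}"
    and z: "value_fun \<phi> \<epsilon> (y T) \<le> ereal z"
  shows "value_fun \<phi> \<epsilon> (y 0) \<le> ereal (integral {0..T} (lagrangian y k) + exp (- T / \<epsilon>) * z)"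
proof (rule ereal_le_epsilon2)
  fix e :: real assume e: "0 < e"
  have "value_fun \<phi> \<epsilon> (y T) < ereal (z + e)"
    using z e by (simp add: le_less_trans)
  then show "value_fun \<phi> \<epsilon> (y 0) \<le> ereal (integral {0..T} (lagrangian y k) + exp (- T / \<epsilon>) * z) + ereal e"
  proof (rule value_fun_approx)
    fix w kw assume w: "finite_action w kw" "w 0 = y T" "ereal (action w kw) < ereal (z + e)"
    have "exp (- T / \<epsilon>) * action w kw \<le> exp (- T / \<epsilon>) * (z + e)"
      using w(3) by (intro mult_left_mono) auto
    also have "\<dots> \<le> exp (- T / \<epsilon>) * z + 1 * e"
      unfolding distrib_left using T eps_pos e by (intro add_left_mono mult_right_mono) auto
    finally have le: "exp (- T / \<epsilon>) * action w kw \<le> exp (- T / \<epsilon>) * z + e" by simp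
    have "value_fun \<phi> \<epsilon> (y 0) \<le> ereal (integral {0..T} (lagrangian y k) + exp (- T / \<epsilon>) * action w kw)"
      by (rule value_fun_le_concatenation[OF T k y fin lag w(1,2)])
    also have "\<dots> \<le> ereal (integral {0..T} (lagrangian y k) + exp (- T / \<epsilon>) * z) + ereal e"
      using le by simp
    finally show ?thesis .
  qed
qed

lemma finite_action_tail:
  assumes c: "finite_action c k" and T: "0 \<le> T"
  shows "finite_action (\<lambda>t. c (t + T)) (\<lambda>t. k (t + T))"
    and "action (\<lambda>t. c (t + T)) (\<lambda>t. k (t + T)) = exp (T / \<epsilon>) * integral {T..} (lagrangian c k)"
proof -
  have cS: "weighted_L2 \<epsilon> k" "\<And>s t. 0 \<le> s \<Longrightarrow> s \<le> t \<Longrightarrow> dist (c s) (c t) \<le> integral {s..t} k"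
    and c_fin: "AE t in lborel. 0 \<le> t \<longrightarrow> \<bar>\<phi> (c t)\<bar> \<noteq> \<infinity>"
    and c_lag: "lagrangian c k absolutely_integrable_on {0..}"
    using c by (simp_all add: finite_action_def speed_majorant_def)
  have img: "(\<lambda>t. t + T) ` {0..} = {T..}"
    by (simp add: image_shift_atLeast)
  have img2: "(\<lambda>r. r + T) ` {s..t} = {s + T..t + T}" for s t
    by (rule image_add_atLeastAtMost')
  have sub: "{T..} \<subseteq> {0..}" using T by auto
  have e: "exp (T / \<epsilon>) * exp (- (t + T) / \<epsilon>) = exp (- t / \<epsilon>)" for t
    by (simp add: add_divide_distrib diff_divide_distrib flip: exp_add)
  have "(\<lambda>t. exp (- t / \<epsilon>) * (k t)\<^sup>2) absolutely_integrable_on (\<lambda>t. t + T) ` {0..}"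
    unfolding img using cS(1) sub by (auto simp: weighted_L2_def intro: set_integrable_subset)
  from absolutely_integrable_shift(1)[OF _ this]
  have "(\<lambda>t. exp (T / \<epsilon>) * (exp (- (t + T) / \<epsilon>) * (k (t + T))\<^sup>2)) absolutely_integrable_on {0..}"
    by (intro set_integrable_mult_right) auto
  then have "weighted_L2 \<epsilon> (\<lambda>t. k (t + T))"
    using cS(1) by (simp only: mult.assoc[symmetric] e weighted_L2_def) simp
  moreover have "dist (c (s + T)) (c (t + T)) \<le> integral {s..t} (\<lambda>t. k (t + T))" if st: "0 \<le> s" "s \<le> t" for s t
  proof -
    have "k absolutely_integrable_on (\<lambda>r. r + T) ` {s..t}"
      unfolding img2 using st T by (intro weighted_L2_local(2)[OF cS(1) eps_pos]) auto
    from absolutely_integrable_shift(2)[OF _ this] show ?thesis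
      using cS(2)[of "s + T" "t + T"] st T by (simp add: img2)
  qed
  ultimately have sm: "speed_majorant (\<lambda>t. c (t + T)) (\<lambda>t. k (t + T))"
    by (simp add: speed_majorant_def)
  have fin: "AE t in lborel. 0 \<le> t \<longrightarrow> \<bar>\<phi> (c (t + T))\<bar> \<noteq> \<infinity>"
    using AE_lborel_shift[OF c_fin, of T] by eventually_elim (use T in auto)
  have "lagrangian c k absolutely_integrable_on (\<lambda>t. t + T) ` {0..}"
    unfolding img by (rule set_integrable_subset[OF c_lag _ sub]) auto
  note sh = absolutely_integrable_shift[OF _ this, unfolded img]
  have eq: "lagrangian (\<lambda>t. c (t + T)) (\<lambda>t. k (t + T)) = (\<lambda>t. exp (T / \<epsilon>) * lagrangian c k (t + T))"
    unfolding lagrangian_def mult.assoc[symmetric] e ..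
  have "lagrangian (\<lambda>t. c (t + T)) (\<lambda>t. k (t + T)) absolutely_integrable_on {0..}"
    unfolding eq by (intro set_integrable_mult_right sh(1)) auto
  with sm fin show "finite_action (\<lambda>t. c (t + T)) (\<lambda>t. k (t + T))"
    by (simp add: finite_action_def)
  show "action (\<lambda>t. c (t + T)) (\<lambda>t. k (t + T)) = exp (T / \<epsilon>) * integral {T..} (lagrangian c k)"
    unfolding action_def eq using sh(2) by simp
qed

section \<open>The upper gradient inequality\<close>

text \<open>Travelling along \<open>u\<close> with speed \<open>\<nu>\<close> takes the time \<open>m / \<nu>\<close> per unit of the parameter. In the new time the
discount on \<open>[0, \<Theta>]\<close> repays \<open>z\<close> at the rate \<open>z / \<epsilon>\<close>, which leaves the running cost
\<open>\<nu>\<^sup>2 / 2 + (\<phi> - z) / \<epsilon>\<close>; its weight \<open>exp (- \<tau> / \<epsilon>) \<le> 1\<close> is harmless once it is replaced by a nonnegative upper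
bound \<open>h\<close>. Conditions are only imposed where \<open>m > 0\<close>, since parameters at which the curve rests are skipped.\<close>

lemma value_fun_along_time_change:
  fixes a b \<delta> z :: real and m \<nu> h :: "real \<Rightarrow> real" and u :: "real \<Rightarrow> 'a"
  assumes ab: "a \<le> b"
    and m[measurable]: "m \<in> borel_measurable borel" and m_nonneg: "\<And>r. 0 \<le> m r" and m_int: "m integrable_on {a..b}"
    and \<nu>[measurable]: "\<nu> \<in> borel_measurable borel" and \<delta>: "0 < \<delta>" and \<nu>_ge: "\<And>r. \<delta> \<le> \<nu> r"
    and \<nu>m_int: "(\<lambda>r. \<nu> r * m r) integrable_on {a..b}"
    and u: "\<And>s t. a \<le> s \<Longrightarrow> s \<le> t \<Longrightarrow> t \<le> b \<Longrightarrow> dist (u s) (u t) \<le> integral {s..t} m"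
    and fin: "AE r in lborel. r \<in> {a..b} \<longrightarrow> 0 < m r \<longrightarrow> \<bar>\<phi> (u r)\<bar> \<noteq> \<infinity>"
    and \<phi>_int: "(\<lambda>r. \<bar>real_of_ereal (\<phi> (u r))\<bar> * (m r / \<nu> r)) integrable_on {a..b}"
    and h[measurable]: "h \<in> borel_measurable borel" and h_nonneg: "\<And>r. 0 \<le> h r"
    and h_int: "(\<lambda>r. h r * (m r / \<nu> r)) integrable_on {a..b}"
    and h_ge: "AE r in lborel. r \<in> {a..b} \<longrightarrow> 0 < m r \<longrightarrow> (\<nu> r)\<^sup>2 / 2 + (real_of_ereal (\<phi> (u r)) - z) / \<epsilon> \<le> h r"
    and z: "value_fun \<phi> \<epsilon> (u b) \<le> ereal z"
  shows "value_fun \<phi> \<epsilon> (u a) \<le> ereal (z + integral {a..b} (\<lambda>r. h r * (m r / \<nu> r)))"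
proof -
  have \<nu>_pos: "0 < \<nu> r" for r using \<delta> \<nu>_ge[of r] by linarith
  define w where "w r = m r / \<nu> r" for r
  have w[measurable]: "w \<in> borel_measurable borel" unfolding w_def by measurable
  have w_nonneg: "0 \<le> w r" for r
    using m_nonneg[of r] \<nu>_pos[of r] by (simp add: w_def)
  have w_int: "w integrable_on {a..b}"
  proof (rule set_lebesgue_integral_eq_integral(1))
    show "w absolutely_integrable_on {a..b}"
    proof (rule measurable_bounded_by_integrable_imp_absolutely_integrable)
      show "w \<in> borel_measurable (lebesgue_on {a..b})"
        using w by (intro measurable_restrict_space1 measurable_completion) simp
      show "(\<lambda>r. 1 / \<delta> * m r) integrable_on {a..b}"
        using m_int by (rule integrable_on_mult_right)
      show "norm (w r) \<le> 1 / \<delta> * m r" for r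
        using frac_le[OF m_nonneg[of r] order_refl \<delta> \<nu>_ge[of r]] m_nonneg[of r] \<nu>_pos[of r] by (simp add: w_def)
    qed simp
  qed
  define \<Theta> where "\<Theta> = integral {a..b} w"
  obtain \<rho> :: "real \<Rightarrow> real" where \<rho>[measurable]: "\<rho> \<in> borel_measurable borel" and \<rho>_ab: "\<And>\<tau>. \<rho> \<tau> \<in> {a..b}"
    and galois: "\<And>\<tau> r. \<tau> \<in> {0..\<Theta>} \<Longrightarrow> r \<in> {a..b} \<Longrightarrow> \<rho> \<tau> \<le> r \<longleftrightarrow> \<tau> \<le> integral {a..r} w"
    and strict: "\<And>\<sigma> \<tau>. 0 \<le> \<sigma> \<Longrightarrow> \<sigma> < \<tau> \<Longrightarrow> \<tau> \<le> \<Theta> \<Longrightarrow> \<rho> \<sigma> < \<rho> \<tau>"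
    and push: "\<And>h :: real \<Rightarrow> ennreal. h \<in> borel_measurable borel \<Longrightarrow>
       (\<integral>\<^sup>+ \<tau>. h (\<rho> \<tau>) * indicator {0..\<Theta>} \<tau> \<partial>lborel) = (\<integral>\<^sup>+ r. h r * ennreal (w r) * indicator {a..b} r \<partial>lborel)"
    by (rule monotone_time_change[OF ab w w_nonneg w_int, folded \<Theta>_def]) (rule that)
  have \<Theta>: "0 \<le> \<Theta>"
    unfolding \<Theta>_def using w_nonneg w_int by (intro integral_nonneg) auto
  have push_int: "(\<lambda>\<tau>. f (\<rho> \<tau>)) absolutely_integrable_on {0..\<Theta>} \<and>
      integral {0..\<Theta>} (\<lambda>\<tau>. f (\<rho> \<tau>)) \<le> integral {a..b} (\<lambda>r. f r * w r)"
    if f[measurable]: "f \<in> borel_measurable borel" and f_nonneg: "\<And>r. 0 \<le> f r"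
      and f_int: "(\<lambda>r. f r * w r) integrable_on {a..b}" for f :: "real \<Rightarrow> real"
  proof -
    have nn: "0 \<le> f r * w r" for r using f_nonneg w_nonneg by simp
    have "(\<integral>\<^sup>+ \<tau>. ennreal (f (\<rho> \<tau>)) * indicator {0..\<Theta>} \<tau> \<partial>lborel) =
        (\<integral>\<^sup>+ r. ennreal (f r * w r) * indicator {a..b} r \<partial>lborel)"
      using push[of "\<lambda>r. ennreal (f r)"] f_nonneg w_nonneg by (simp add: ennreal_mult)
    also have "\<dots> = ennreal (integral {a..b} (\<lambda>r. f r * w r))"
      by (rule nn_integral_has_integral_lebesgue'[OF nn integrable_integral[OF f_int]])
    finally have le: "(\<integral>\<^sup>+ \<tau>. ennreal (f (\<rho> \<tau>)) * indicator {0..\<Theta>} \<tau> \<partial>lborel) \<le>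
        ennreal (integral {a..b} (\<lambda>r. f r * w r))" by simp
    have meas: "(\<lambda>\<tau>. f (\<rho> \<tau>)) \<in> borel_measurable (lebesgue_on {0..\<Theta>})"
      by (intro measurable_restrict_space1 measurable_completion) measurable
    have C: "0 \<le> integral {a..b} (\<lambda>r. f r * w r)"
      using f_int nn by (rule integral_nonneg)
    show ?thesis
      using absolutely_integrable_if_nn_integral_le[OF meas _ _ C le] f_nonneg by simp
  qed
  define y where "y \<tau> = u (\<rho> \<tau>)" for \<tau>
  define k where "k \<tau> = \<nu> (\<rho> \<tau>)" for \<tau>
  have \<nu>w: "\<nu> r * w r = m r" for r
    using \<nu>_pos[of r] by (simp add: w_def)
  have k_int: "k absolutely_integrable_on {0..\<Theta>}"
    unfolding k_def using push_int[of \<nu>] \<nu>_pos m_int by (simp add: \<nu>w less_imp_le)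
  have "(\<lambda>r. (\<nu> r)\<^sup>2 * w r) = (\<lambda>r. \<nu> r * m r)"
    by (simp add: power2_eq_square mult.assoc \<nu>w)
  then have k2_int: "(\<lambda>\<tau>. (k \<tau>)\<^sup>2) absolutely_integrable_on {0..\<Theta>}"
    unfolding k_def using push_int[of "\<lambda>r. (\<nu> r)\<^sup>2"] \<nu>m_int by simp
  \<comment> \<open>Lengths of pieces of \<open>u\<close>, expressed in the new time, yield the speed bound for \<open>y\<close> and the end point of \<open>y\<close>.\<close>
  have length: "ennreal (integral {p..q} m) =
      (\<integral>\<^sup>+ \<tau>. indicator {p<..q} (\<rho> \<tau>) * ennreal (k \<tau>) * indicator {0..\<Theta>} \<tau> \<partial>lborel)"
    if pq: "a \<le> p" "p \<le> q" "q \<le> b" for p q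
  proof -
    have "m integrable_on {p..q}"
      by (rule integrable_subinterval_real[OF m_int]) (use pq in auto)
    then have "ennreal (integral {p..q} m) = (\<integral>\<^sup>+ r. ennreal (m r) * indicator {p..q} r \<partial>lborel)"
      by (intro nn_integral_has_integral_lebesgue'[symmetric] integrable_integral m_nonneg)
    also have "\<dots> = (\<integral>\<^sup>+ r. indicator {p<..q} r * ennreal (\<nu> r) * ennreal (w r) * indicator {a..b} r \<partial>lborel)"
    proof (rule nn_integral_cong_AE)
      show "AE r in lborel. ennreal (m r) * indicator {p..q} r =
          indicator {p<..q} r * ennreal (\<nu> r) * ennreal (w r) * indicator {a..b} r"
        using AE_lborel_singleton[of p]
      proof eventually_elim
        case (elim r)
        have "ennreal (\<nu> r) * ennreal (w r) = ennreal (m r)"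
          using \<nu>w[of r] \<nu>_pos[of r] w_nonneg[of r] by (simp flip: ennreal_mult)
        then show ?case using elim pq by (auto simp: indicator_def mult.assoc)
      qed
    qed
    also have "\<dots> = (\<integral>\<^sup>+ \<tau>. indicator {p<..q} (\<rho> \<tau>) * ennreal (k \<tau>) * indicator {0..\<Theta>} \<tau> \<partial>lborel)"
      unfolding k_def by (rule push[symmetric]) measurable
    finally show ?thesis .
  qed
  have y_speed: "dist (y s) (y t) \<le> integral {s..t} k" if st: "0 \<le> s" "s \<le> t" "t \<le> \<Theta>" for s t
  proof -
    have mono: "\<rho> s \<le> \<rho> t" using strict[of s t] st by (cases "s = t") auto
    have kst: "k absolutely_integrable_on {s..t}"
      by (rule set_integrable_subset[OF k_int]) (use st in auto)
    have "ennreal (integral {\<rho> s..\<rho> t} m) =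
        (\<integral>\<^sup>+ \<tau>. indicator {\<rho> s<..\<rho> t} (\<rho> \<tau>) * ennreal (k \<tau>) * indicator {0..\<Theta>} \<tau> \<partial>lborel)"
      using \<rho>_ab mono by (intro length) auto
    also have "\<dots> \<le> (\<integral>\<^sup>+ \<tau>. ennreal (k \<tau>) * indicator {s..t} \<tau> \<partial>lborel)"
    proof (rule nn_integral_mono)
      fix \<tau> :: real
      have "\<tau> \<in> {s..t}" if "\<tau> \<in> {0..\<Theta>}" "\<rho> s < \<rho> \<tau>" "\<rho> \<tau> \<le> \<rho> t"
        using strict[of \<tau> s] strict[of t \<tau>] that st by (force simp: not_less[symmetric])
      then show "indicator {\<rho> s<..\<rho> t} (\<rho> \<tau>) * ennreal (k \<tau>) * indicator {0..\<Theta>} \<tau> \<le> ennreal (k \<tau>) * indicator {s..t} \<tau>"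
        by (auto simp: indicator_def)
    qed
    also have "\<dots> = ennreal (integral {s..t} k)"
      using \<nu>_pos by (intro nn_integral_eq_integral_if_nonneg[OF kst]) (simp add: k_def less_imp_le)
    finally have "integral {\<rho> s..\<rho> t} m \<le> integral {s..t} k"
      using \<nu>_pos by (subst (asm) ennreal_le_iff)
        (auto intro!: integral_nonneg set_lebesgue_integral_eq_integral(1) kst simp: k_def less_imp_le)
    moreover have "dist (y s) (y t) \<le> integral {\<rho> s..\<rho> t} m"
      unfolding y_def using \<rho>_ab mono by (intro u) auto
    ultimately show ?thesis by linarith
  qed
  have y0: "y 0 = u a"
  proof -
    have "\<rho> 0 \<le> a" using galois[of 0 a] \<Theta> ab by simp
    then show ?thesis using \<rho>_ab[of 0] by (simp add: y_def)
  qed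
  have y\<Theta>: "y \<Theta> = u b"
  proof -
    have "ennreal (integral {\<rho> \<Theta>..b} m) =
        (\<integral>\<^sup>+ \<tau>. indicator {\<rho> \<Theta><..b} (\<rho> \<tau>) * ennreal (k \<tau>) * indicator {0..\<Theta>} \<tau> \<partial>lborel)"
      using \<rho>_ab[of \<Theta>] by (intro length) auto
    also have "\<dots> = (\<integral>\<^sup>+ \<tau>. 0 \<partial>(lborel :: real measure))"
    proof (rule nn_integral_cong)
      fix \<tau> :: real
      have "\<rho> \<tau> \<le> \<rho> \<Theta>" if "\<tau> \<in> {0..\<Theta>}"
        using strict[of \<tau> \<Theta>] that by (cases "\<tau> = \<Theta>") auto
      then show "indicator {\<rho> \<Theta><..b} (\<rho> \<tau>) * ennreal (k \<tau>) * indicator {0..\<Theta>} \<tau> = 0"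
        by (auto simp: indicator_def)
    qed
    finally have "integral {\<rho> \<Theta>..b} m \<le> 0" by (simp add: ennreal_eq_0_iff)
    moreover have "dist (u (\<rho> \<Theta>)) (u b) \<le> integral {\<rho> \<Theta>..b} m"
      using \<rho>_ab[of \<Theta>] by (intro u) auto
    ultimately have "dist (u (\<rho> \<Theta>)) (u b) \<le> 0" by linarith
    then show ?thesis by (simp add: y_def)
  qed
  have "continuous_on {a..b} u"
    by (rule continuous_on_if_speed[OF m_int u])
  then have \<phi>u: "(\<lambda>r. \<phi> (u r)) \<in> borel_measurable (restrict_space borel {a..b})"
    by (intro borel_measurable_lsc_along_curve[of \<phi>]) (auto simp: closed_sublevels)
  define F where "F r = (if r \<in> {a..b} then \<phi> (u r) else 0)" for r
  have F[measurable]: "F \<in> borel_measurable borel"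
  proof -
    have "F \<in> borel_measurable borel \<longleftrightarrow>
        (\<lambda>r. \<phi> (u r)) \<in> borel_measurable (restrict_space borel {r. r \<in> {a..b}}) \<and>
        (\<lambda>r. 0::ereal) \<in> borel_measurable (restrict_space borel {r. r \<notin> {a..b}})"
      unfolding F_def by (rule measurable_If_restrict_space_iff) simp
    then show ?thesis using \<phi>u by (simp only: Collect_mem_eq) simp
  qed
  have F_y: "F (\<rho> \<tau>) = \<phi> (y \<tau>)" for \<tau>
    using \<rho>_ab[of \<tau>] by (simp add: F_def y_def)
  \<comment> \<open>A null set of parameters where \<open>m > 0\<close>, enlarged by all rest points, has measure \<open>0\<close> for the density \<open>w\<close>.\<close>
  have push_AE: "AE \<tau> in lborel. \<tau> \<in> {0..\<Theta>} \<longrightarrow> P (\<rho> \<tau>)"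
    if P: "AE r in lborel. r \<in> {a..b} \<longrightarrow> 0 < m r \<longrightarrow> P r" and Pm: "{r. \<not> P r} \<in> sets borel" for P
  proof -
    have [measurable]: "{r. \<not> P r} \<in> sets borel" by (rule Pm)
    have "(\<integral>\<^sup>+ \<tau>. indicator {r. \<not> P r} (\<rho> \<tau>) * indicator {0..\<Theta>} \<tau> \<partial>lborel) =
        (\<integral>\<^sup>+ r. indicator {r. \<not> P r} r * ennreal (w r) * indicator {a..b} r \<partial>lborel)"
      by (rule push) measurable
    also have "\<dots> = (\<integral>\<^sup>+ r. 0 \<partial>(lborel :: real measure))"
    proof (rule nn_integral_cong_AE)
      show "AE r in lborel. indicator {r. \<not> P r} r * ennreal (w r) * indicator {a..b} r = 0"
        using P
      proof eventually_elim
        case (elim r)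
        show ?case
        proof (cases "0 < m r")
          case False
          then have "w r = 0" using m_nonneg[of r] by (simp add: w_def)
          then show ?thesis by simp
        qed (use elim in \<open>auto simp: indicator_def\<close>)
      qed
    qed
    finally have "(\<integral>\<^sup>+ \<tau>. indicator {r. \<not> P r} (\<rho> \<tau>) * indicator {0..\<Theta>} \<tau> \<partial>lborel) = 0" by simp
    then have "AE \<tau> in lborel. indicator {r. \<not> P r} (\<rho> \<tau>) * indicator {0..\<Theta>} \<tau> = (0::ennreal)"
      by (subst (asm) nn_integral_0_iff_AE) auto
    then show ?thesis by eventually_elim (auto simp: indicator_def split: if_splits)
  qed
  have y_fin: "AE \<tau> in lborel. \<tau> \<in> {0..\<Theta>} \<longrightarrow> \<bar>\<phi> (y \<tau>)\<bar> \<noteq> \<infinity>"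
  proof -
    have "AE \<tau> in lborel. \<tau> \<in> {0..\<Theta>} \<longrightarrow> \<bar>F (\<rho> \<tau>)\<bar> \<noteq> \<infinity>"
    proof (rule push_AE)
      show "AE r in lborel. r \<in> {a..b} \<longrightarrow> 0 < m r \<longrightarrow> \<bar>F r\<bar> \<noteq> \<infinity>"
        using fin by eventually_elim (auto simp: F_def)
      show "{r. \<not> \<bar>F r\<bar> \<noteq> \<infinity>} \<in> sets borel" by measurable
    qed
    then show ?thesis by (simp add: F_y)
  qed
  have \<phi>y_int: "(\<lambda>\<tau>. real_of_ereal (\<phi> (y \<tau>))) absolutely_integrable_on {0..\<Theta>}"
  proof -
    have F_int: "(\<lambda>r. \<bar>real_of_ereal (F r)\<bar> * w r) integrable_on {a..b}"
      by (rule integrable_eq[OF \<phi>_int]) (auto simp: F_def w_def)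
    have "(\<lambda>r. \<bar>real_of_ereal (F r)\<bar>) \<in> borel_measurable borel" by measurable
    from conjunct1[OF push_int[OF this abs_ge_zero F_int]]
    have abs: "(\<lambda>\<tau>. \<bar>real_of_ereal (F (\<rho> \<tau>))\<bar>) absolutely_integrable_on {0..\<Theta>}" .
    have "(\<lambda>\<tau>. real_of_ereal (F (\<rho> \<tau>))) \<in> borel_measurable (lebesgue_on {0..\<Theta>})"
      by (intro measurable_restrict_space1 measurable_completion) measurable
    then have "(\<lambda>\<tau>. real_of_ereal (F (\<rho> \<tau>))) absolutely_integrable_on {0..\<Theta>}"
      by (rule measurable_bounded_by_integrable_imp_absolutely_integrable[OF _ _ set_lebesgue_integral_eq_integral(1)[OF abs]])
        auto
    then show ?thesis by (simp add: F_y)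
  qed
  have sum_int: "(\<lambda>\<tau>. (k \<tau>)\<^sup>2 / 2 + real_of_ereal (\<phi> (y \<tau>)) / \<epsilon>) absolutely_integrable_on {0..\<Theta>}"
    by (intro set_integral_add(1) set_integrable_divide k2_int \<phi>y_int)
  have lag: "lagrangian y k absolutely_integrable_on {0..\<Theta>}"
    unfolding lagrangian_def[abs_def] by (rule absolutely_integrable_exp_mult[OF sum_int eps_pos])
  have "value_fun \<phi> \<epsilon> (y 0) \<le> ereal (integral {0..\<Theta>} (lagrangian y k) + exp (- \<Theta> / \<epsilon>) * z)"
    by (rule dynamic_programming[OF \<Theta> k_int k2_int _ y_speed y_fin lag])
      (use \<nu>_pos z y\<Theta> in \<open>auto simp: k_def less_imp_le\<close>)
  also have "integral {0..\<Theta>} (lagrangian y k) + exp (- \<Theta> / \<epsilon>) * z \<le> z + integral {a..b} (\<lambda>r. h r * w r)"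
  proof -
    have expint: "((\<lambda>\<tau>. z / \<epsilon> * exp (- \<tau> / \<epsilon>)) has_integral (z - exp (- \<Theta> / \<epsilon>) * z)) {0..\<Theta>}"
    proof -
      have "((\<lambda>\<tau>. z / \<epsilon> * exp (- \<tau> / \<epsilon>)) has_integral (- z * exp (- \<Theta> / \<epsilon>) - (- z * exp (- 0 / \<epsilon>)))) {0..\<Theta>}"
        using eps_pos by (intro fundamental_theorem_of_calculus \<Theta>)
          (auto intro!: derivative_eq_intros simp flip: has_real_derivative_iff_has_vector_derivative)
      then show ?thesis by (simp add: algebra_simps)
    qed
    have hw: "(\<lambda>\<tau>. h (\<rho> \<tau>)) absolutely_integrable_on {0..\<Theta>}"
      "integral {0..\<Theta>} (\<lambda>\<tau>. h (\<rho> \<tau>)) \<le> integral {a..b} (\<lambda>r. h r * w r)"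
      using push_int[of h] h_nonneg h_int unfolding w_def by auto
    have le: "AE \<tau> in lborel. \<tau> \<in> {0..\<Theta>} \<longrightarrow> (k \<tau>)\<^sup>2 / 2 + (real_of_ereal (\<phi> (y \<tau>)) - z) / \<epsilon> \<le> h (\<rho> \<tau>)"
    proof -
      have "AE \<tau> in lborel. \<tau> \<in> {0..\<Theta>} \<longrightarrow> (\<nu> (\<rho> \<tau>))\<^sup>2 / 2 + (real_of_ereal (F (\<rho> \<tau>)) - z) / \<epsilon> \<le> h (\<rho> \<tau>)"
      proof (rule push_AE)
        show "AE r in lborel. r \<in> {a..b} \<longrightarrow> 0 < m r \<longrightarrow> (\<nu> r)\<^sup>2 / 2 + (real_of_ereal (F r) - z) / \<epsilon> \<le> h r"
          using h_ge by eventually_elim (auto simp: F_def)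
        show "{r. \<not> (\<nu> r)\<^sup>2 / 2 + (real_of_ereal (F r) - z) / \<epsilon> \<le> h r} \<in> sets borel" by measurable
      qed
      then show ?thesis by (simp add: F_y k_def)
    qed
    \<comment> \<open>The comparison with \<open>h\<close> holds almost everywhere; the maximum turns it into one that holds everywhere.\<close>
    define G where "G \<tau> = max (lagrangian y k \<tau> - z / \<epsilon> * exp (- \<tau> / \<epsilon>)) (h (\<rho> \<tau>))" for \<tau>
    have Gh: "AE \<tau> in lborel. \<tau> \<in> {0..\<Theta>} \<longrightarrow> h (\<rho> \<tau>) = G \<tau>"
      using le
    proof (eventually_elim, intro impI)
      fix \<tau> assume le: "\<tau> \<in> {0..\<Theta>} \<longrightarrow> (k \<tau>)\<^sup>2 / 2 + (real_of_ereal (\<phi> (y \<tau>)) - z) / \<epsilon> \<le> h (\<rho> \<tau>)" and \<tau>: "\<tau> \<in> {0..\<Theta>}"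
      have "lagrangian y k \<tau> - z / \<epsilon> * exp (- \<tau> / \<epsilon>) =
          exp (- \<tau> / \<epsilon>) * ((k \<tau>)\<^sup>2 / 2 + (real_of_ereal (\<phi> (y \<tau>)) - z) / \<epsilon>)"
        by (simp add: lagrangian_def algebra_simps diff_divide_distrib)
      also have "\<dots> \<le> exp (- \<tau> / \<epsilon>) * h (\<rho> \<tau>)"
        using le \<tau> by (intro mult_left_mono) auto
      also have "\<dots> \<le> 1 * h (\<rho> \<tau>)"
        using \<tau> eps_pos h_nonneg by (intro mult_right_mono) auto
      finally show "h (\<rho> \<tau>) = G \<tau>" by (simp add: G_def)
    qed
    have gI: "(G has_integral integral {0..\<Theta>} (\<lambda>\<tau>. h (\<rho> \<tau>))) {0..\<Theta>}"
      using has_integral_AE[OF Gh, THEN iffD1, OF integrable_integral[OF set_lebesgue_integral_eq_integral(1)[OF hw(1)]]] .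
    have lI: "((\<lambda>\<tau>. lagrangian y k \<tau> - z / \<epsilon> * exp (- \<tau> / \<epsilon>)) has_integral
        (integral {0..\<Theta>} (lagrangian y k) - (z - exp (- \<Theta> / \<epsilon>) * z))) {0..\<Theta>}"
      by (intro has_integral_diff expint integrable_integral set_lebesgue_integral_eq_integral(1) lag)
    have "integral {0..\<Theta>} (lagrangian y k) - (z - exp (- \<Theta> / \<epsilon>) * z) \<le> integral {0..\<Theta>} (\<lambda>\<tau>. h (\<rho> \<tau>))"
      by (rule has_integral_le[OF lI gI]) (simp add: G_def)
    then show ?thesis using hw(2) by linarith
  qed
  finally show ?thesis by (simp add: y0 w_def)
qed

text \<open>The speed is \<open>\<nu> = max g \<delta>\<close>. Over a piece \<open>[p, q]\<close> let \<open>S\<close> be the largest excess of \<open>V\<close> over its value at \<open>u q\<close>.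
As \<open>\<phi> = v + \<epsilon> g\<^sup>2 / 2\<close>, the running cost relative to \<open>u q\<close> is at most \<open>\<nu>\<^sup>2 / 2 + g\<^sup>2 / 2 + S / \<epsilon>\<close>; multiplied by the
time \<open>m / \<nu>\<close> the first two terms give at most \<open>(g + \<delta>) m\<close>. Taking the supremum over the starting points in
\<open>[p, q]\<close> bounds \<open>S\<close> by the integral of \<open>(g + \<delta>) m\<close> plus \<open>S\<close> times the duration divided by \<open>\<epsilon>\<close>. If the duration
is at most \<open>\<eta> \<epsilon>\<close> this can be solved for \<open>S\<close>, with a loss of \<open>1 - \<eta>\<close>; the inequality adds up over consecutive
pieces, and \<open>\<eta>\<close> tends to \<open>0\<close>.\<close>

lemma value_fun_slope_bound_truncated:
  fixes a b \<delta> vb :: real and m v g :: "real \<Rightarrow> real" and u :: "real \<Rightarrow> 'a"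
  assumes ab: "a \<le> b"
    and m[measurable]: "m \<in> borel_measurable borel" and m_nonneg: "\<And>r. 0 \<le> m r" and m_int: "m integrable_on {a..b}"
    and v[measurable]: "v \<in> borel_measurable borel"
    and g[measurable]: "g \<in> borel_measurable borel" and g_nonneg: "\<And>r. 0 \<le> g r"
    and u: "\<And>s t. a \<le> s \<Longrightarrow> s \<le> t \<Longrightarrow> t \<le> b \<Longrightarrow> dist (u s) (u t) \<le> integral {s..t} m"
    and V: "AE r in lborel. r \<in> {a..b} \<longrightarrow> 0 < m r \<longrightarrow>
        value_fun \<phi> \<epsilon> (u r) = ereal (v r) \<and> \<phi> (u r) = ereal (v r + \<epsilon> / 2 * (g r)\<^sup>2)"
    and vm: "(\<lambda>r. \<bar>v r\<bar> * m r) integrable_on {a..b}" and gm: "(\<lambda>r. g r * m r) integrable_on {a..b}"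
    and vb: "value_fun \<phi> \<epsilon> (u b) = ereal vb"
    and \<delta>: "0 < \<delta>"
  shows "value_fun \<phi> \<epsilon> (u a) \<le> ereal (vb + integral {a..b} (\<lambda>r. g r * m r + \<delta> * m r))"
proof -
  define \<nu> where "\<nu> r = max (g r) \<delta>" for r
  have \<nu>[measurable]: "\<nu> \<in> borel_measurable borel" unfolding \<nu>_def by measurable
  have \<nu>_ge: "\<delta> \<le> \<nu> r" "g r \<le> \<nu> r" and \<nu>_pos: "0 < \<nu> r" and \<nu>_le: "\<nu> r \<le> g r + \<delta>" for r
    using \<delta> g_nonneg[of r] by (auto simp: \<nu>_def)
  define w where "w r = m r / \<nu> r" for r
  have w[measurable]: "w \<in> borel_measurable borel" unfolding w_def by measurable
  have w_nonneg: "0 \<le> w r" for r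
    using m_nonneg[of r] \<nu>_pos[of r] by (simp add: w_def)
  have w_le: "w r \<le> m r / \<delta>" for r
    unfolding w_def using frac_le[OF m_nonneg[of r] order_refl \<delta> \<nu>_ge(1)[of r]] .
  have \<nu>w: "\<nu> r * w r = m r" for r
    using \<nu>_pos[of r] by (simp add: w_def)
  have \<nu>2w: "(\<nu> r)\<^sup>2 * w r = \<nu> r * m r" for r
    by (simp add: power2_eq_square mult.assoc \<nu>w)
  have g2w: "(g r)\<^sup>2 * w r \<le> g r * m r" for r
  proof -
    have "(g r)\<^sup>2 * w r = g r * (g r * w r)" by (simp add: power2_eq_square)
    also have "\<dots> \<le> g r * (\<nu> r * w r)"
      using \<nu>_ge g_nonneg w_nonneg by (intro mult_left_mono mult_right_mono) auto
    finally show ?thesis by (simp add: \<nu>w)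
  qed
  have \<nu>m: "\<nu> r * m r \<le> g r * m r + \<delta> * m r" for r
    using mult_right_mono[OF \<nu>_le m_nonneg, of r r] by (simp add: distrib_right)
  have gdm: "(\<lambda>r. g r * m r + \<delta> * m r) integrable_on {a..b}"
    by (intro integrable_add gm integrable_on_mult_right m_int)
  have \<nu>m_int: "(\<lambda>r. \<nu> r * m r) integrable_on {a..b}"
    by (rule integrable_on_if_borel_bound[OF _ gdm]) (use \<nu>m \<nu>_pos m_nonneg in \<open>auto simp: abs_mult abs_of_pos\<close>)
  have w_int: "w integrable_on {a..b}"
  proof (rule integrable_on_if_borel_bound)
    show "(\<lambda>r. m r / \<delta>) integrable_on {a..b}"
      using integrable_on_mult_right[OF m_int, of "1 / \<delta>"] by simp
  qed (use w_le w_nonneg in auto)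
  have vw_le: "\<bar>v r\<bar> * w r \<le> \<bar>v r\<bar> * m r / \<delta>" for r
    using mult_left_mono[OF w_le[of r] abs_ge_zero[of "v r"]] by simp
  have vw_int: "(\<lambda>r. \<bar>v r\<bar> * w r) integrable_on {a..b}"
  proof (rule integrable_on_if_borel_bound)
    show "(\<lambda>r. \<bar>v r\<bar> * m r / \<delta>) integrable_on {a..b}"
      using integrable_on_mult_right[OF vm, of "1 / \<delta>"] by simp
  qed (use vw_le w_nonneg in \<open>auto simp: abs_mult\<close>)
  have g2w_int: "(\<lambda>r. (g r)\<^sup>2 * w r) integrable_on {a..b}"
    by (rule integrable_on_if_borel_bound[OF _ gm]) (use g2w w_nonneg in \<open>auto simp: abs_mult\<close>)
  have \<phi>_int: "(\<lambda>r. \<bar>real_of_ereal (\<phi> (u r))\<bar> * (m r / \<nu> r)) integrable_on {a..b}"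
  proof -
    have "AE r in lborel. r \<in> {a..b} \<longrightarrow> \<bar>v r + \<epsilon> / 2 * (g r)\<^sup>2\<bar> * w r = \<bar>real_of_ereal (\<phi> (u r))\<bar> * (m r / \<nu> r)"
      using V
    proof eventually_elim
      case (elim r)
      then show ?case using m_nonneg[of r] by (cases "0 < m r") (auto simp: w_def)
    qed
    note eq = has_integral_AE[OF this]
    have "(\<lambda>r. \<bar>v r + \<epsilon> / 2 * (g r)\<^sup>2\<bar> * w r) integrable_on {a..b}"
    proof (rule integrable_on_if_borel_bound)
      show "(\<lambda>r. \<bar>v r\<bar> * w r + \<epsilon> / 2 * ((g r)\<^sup>2 * w r)) integrable_on {a..b}"
        by (intro integrable_add vw_int integrable_on_mult_right g2w_int)
      show "\<bar>\<bar>v r + \<epsilon> / 2 * (g r)\<^sup>2\<bar> * w r\<bar> \<le> \<bar>v r\<bar> * w r + \<epsilon> / 2 * ((g r)\<^sup>2 * w r)" for r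
      proof -
        have "\<bar>v r + \<epsilon> / 2 * (g r)\<^sup>2\<bar> \<le> \<bar>v r\<bar> + \<epsilon> / 2 * (g r)\<^sup>2"
          using abs_triangle_ineq[of "v r" "\<epsilon> / 2 * (g r)\<^sup>2"] eps_pos by simp
        from mult_right_mono[OF this w_nonneg[of r]] show ?thesis
          using w_nonneg[of r] by (simp add: abs_mult distrib_right mult.assoc)
      qed
    qed measurable
    then show ?thesis using eq unfolding integrable_on_def by blast
  qed
  have fin: "AE r in lborel. r \<in> {a..b} \<longrightarrow> 0 < m r \<longrightarrow> \<bar>\<phi> (u r)\<bar> \<noteq> \<infinity>"
    using V by eventually_elim auto
  have sub: "f integrable_on {p..q}" if "f integrable_on {a..b}" "a \<le> p" "q \<le> b" for f :: "real \<Rightarrow> real" and p q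
    by (rule integrable_subinterval_real[OF that(1)]) (use that in auto)
  have main: "value_fun \<phi> \<epsilon> (u p) \<le> ereal (z + integral {p..q} (\<lambda>r. h r * w r))"
    if pq: "a \<le> p" "p \<le> q" "q \<le> b" and z: "value_fun \<phi> \<epsilon> (u q) \<le> ereal z"
      and h: "h \<in> borel_measurable borel" "\<And>r. 0 \<le> h r" "(\<lambda>r. h r * w r) integrable_on {a..b}"
      and h_ge: "AE r in lborel. r \<in> {p..q} \<longrightarrow> 0 < m r \<longrightarrow> (\<nu> r)\<^sup>2 / 2 + (v r + \<epsilon> / 2 * (g r)\<^sup>2 - z) / \<epsilon> \<le> h r"
    for p q z h
    unfolding w_def
  proof (rule value_fun_along_time_change[where m = m and \<nu> = \<nu> and \<delta> = \<delta> and u = u and h = h and z = z])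
    show "AE r in lborel. r \<in> {p..q} \<longrightarrow> 0 < m r \<longrightarrow> \<bar>\<phi> (u r)\<bar> \<noteq> \<infinity>"
      using fin by eventually_elim (use pq in auto)
    show "AE r in lborel. r \<in> {p..q} \<longrightarrow> 0 < m r \<longrightarrow> (\<nu> r)\<^sup>2 / 2 + (real_of_ereal (\<phi> (u r)) - z) / \<epsilon> \<le> h r"
      using h_ge V by eventually_elim (use pq in auto)
    show "dist (u s) (u t) \<le> integral {s..t} m" if "p \<le> s" "s \<le> t" "t \<le> q" for s t
      using that pq by (intro u) auto
    show "m integrable_on {p..q}" "(\<lambda>r. \<nu> r * m r) integrable_on {p..q}"
      "(\<lambda>r. \<bar>real_of_ereal (\<phi> (u r))\<bar> * (m r / \<nu> r)) integrable_on {p..q}"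
      "(\<lambda>r. h r * (m r / \<nu> r)) integrable_on {p..q}"
      using sub[OF m_int] sub[OF \<nu>m_int] sub[OF \<phi>_int] sub[OF h(3)] pq by (auto simp: w_def)
  qed (use pq m m_nonneg \<nu> \<delta> \<nu>_ge(1) h(1,2) z in auto)
  \<comment> \<open>A crude bound that only serves to show that \<open>V\<close> is finite and bounded above along the curve.\<close>
  define h1 where "h1 r = \<bar>(\<nu> r)\<^sup>2 / 2 + (v r + \<epsilon> / 2 * (g r)\<^sup>2 - vb) / \<epsilon>\<bar>" for r
  have h1[measurable]: "h1 \<in> borel_measurable borel" unfolding h1_def by measurable
  have h1_nonneg: "0 \<le> h1 r" for r by (simp add: h1_def)
  have h1_int: "(\<lambda>r. h1 r * w r) integrable_on {a..b}"
  proof (rule integrable_on_if_borel_bound)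
    show "(\<lambda>r. 1 / 2 * (\<nu> r * m r) + 1 / \<epsilon> * (\<bar>v r\<bar> * w r) + 1 / 2 * ((g r)\<^sup>2 * w r) + \<bar>vb\<bar> / \<epsilon> * w r) integrable_on {a..b}"
      by (intro integrable_add integrable_on_mult_right \<nu>m_int vw_int g2w_int w_int)
    show "\<bar>h1 r * w r\<bar> \<le> 1 / 2 * (\<nu> r * m r) + 1 / \<epsilon> * (\<bar>v r\<bar> * w r) + 1 / 2 * ((g r)\<^sup>2 * w r) + \<bar>vb\<bar> / \<epsilon> * w r" for r
    proof -
      have "(\<nu> r)\<^sup>2 / 2 + (v r + \<epsilon> / 2 * (g r)\<^sup>2 - vb) / \<epsilon> = (\<nu> r)\<^sup>2 / 2 + v r / \<epsilon> + (g r)\<^sup>2 / 2 - vb / \<epsilon>"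
        using eps_pos by (simp add: field_simps)
      moreover have "\<bar>v r / \<epsilon>\<bar> = \<bar>v r\<bar> / \<epsilon>" "\<bar>vb / \<epsilon>\<bar> = \<bar>vb\<bar> / \<epsilon>"
        using eps_pos by auto
      moreover have "0 \<le> (\<nu> r)\<^sup>2 / 2" "0 \<le> (g r)\<^sup>2 / 2" by auto
      ultimately have "h1 r \<le> (\<nu> r)\<^sup>2 / 2 + \<bar>v r\<bar> / \<epsilon> + (g r)\<^sup>2 / 2 + \<bar>vb\<bar> / \<epsilon>"
        unfolding h1_def by linarith
      from mult_right_mono[OF this w_nonneg[of r]]
      have "h1 r * w r \<le> ((\<nu> r)\<^sup>2 / 2 + \<bar>v r\<bar> / \<epsilon> + (g r)\<^sup>2 / 2 + \<bar>vb\<bar> / \<epsilon>) * w r" .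
      also have "\<dots> = 1 / 2 * ((\<nu> r)\<^sup>2 * w r) + 1 / \<epsilon> * (\<bar>v r\<bar> * w r) + 1 / 2 * ((g r)\<^sup>2 * w r) + \<bar>vb\<bar> / \<epsilon> * w r"
        by (simp add: algebra_simps)
      finally show ?thesis
        using w_nonneg[of r] by (simp add: h1_def abs_mult \<nu>2w)
    qed
  qed measurable
  define K where "K = vb + integral {a..b} (\<lambda>r. h1 r * w r)"
  have V_le: "value_fun \<phi> \<epsilon> (u p) \<le> ereal K" if p: "a \<le> p" "p \<le> b" for p
  proof -
    have "value_fun \<phi> \<epsilon> (u p) \<le> ereal (vb + integral {p..b} (\<lambda>r. h1 r * w r))"
      by (rule main[OF p order_refl _ h1 _ h1_int]) (use vb in \<open>auto simp: h1_def\<close>)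
    also have "\<dots> \<le> ereal K"
      unfolding K_def using p w_nonneg
      by (auto intro!: integral_subset_le sub[OF h1_int] h1_int simp: h1_nonneg)
    finally show ?thesis .
  qed
  define vv where "vv p = real_of_ereal (value_fun \<phi> \<epsilon> (u p))" for p
  have V_eq: "value_fun \<phi> \<epsilon> (u p) = ereal (vv p)" if p: "a \<le> p" "p \<le> b" for p
    using V_le[OF p] value_fun_not_MInf[of "u p"] unfolding vv_def
    by (cases "value_fun \<phi> \<epsilon> (u p)") auto
  have vv_le: "vv p \<le> K" if p: "a \<le> p" "p \<le> b" for p
    using V_le[OF p] V_eq[OF p] by simp
  have vv_v: "AE r in lborel. r \<in> {a..b} \<longrightarrow> 0 < m r \<longrightarrow> v r = vv r"
    using V by eventually_elim (simp add: vv_def)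
  have local_bound: "(1 - \<eta>) * (vv p - vv q) \<le> integral {p..q} (\<lambda>r. g r * m r + \<delta> * m r)"
    if pq: "a \<le> p" "p \<le> q" "q \<le> b" and \<eta>: "integral {p..q} w \<le> \<eta> * \<epsilon>" "\<eta> < 1" for p q \<eta>
  proof -
    define S where "S = (SUP r\<in>{p..q}. vv r - vv q)"
    have bdd: "bdd_above ((\<lambda>r. vv r - vv q) ` {p..q})"
      using vv_le pq by (intro bdd_aboveI[of _ "K - vv q"]) auto
    have S_ge: "vv r - vv q \<le> S" if "r \<in> {p..q}" for r
      unfolding S_def by (rule cSUP_upper[OF that bdd])
    have S_nonneg: "0 \<le> S" using S_ge[of q] pq by simp
    define h where "h r = (\<nu> r)\<^sup>2 / 2 + (g r)\<^sup>2 / 2 + S / \<epsilon>" for r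
    have h[measurable]: "h \<in> borel_measurable borel" unfolding h_def by measurable
    have h_nonneg: "0 \<le> h r" for r unfolding h_def using S_nonneg eps_pos by simp
    have hw: "h r * w r = 1 / 2 * (\<nu> r * m r) + 1 / 2 * ((g r)\<^sup>2 * w r) + S / \<epsilon> * w r" for r
      unfolding h_def \<nu>2w[symmetric] by (simp add: algebra_simps)
    have hw_int: "(\<lambda>r. h r * w r) integrable_on {a..b}"
      unfolding hw by (intro integrable_add integrable_on_mult_right \<nu>m_int g2w_int w_int)
    have "vv p' - vv q \<le> integral {p..q} (\<lambda>r. h r * w r)" if p': "p' \<in> {p..q}" for p'
    proof -
      have "value_fun \<phi> \<epsilon> (u p') \<le> ereal (vv q + integral {p'..q} (\<lambda>r. h r * w r))"
      proof (rule main[OF _ _ pq(3) _ h h_nonneg hw_int])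
        show "AE r in lborel. r \<in> {p'..q} \<longrightarrow> 0 < m r \<longrightarrow>
            (\<nu> r)\<^sup>2 / 2 + (v r + \<epsilon> / 2 * (g r)\<^sup>2 - vv q) / \<epsilon> \<le> h r"
          using vv_v
        proof (eventually_elim, intro impI)
          fix r assume "r \<in> {a..b} \<longrightarrow> 0 < m r \<longrightarrow> v r = vv r" "r \<in> {p'..q}" "0 < m r"
          then have "v r - vv q \<le> S" using S_ge[of r] p' pq by auto
          then have "(v r - vv q) / \<epsilon> \<le> S / \<epsilon>" using eps_pos by (intro divide_right_mono) auto
          moreover have "(v r + \<epsilon> / 2 * (g r)\<^sup>2 - vv q) / \<epsilon> = (v r - vv q) / \<epsilon> + (g r)\<^sup>2 / 2"
            using eps_pos by (simp add: field_simps)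
          ultimately show "(\<nu> r)\<^sup>2 / 2 + (v r + \<epsilon> / 2 * (g r)\<^sup>2 - vv q) / \<epsilon> \<le> h r"
            by (simp add: h_def)
        qed
      qed (use p' pq V_eq[of q] in auto)
      then have "vv p' - vv q \<le> integral {p'..q} (\<lambda>r. h r * w r)"
        using V_eq[of p'] p' pq by simp
      also have "\<dots> \<le> integral {p..q} (\<lambda>r. h r * w r)"
        using p' pq h_nonneg w_nonneg by (intro integral_subset_le sub[OF hw_int]) auto
      finally show ?thesis .
    qed
    then have "S \<le> integral {p..q} (\<lambda>r. h r * w r)"
      unfolding S_def using pq by (intro cSUP_least) auto
    also have "\<dots> \<le> integral {p..q} (\<lambda>r. (g r * m r + \<delta> * m r) + S / \<epsilon> * w r)"
    proof (rule integral_le)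
      show "(\<lambda>r. h r * w r) integrable_on {p..q}" using pq by (intro sub[OF hw_int]) auto
      show "(\<lambda>r. (g r * m r + \<delta> * m r) + S / \<epsilon> * w r) integrable_on {p..q}"
        using pq by (intro integrable_add[OF sub[OF gdm] integrable_on_mult_right[OF sub[OF w_int]]]) auto
      show "h r * w r \<le> (g r * m r + \<delta> * m r) + S / \<epsilon> * w r" for r
      proof -
        have "0 \<le> \<delta> * m r" using \<delta> m_nonneg[of r] by simp
        then show ?thesis unfolding hw using \<nu>m[of r] g2w[of r] by linarith
      qed
    qed
    also have "\<dots> = integral {p..q} (\<lambda>r. g r * m r + \<delta> * m r) + S / \<epsilon> * integral {p..q} w"
      using pq by (subst Henstock_Kurzweil_Integration.integral_add[OF sub[OF gdm] integrable_on_mult_right[OF sub[OF w_int]]]) auto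
    also have "S / \<epsilon> * integral {p..q} w \<le> S / \<epsilon> * (\<eta> * \<epsilon>)"
      using S_nonneg eps_pos \<eta> by (intro mult_left_mono) auto
    also have "S / \<epsilon> * (\<eta> * \<epsilon>) = S * \<eta>" using eps_pos by simp
    finally have "(1 - \<eta>) * S \<le> integral {p..q} (\<lambda>r. g r * m r + \<delta> * m r)"
      by (simp add: algebra_simps)
    moreover have "(1 - \<eta>) * (vv p - vv q) \<le> (1 - \<eta>) * S"
      using S_ge[of p] pq \<eta> by (intro mult_left_mono) auto
    ultimately show ?thesis by linarith
  qed
  have "vv a - vv b \<le> integral {a..b} (\<lambda>r. g r * m r + \<delta> * m r)"
  proof (rule field_le_mult_one_interval)
    fix z :: real assume z: "0 < z" "z < 1"
    define P where "P p q \<longleftrightarrow> (a \<le> p \<longrightarrow> q \<le> b \<longrightarrow>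
        z * (vv p - vv q) \<le> integral {p..q} (\<lambda>r. g r * m r + \<delta> * m r))" for p q
    have "P a b"
      using ab
    proof (rule Bolzano)
      fix p q r assume trans: "P p q" "P q r" "p \<le> q" "q \<le> r"
      show "P p r"
        unfolding P_def
      proof (intro impI)
        assume pr: "a \<le> p" "r \<le> b"
        have "z * (vv p - vv q) \<le> integral {p..q} (\<lambda>r. g r * m r + \<delta> * m r)"
          "z * (vv q - vv r) \<le> integral {q..r} (\<lambda>r. g r * m r + \<delta> * m r)"
          using trans pr by (auto simp: P_def)
        moreover have "integral {p..q} (\<lambda>r. g r * m r + \<delta> * m r) + integral {q..r} (\<lambda>r. g r * m r + \<delta> * m r)
            = integral {p..r} (\<lambda>r. g r * m r + \<delta> * m r)"
          using trans pr by (intro Henstock_Kurzweil_Integration.integral_combine sub[OF gdm]) auto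
        ultimately show "z * (vv p - vv r) \<le> integral {p..r} (\<lambda>r. g r * m r + \<delta> * m r)"
          by (simp add: algebra_simps)
      qed
    next
      fix x assume x: "a \<le> x" "x \<le> b"
      have e: "0 < (1 - z) * \<epsilon> / 2" using z eps_pos by simp
      have "continuous_on {a..b} (\<lambda>r. integral {a..r} w)"
        by (rule indefinite_integral_continuous_1[OF w_int])
      from this[unfolded continuous_on_iff, rule_format, of x, OF _ e] x
      obtain d where d: "0 < d"
        "\<And>r. r \<in> {a..b} \<Longrightarrow> dist r x < d \<Longrightarrow> dist (integral {a..r} w) (integral {a..x} w) < (1 - z) * \<epsilon> / 2"
        by auto
      show "\<exists>d>0. \<forall>p q. p \<le> x \<and> x \<le> q \<and> q - p < d \<longrightarrow> P p q"
        unfolding P_def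
      proof (intro exI[of _ d] conjI allI impI)
        fix p q assume pq: "p \<le> x \<and> x \<le> q \<and> q - p < d" "a \<le> p" "q \<le> b"
        have "integral {a..p} w + integral {p..q} w = integral {a..q} w"
          using pq by (intro Henstock_Kurzweil_Integration.integral_combine sub[OF w_int]) auto
        moreover have "dist (integral {a..p} w) (integral {a..x} w) < (1 - z) * \<epsilon> / 2"
          "dist (integral {a..q} w) (integral {a..x} w) < (1 - z) * \<epsilon> / 2"
          using d(2)[of p] d(2)[of q] pq by (auto simp: dist_real_def)
        ultimately have "integral {p..q} w \<le> (1 - z) * \<epsilon>"
          unfolding dist_real_def by linarith
        then show "z * (vv p - vv q) \<le> integral {p..q} (\<lambda>r. g r * m r + \<delta> * m r)"
          using local_bound[of p q "1 - z"] pq z by simp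
      qed (rule d(1))
    qed
    then show "z * (vv a - vv b) \<le> integral {a..b} (\<lambda>r. g r * m r + \<delta> * m r)" by (simp add: P_def)
  qed
  moreover have "vv b = vb" using vb by (simp add: vv_def)
  ultimately show ?thesis using V_eq[of a] ab by simp
qed

lemma value_fun_slope_bound_borel:
  fixes a b :: real and m v g :: "real \<Rightarrow> real" and u :: "real \<Rightarrow> 'a"
  assumes ab: "a \<le> b"
    and m: "m \<in> borel_measurable borel" "\<And>r. 0 \<le> m r" "m integrable_on {a..b}"
    and v: "v \<in> borel_measurable borel"
    and g: "g \<in> borel_measurable borel" "\<And>r. 0 \<le> g r"
    and u: "\<And>s t. a \<le> s \<Longrightarrow> s \<le> t \<Longrightarrow> t \<le> b \<Longrightarrow> dist (u s) (u t) \<le> integral {s..t} m"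
    and V: "AE r in lborel. r \<in> {a..b} \<longrightarrow> 0 < m r \<longrightarrow>
        value_fun \<phi> \<epsilon> (u r) = ereal (v r) \<and> \<phi> (u r) = ereal (v r + \<epsilon> / 2 * (g r)\<^sup>2)"
    and vm: "(\<lambda>r. \<bar>v r\<bar> * m r) integrable_on {a..b}" and gm: "(\<lambda>r. g r * m r) integrable_on {a..b}"
  shows "value_fun \<phi> \<epsilon> (u a) \<le> value_fun \<phi> \<epsilon> (u b) + ereal (integral {a..b} (\<lambda>r. g r * m r))"
proof (cases "value_fun \<phi> \<epsilon> (u b)")
  case (real vb)
  have "value_fun \<phi> \<epsilon> (u a) \<le> ereal (vb + integral {a..b} (\<lambda>r. g r * m r))"
  proof (rule ereal_le_epsilon2)
    fix e :: real assume e: "0 < e"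
    define M where "M = integral {a..b} m"
    have M: "0 \<le> M" unfolding M_def using m by (intro integral_nonneg) auto
    \<comment> \<open>The denominator is positive even for a curve of length \<open>0\<close>.\<close>
    define \<delta> where "\<delta> = e / (M + 1)"
    have \<delta>: "0 < \<delta>" using e M by (simp add: \<delta>_def)
    have "value_fun \<phi> \<epsilon> (u a) \<le> ereal (vb + integral {a..b} (\<lambda>r. g r * m r + \<delta> * m r))"
      by (rule value_fun_slope_bound_truncated[OF ab m v g u V vm gm real \<delta>])
    also have "integral {a..b} (\<lambda>r. g r * m r + \<delta> * m r) = integral {a..b} (\<lambda>r. g r * m r) + \<delta> * M"
      unfolding M_def using m by (subst Henstock_Kurzweil_Integration.integral_add[OF gm integrable_on_mult_right]) auto
    also have "\<delta> * M \<le> \<delta> * (M + 1)" using \<delta> by (intro mult_left_mono) auto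
    also have "\<delta> * (M + 1) = e" using M by (simp add: \<delta>_def)
    finally show "value_fun \<phi> \<epsilon> (u a) \<le> ereal (vb + integral {a..b} (\<lambda>r. g r * m r)) + ereal e"
      by (simp add: add.assoc)
  qed
  then show ?thesis using real by simp
qed (use value_fun_not_MInf in auto)

text \<open>The second inequality is the first one for the reversed curve.\<close>

lemma value_fun_slope_bound:
  fixes a b :: real and m v g :: "real \<Rightarrow> real" and u :: "real \<Rightarrow> 'a"
  assumes ab: "a \<le> b"
    and m: "m absolutely_integrable_on {a..b}" "\<And>r. 0 \<le> m r"
    and v: "v \<in> borel_measurable (lebesgue_on {a..b})"
    and g: "g \<in> borel_measurable (lebesgue_on {a..b})"
    and u: "\<And>s t. a \<le> s \<Longrightarrow> s \<le> t \<Longrightarrow> t \<le> b \<Longrightarrow> dist (u s) (u t) \<le> integral {s..t} m"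
    and V: "AE r in lborel. r \<in> {a..b} \<longrightarrow> 0 < m r \<longrightarrow>
        value_fun \<phi> \<epsilon> (u r) = ereal (v r) \<and> \<phi> (u r) = ereal (v r + \<epsilon> / 2 * (g r)\<^sup>2) \<and> 0 \<le> g r"
    and vm: "(\<lambda>r. v r * m r) absolutely_integrable_on {a..b}"
    and gm: "(\<lambda>r. g r * m r) absolutely_integrable_on {a..b}"
  shows "value_fun \<phi> \<epsilon> (u a) \<le> value_fun \<phi> \<epsilon> (u b) + ereal (integral {a..b} (\<lambda>r. g r * m r))"
    and "value_fun \<phi> \<epsilon> (u b) \<le> value_fun \<phi> \<epsilon> (u a) + ereal (integral {a..b} (\<lambda>r. g r * m r))"
proof -
  obtain m1 where m1[measurable]: "m1 \<in> borel_measurable borel" and m1_eq: "AE r in lborel. r \<in> {a..b} \<longrightarrow> m r = m1 r"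
    by (rule borel_version_on[OF measurable_on_if_absolutely_integrable[OF m(1)]]) auto
  obtain v1 where v1[measurable]: "v1 \<in> borel_measurable borel" and v1_eq: "AE r in lborel. r \<in> {a..b} \<longrightarrow> v r = v1 r"
    by (rule borel_version_on[OF v])
  obtain g1 where g1[measurable]: "g1 \<in> borel_measurable borel" and g1_eq: "AE r in lborel. r \<in> {a..b} \<longrightarrow> g r = g1 r"
    by (rule borel_version_on[OF g])
  define m' where "m' r = max 0 (m1 r)" for r
  define g' where "g' r = max 0 (g1 r)" for r
  have meas[measurable]: "m' \<in> borel_measurable borel" "g' \<in> borel_measurable borel"
    unfolding m'_def g'_def by measurable
  have nonneg: "0 \<le> m' r" "0 \<le> g' r" for r by (simp_all add: m'_def g'_def)
  have m'_eq: "AE r in lborel. r \<in> {a..b} \<longrightarrow> m r = m' r"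
    using m1_eq
  proof eventually_elim
    case (elim r)
    then show ?case using m(2)[of r] by (auto simp: m'_def)
  qed
  have gm_eq: "AE r in lborel. r \<in> {a..b} \<longrightarrow> g r * m r = g' r * m' r"
    using m'_eq g1_eq V
  proof eventually_elim
    case (elim r)
    then show ?case using m(2)[of r] by (cases "0 < m r") (auto simp: g'_def)
  qed
  have vm_eq: "AE r in lborel. r \<in> {a..b} \<longrightarrow> \<bar>v r * m r\<bar> = \<bar>v1 r\<bar> * m' r"
    using m'_eq v1_eq
    by eventually_elim (auto simp: abs_mult nonneg)
  have m'_int: "(m' has_integral integral {s..t} m) {s..t}" if "a \<le> s" "t \<le> b" for s t
  proof -
    have "AE r in lborel. r \<in> {s..t} \<longrightarrow> m r = m' r"
      using m'_eq by eventually_elim (use that in auto)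
    moreover have "(m has_integral integral {s..t} m) {s..t}"
      by (intro integrable_integral set_lebesgue_integral_eq_integral(1) set_integrable_subset[OF m(1)])
        (use that in auto)
    ultimately show ?thesis using has_integral_AE by blast
  qed
  have u': "dist (u s) (u t) \<le> integral {s..t} m'" if "a \<le> s" "s \<le> t" "t \<le> b" for s t
    using u[OF that] integral_unique[OF m'_int[of s t]] that by simp
  have m'_on: "m' integrable_on {a..b}" using m'_int[of a b] by auto
  have gm': "((\<lambda>r. g' r * m' r) has_integral integral {a..b} (\<lambda>r. g r * m r)) {a..b}"
    using has_integral_AE[OF gm_eq] integrable_integral[OF set_lebesgue_integral_eq_integral(1)[OF gm]] by blast
  have vm': "(\<lambda>r. \<bar>v1 r\<bar> * m' r) integrable_on {a..b}"
    using has_integral_AE[OF vm_eq] set_lebesgue_integral_eq_integral(1)[OF set_integrable_abs[OF vm]]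
    unfolding integrable_on_def by blast
  have V': "AE r in lborel. r \<in> {a..b} \<longrightarrow> 0 < m' r \<longrightarrow>
        value_fun \<phi> \<epsilon> (u r) = ereal (v1 r) \<and> \<phi> (u r) = ereal (v1 r + \<epsilon> / 2 * (g' r)\<^sup>2)"
    using m'_eq v1_eq g1_eq V by eventually_elim (auto simp: g'_def)
  show "value_fun \<phi> \<epsilon> (u a) \<le> value_fun \<phi> \<epsilon> (u b) + ereal (integral {a..b} (\<lambda>r. g r * m r))"
    using value_fun_slope_bound_borel[OF ab meas(1) nonneg(1) m'_on v1 meas(2) nonneg(2) u' V' vm' has_integral_integrable[OF gm']]
    by (simp add: integral_unique[OF gm'])
  have "value_fun \<phi> \<epsilon> (u (- (- b))) \<le> value_fun \<phi> \<epsilon> (u (- (- a))) + ereal (integral {-b..-a} (\<lambda>r. g' (- r) * m' (- r)))"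
  proof (rule value_fun_slope_bound_borel[where u = "\<lambda>r. u (- r)" and v = "\<lambda>r. v1 (- r)" and a = "-b" and b = "-a"])
    show "(\<lambda>r. m' (- r)) integrable_on {- b..- a}"
      using m'_on by (simp only: Henstock_Kurzweil_Integration.integrable_reflect_real)
    show "(\<lambda>r. \<bar>v1 (- r)\<bar> * m' (- r)) integrable_on {- b..- a}"
      using vm' by (simp only: Henstock_Kurzweil_Integration.integrable_reflect_real[of "\<lambda>r. \<bar>v1 r\<bar> * m' r"])
    show "(\<lambda>r. g' (- r) * m' (- r)) integrable_on {- b..- a}"
      using has_integral_integrable[OF gm']
      by (simp only: Henstock_Kurzweil_Integration.integrable_reflect_real[of "\<lambda>r. g' r * m' r"])
    show "dist (u (- s)) (u (- t)) \<le> integral {s..t} (\<lambda>r. m' (- r))" if "- b \<le> s" "s \<le> t" "t \<le> - a" for s t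
      using u'[of "- t" "- s"] that Henstock_Kurzweil_Integration.integral_reflect_real[of "- s" "- t" m']
      by (simp add: dist_commute)
    show "AE r in lborel. r \<in> {- b..- a} \<longrightarrow> 0 < m' (- r) \<longrightarrow> value_fun \<phi> \<epsilon> (u (- r)) = ereal (v1 (- r)) \<and>
        \<phi> (u (- r)) = ereal (v1 (- r) + \<epsilon> / 2 * (g' (- r))\<^sup>2)"
      using AE_lborel_reflect[OF V'] by eventually_elim auto
  qed (use ab nonneg in auto)
  then show "value_fun \<phi> \<epsilon> (u b) \<le> value_fun \<phi> \<epsilon> (u a) + ereal (integral {a..b} (\<lambda>r. g r * m r))"
    using Henstock_Kurzweil_Integration.integral_reflect_real[of b a "\<lambda>r. g' r * m' r"]
    by (simp add: integral_unique[OF gm'])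
qed

lemma value_slope_eq:
  assumes v: "value_fun \<phi> \<epsilon> x = ereal v" and r: "\<phi> x = ereal r"
  shows "v \<le> r" "value_slope \<phi> \<epsilon> x = ennreal (sqrt (2 * (r - v) / \<epsilon>))"
proof -
  show le: "v \<le> r" using value_fun_le_phi[of x] v r by simp
  have "x \<in> value_dom \<phi> \<epsilon>" using v by (simp add: value_dom_def)
  moreover have "2 * (ereal r - ereal v) / ereal \<epsilon> = ereal (2 * (r - v) / \<epsilon>)"
    using eps_pos by (simp add: divide_ereal_def field_simps)
  moreover have "0 \<le> 2 * (r - v) / \<epsilon>" using le eps_pos by simp
  ultimately show "value_slope \<phi> \<epsilon> x = ennreal (sqrt (2 * (r - v) / \<epsilon>))"
    using v r by (simp add: value_slope_def sqrt_ennreal_def)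
qed

text \<open>If \<open>\<phi> x = \<infinity>\<close> while \<open>V x\<close> is finite, the slope is infinite; otherwise its definition can be solved for \<open>\<phi> x\<close>.\<close>

lemma phi_eq_if_value_slope_finite:
  assumes v: "value_fun \<phi> \<epsilon> x = ereal v" and fin: "\<bar>enn2ereal (value_slope \<phi> \<epsilon> x)\<bar> \<noteq> \<infinity>"
  defines "g \<equiv> real_of_ereal (enn2ereal (value_slope \<phi> \<epsilon> x))"
  shows "\<phi> x = ereal (v + \<epsilon> / 2 * g\<^sup>2)" "0 \<le> g" "value_slope \<phi> \<epsilon> x = ennreal g"
proof -
  have "\<phi> x \<noteq> \<infinity>"
  proof
    assume inf: "\<phi> x = \<infinity>"
    have "x \<in> value_dom \<phi> \<epsilon>" using v by (simp add: value_dom_def)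
    moreover have "2 * (\<infinity> - ereal v) / ereal \<epsilon> = \<infinity>"
      using eps_pos by (simp add: divide_ereal_def)
    ultimately have "value_slope \<phi> \<epsilon> x = top"
      using v inf by (simp add: value_slope_def sqrt_ennreal_def)
    then show False using fin by simp
  qed
  then obtain r where r: "\<phi> x = ereal r"
    using not_MInf[of x] by (cases "\<phi> x") auto
  note vs = value_slope_eq[OF v r]
  have "0 \<le> 2 * (r - v) / \<epsilon>" using vs(1) eps_pos by simp
  then have g: "g = sqrt (2 * (r - v) / \<epsilon>)"
    unfolding g_def vs(2) by simp
  show "0 \<le> g" using \<open>0 \<le> 2 * (r - v) / \<epsilon>\<close> by (simp add: g)
  show "value_slope \<phi> \<epsilon> x = ennreal g" unfolding vs(2) g ..
  have "g\<^sup>2 = 2 * (r - v) / \<epsilon>" using \<open>0 \<le> 2 * (r - v) / \<epsilon>\<close> by (simp add: g)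
  then show "\<phi> x = ereal (v + \<epsilon> / 2 * g\<^sup>2)" using r eps_pos by (simp add: field_simps)
qed

text \<open>The integrability assumptions of the definition are those of \<open>value_fun_slope_bound\<close>, with respect to the speed
measure.\<close>

theorem value_slope_upper_gradient:
  "moderated_upper_gradient 1 (value_fun \<phi> \<epsilon>) (value_slope \<phi> \<epsilon>)"
  unfolding moderated_upper_gradient_def
proof (intro conjI allI impI ballI)
  show "value_fun \<phi> \<epsilon> x \<noteq> - \<infinity>" for x by (rule value_fun_not_MInf)
  fix I :: "real set" and u :: "real \<Rightarrow> 'a" and s t :: real
  assume I: "is_interval I" and u: "u \<in> AC 1 I"
    and V: "Lp 1 (speed_measure I u) (\<lambda>t. value_fun \<phi> \<epsilon> (u t))"
    and G: "Lp 1 (speed_measure I u) (\<lambda>t. enn2ereal (value_slope \<phi> \<epsilon> (u t)))"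
    and st: "s \<in> I" "t \<in> I" "s \<le> t"
  have sub: "{s..t} \<subseteq> I"
    using I st unfolding is_interval_1 by (meson atLeastAtMost_iff subsetI)
  have I_sets: "I \<in> sets lebesgue" using real_interval_borel_measurable[OF I] by simp
  have speed: "metric_deriv I u absolutely_integrable_on {p..q}"
    "AE r in lborel. r \<in> {p..q} \<longrightarrow> 0 \<le> metric_deriv I u r"
    "\<And>x y. p \<le> x \<Longrightarrow> x \<le> y \<Longrightarrow> y \<le> q \<Longrightarrow> dist (u x) (u y) \<le> integral {x..y} (metric_deriv I u)"
    if pq: "p \<le> q" "{p..q} \<subseteq> I" for p q
  proof -
    obtain m where m: "m absolutely_integrable_on {p..q}"
      "\<And>s t. p \<le> s \<Longrightarrow> s \<le> t \<Longrightarrow> t \<le> q \<Longrightarrow> dist (u s) (u t) \<le> integral {s..t} m"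
      by (rule AC_1_speed[OF u I pq(2)]) (rule that)
    show "metric_deriv I u absolutely_integrable_on {p..q}"
      by (rule metric_deriv_speed(1)[OF pq m])
    show "AE r in lborel. r \<in> {p..q} \<longrightarrow> 0 \<le> metric_deriv I u r"
    proof -
      have "AE r in lborel. r \<in> {p..q} \<longrightarrow> 0 \<le> metric_deriv I u r \<and> metric_deriv I u r \<le> \<bar>m r\<bar>"
        by (rule metric_deriv_speed(2)[OF pq m])
      then show ?thesis by eventually_elim auto
    qed
    show "dist (u x) (u y) \<le> integral {x..y} (metric_deriv I u)" if "p \<le> x" "x \<le> y" "y \<le> q" for x y
      by (rule metric_deriv_speed(3)[OF pq m that])
  qed
  have md: "metric_deriv I u \<in> borel_measurable (lebesgue_on I)"
    by (rule borel_measurable_on_interval[OF I])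
      (intro measurable_on_if_absolutely_integrable speed(1); simp)
  define m where "m r = max 0 (metric_deriv I u r)" for r
  note V' = Lp_1_speed_measure[OF V I_sets md sub, folded m_def]
  note G' = Lp_1_speed_measure[OF G I_sets md sub, folded m_def]
  have m_int: "m absolutely_integrable_on {s..t}"
  proof -
    have "m = (\<lambda>r. 1 / 2 * (metric_deriv I u r + \<bar>metric_deriv I u r\<bar>))"
      by (auto simp: m_def fun_eq_iff)
    then show ?thesis
      using speed(1)[OF st(3) sub] by (simp only: set_integrable_mult_right set_integral_add(1) set_integrable_abs)
  qed
  have m_speed: "dist (u x) (u y) \<le> integral {x..y} m" if "s \<le> x" "x \<le> y" "y \<le> t" for x y
  proof -
    have "dist (u x) (u y) \<le> integral {x..y} (metric_deriv I u)"
      by (rule speed(3)[OF st(3) sub that])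
    also have "\<dots> \<le> integral {x..y} m"
    proof (rule integral_le)
      show "metric_deriv I u integrable_on {x..y}" "m integrable_on {x..y}"
        by (intro set_lebesgue_integral_eq_integral(1) set_integrable_subset[OF speed(1)[OF st(3) sub]]
          set_integrable_subset[OF m_int]; use that in auto)+
    qed (simp add: m_def)
    finally show ?thesis .
  qed
  define v where "v r = real_of_ereal (value_fun \<phi> \<epsilon> (u r))" for r
  define g where "g r = real_of_ereal (enn2ereal (value_slope \<phi> \<epsilon> (u r)))" for r
  have facts: "AE r in lborel. r \<in> {s..t} \<longrightarrow> 0 < m r \<longrightarrow>
      value_fun \<phi> \<epsilon> (u r) = ereal (v r) \<and> \<phi> (u r) = ereal (v r + \<epsilon> / 2 * (g r)\<^sup>2) \<and> 0 \<le> g r \<and>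
      value_slope \<phi> \<epsilon> (u r) = ennreal (g r)"
    using V'(3) G'(3)
  proof (eventually_elim, intro impI)
    fix r assume "r \<in> {s..t} \<longrightarrow> 0 < m r \<longrightarrow> \<bar>value_fun \<phi> \<epsilon> (u r)\<bar> \<noteq> \<infinity>"
      and "r \<in> {s..t} \<longrightarrow> 0 < m r \<longrightarrow> \<bar>enn2ereal (value_slope \<phi> \<epsilon> (u r))\<bar> \<noteq> \<infinity>"
      and r: "r \<in> {s..t}" "0 < m r"
    then have fin: "\<bar>value_fun \<phi> \<epsilon> (u r)\<bar> \<noteq> \<infinity>" "\<bar>enn2ereal (value_slope \<phi> \<epsilon> (u r))\<bar> \<noteq> \<infinity>"
      by auto
    have v: "value_fun \<phi> \<epsilon> (u r) = ereal (v r)"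
      using fin(1) by (simp add: v_def ereal_real)
    show "value_fun \<phi> \<epsilon> (u r) = ereal (v r) \<and> \<phi> (u r) = ereal (v r + \<epsilon> / 2 * (g r)\<^sup>2) \<and> 0 \<le> g r \<and>
      value_slope \<phi> \<epsilon> (u r) = ennreal (g r)"
      using phi_eq_if_value_slope_finite[OF v fin(2)] v by (simp add: g_def)
  qed
  then have VF: "AE r in lborel. r \<in> {s..t} \<longrightarrow> 0 < m r \<longrightarrow>
      value_fun \<phi> \<epsilon> (u r) = ereal (v r) \<and> \<phi> (u r) = ereal (v r + \<epsilon> / 2 * (g r)\<^sup>2) \<and> 0 \<le> g r"
    by eventually_elim auto
  have m_nonneg: "0 \<le> m r" for r by (simp add: m_def)
  note bound = value_fun_slope_bound[OF st(3) m_int m_nonneg V'(1)[folded v_def] G'(1)[folded g_def] m_speed VF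
      V'(2)[folded v_def] G'(2)[folded g_def]]
  have g_nonneg: "0 \<le> g r" for r by (simp add: g_def real_of_ereal_pos)
  have "(\<integral>\<^sup>+ r\<in>{s..t}. (value_slope \<phi> \<epsilon> (u r) * ennreal (metric_deriv I u r)) \<partial>lebesgue) =
      (\<integral>\<^sup>+ r. ennreal (g r * m r) * indicator {s..t} r \<partial>lborel)"
    unfolding nn_integral_completion
  proof (rule nn_integral_cong_AE)
    show "AE r in lborel. value_slope \<phi> \<epsilon> (u r) * ennreal (metric_deriv I u r) * indicator {s..t} r =
        ennreal (g r * m r) * indicator {s..t} r"
      using facts
    proof eventually_elim
      case (elim r)
      have em: "ennreal (metric_deriv I u r) = ennreal (m r)" by (simp add: m_def ennreal_max_0)
      show ?case
      proof (cases "0 < m r")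
        case True
        then show ?thesis
          using elim g_nonneg[of r] by (auto simp: indicator_def em ennreal_mult)
      next
        case False
        then have "m r = 0" using m_nonneg[of r] by linarith
        then show ?thesis by (simp add: em)
      qed
    qed
  qed
  also have "\<dots> = ennreal (integral {s..t} (\<lambda>r. g r * m r))"
    using G'(2)[folded g_def] g_nonneg m_nonneg by (intro nn_integral_eq_integral_if_nonneg) auto
  finally have L: "enn2ereal (\<integral>\<^sup>+ r\<in>{s..t}. (value_slope \<phi> \<epsilon> (u r) * ennreal (metric_deriv I u r)) \<partial>lebesgue) =
      ereal (integral {s..t} (\<lambda>r. g r * m r))"
    using integral_nonneg[OF set_lebesgue_integral_eq_integral(1)[OF G'(2)[folded g_def]]] g_nonneg m_nonneg
    by simp
  show "let L = enn2ereal (\<integral>\<^sup>+ r\<in>{s..t}. (value_slope \<phi> \<epsilon> (u r) * ennreal (metric_deriv I u r)) \<partial>lebesgue)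
      in value_fun \<phi> \<epsilon> (u t) \<le> value_fun \<phi> \<epsilon> (u s) + L \<and> value_fun \<phi> \<epsilon> (u s) \<le> value_fun \<phi> \<epsilon> (u t) + L"
    unfolding L Let_def using bound by blast
qed

section \<open>Minimizers\<close>

lemma minimizer_action:
  assumes x: "x \<in> value_dom \<phi> \<epsilon>" and u: "u \<in> wed_minimizers \<phi> \<epsilon> x"
  shows "finite_action u (curve_speed u)" "value_fun \<phi> \<epsilon> x = ereal (action u (curve_speed u))" "u 0 = x"
proof -
  have uC: "u \<in> wed_curves \<epsilon> x" and umin: "\<And>c. c \<in> wed_curves \<epsilon> x \<Longrightarrow> wed_functional \<phi> \<epsilon> u \<le> wed_functional \<phi> \<epsilon> c"
    using u by (auto simp: wed_minimizers_def)
  have eq: "value_fun \<phi> \<epsilon> x = wed_functional \<phi> \<epsilon> u"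
    unfolding value_fun_def using uC umin by (intro antisym INF_lower INF_greatest) auto
  then have "wed_functional \<phi> \<epsilon> u < \<infinity>"
    using x by (simp add: value_dom_def)
  from wed_curve_finite_action[OF uC this] eq
  show "finite_action u (curve_speed u)" "value_fun \<phi> \<epsilon> x = ereal (action u (curve_speed u))" "u 0 = x"
    by simp_all
qed

text \<open>The tail of the curve is a competitor, which bounds the value from above. From below, dynamic programming
on \<open>[0, t]\<close> would otherwise make the curve suboptimal.\<close>

lemma value_fun_along_optimal_curve:
  assumes c: "finite_action c k" and opt: "value_fun \<phi> \<epsilon> (c 0) = ereal (action c k)" and t: "0 \<le> t"
  shows "value_fun \<phi> \<epsilon> (c t) = ereal (exp (t / \<epsilon>) * (action c k - integral {0..t} (lagrangian c k)))"
proof -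
  have sm: "weighted_L2 \<epsilon> k" "\<And>s t. 0 \<le> s \<Longrightarrow> s \<le> t \<Longrightarrow> dist (c s) (c t) \<le> integral {s..t} k"
    and fin: "AE t in lborel. 0 \<le> t \<longrightarrow> \<bar>\<phi> (c t)\<bar> \<noteq> \<infinity>"
    and lag: "lagrangian c k absolutely_integrable_on {0..}"
    using c by (simp_all add: finite_action_def speed_majorant_def)
  have lag1: "lagrangian c k absolutely_integrable_on {0..t}" and lag2: "lagrangian c k absolutely_integrable_on {t..}"
    by (intro set_integrable_subset[OF lag]; use t in auto)+
  have split: "integral {t..} (lagrangian c k) = action c k - integral {0..t} (lagrangian c k)"
    using absolutely_integrable_halfline_combine(2)[OF t lag1 lag2] by (simp add: action_def)
  have "value_fun \<phi> \<epsilon> (c t) \<le> ereal (action (\<lambda>s. c (s + t)) (\<lambda>s. k (s + t)))"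
    by (rule value_fun_le_action[OF finite_action_tail(1)[OF c t]]) simp
  then have upper: "value_fun \<phi> \<epsilon> (c t) \<le> ereal (exp (t / \<epsilon>) * (action c k - integral {0..t} (lagrangian c k)))"
    by (simp add: finite_action_tail(2)[OF c t] split)
  then obtain z where z: "value_fun \<phi> \<epsilon> (c t) = ereal z"
    using value_fun_not_MInf[of "c t"] by (cases "value_fun \<phi> \<epsilon> (c t)") auto
  have "value_fun \<phi> \<epsilon> (c 0) \<le> ereal (integral {0..t} (lagrangian c k) + exp (- t / \<epsilon>) * z)"
  proof (rule dynamic_programming[OF t weighted_L2_local(2)[OF sm(1) eps_pos order_refl]
        weighted_L2_local(1)[OF sm(1) eps_pos order_refl] _ _ _ lag1])
    show "0 \<le> k t" for t using sm(1) by (simp add: weighted_L2_def)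
    show "AE s in lborel. s \<in> {0..t} \<longrightarrow> \<bar>\<phi> (c s)\<bar> \<noteq> \<infinity>"
      using fin by eventually_elim auto
  qed (use sm z in auto)
  then have "action c k - integral {0..t} (lagrangian c k) \<le> exp (- t / \<epsilon>) * z"
    by (simp add: opt)
  then have "exp (t / \<epsilon>) * (action c k - integral {0..t} (lagrangian c k)) \<le> exp (t / \<epsilon>) * (exp (- t / \<epsilon>) * z)"
    by (rule mult_left_mono) simp
  also have "\<dots> = z"
    by (simp add: mult.assoc[symmetric] flip: exp_add)
  finally show ?thesis using upper z by simp
qed

text \<open>Here \<open>g\<close> is the slope along the curve, and \<open>gk \<le> (g\<^sup>2 + k\<^sup>2) / 2 \<le> \<bar>\<phi> - V\<bar> / \<epsilon> + k\<^sup>2 / 2\<close> shows that the upper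
gradient inequality applies. Its derivative and that of the formula for \<open>v\<close> are compared almost everywhere.\<close>

lemma optimal_curve_slope:
  assumes c: "finite_action c k" and opt: "value_fun \<phi> \<epsilon> (c 0) = ereal (action c k)"
  defines "v \<equiv> \<lambda>t. exp (t / \<epsilon>) * (action c k - integral {0..t} (lagrangian c k))"
  shows "continuous_on {0..} v"
    and "AE t in lborel. 0 < t \<longrightarrow> (v has_real_derivative - (k t)\<^sup>2) (at t) \<and>
      value_slope \<phi> \<epsilon> (c t) = ennreal (k t)"
proof -
  have smc: "speed_majorant c k" and sm: "weighted_L2 \<epsilon> k" "\<And>s t. 0 \<le> s \<Longrightarrow> s \<le> t \<Longrightarrow> dist (c s) (c t) \<le> integral {s..t} k"
    and fin: "AE t in lborel. 0 \<le> t \<longrightarrow> \<bar>\<phi> (c t)\<bar> \<noteq> \<infinity>"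
    and lag: "lagrangian c k absolutely_integrable_on {0..}"
    using c by (simp_all add: finite_action_def speed_majorant_def)
  have k_nonneg: "0 \<le> k t" for t using sm(1) by (simp add: weighted_L2_def)
  have V: "value_fun \<phi> \<epsilon> (c t) = ereal (v t)" if "0 \<le> t" for t
    unfolding v_def by (rule value_fun_along_optimal_curve[OF c opt that])
  have lag_on: "lagrangian c k absolutely_integrable_on {0..b}" for b
    by (rule set_integrable_subset[OF lag]) auto
  have v_cont_Icc: "continuous_on {0..b} v" for b
    unfolding v_def using eps_pos
    by (intro continuous_intros indefinite_integral_continuous_1 set_lebesgue_integral_eq_integral(1) lag_on) auto
  show v_cont: "continuous_on {0..} v"
    unfolding continuous_on_eq_continuous_within
  proof
    fix t :: real assume "t \<in> {0..}"
    then have "continuous (at t within {0..t+1}) v"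
      using v_cont_Icc[of "t + 1"] by (simp add: continuous_on_eq_continuous_within)
    moreover have "at t within {0..t+1} = at t within {0..}"
      by (rule at_within_nhd[of t "{..<t+1}"]) auto
    ultimately show "continuous (at t within {0..}) v" by simp
  qed
  define f where "f t = real_of_ereal (\<phi> (c t))" for t
  define g where "g t = sqrt (2 * max 0 (f t - v t) / \<epsilon>)" for t
  have g_nonneg: "0 \<le> g t" for t using eps_pos by (simp add: g_def)
  have g2: "(g t)\<^sup>2 = 2 * max 0 (f t - v t) / \<epsilon>" for t
    using eps_pos by (simp add: g_def)
  have fv: "\<phi> (c t) = ereal (f t) \<and> v t \<le> f t \<and> value_slope \<phi> \<epsilon> (c t) = ennreal (g t)
      \<and> f t = v t + \<epsilon> / 2 * (g t)\<^sup>2" if "0 \<le> t" "\<bar>\<phi> (c t)\<bar> \<noteq> \<infinity>" for t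
  proof -
    have f: "\<phi> (c t) = ereal (f t)" using that(2) by (simp add: f_def ereal_real)
    note vs = value_slope_eq[OF V[OF that(1)] f]
    have "max 0 (f t - v t) = f t - v t" using vs(1) by simp
    then show ?thesis using f vs eps_pos g2[of t] by (simp add: g_def field_simps)
  qed
  have f_meas: "f \<in> borel_measurable (lebesgue_on {0..})"
    unfolding f_def using phi_measurable[OF speed_majorant_continuous[OF smc]] by simp
  have v_meas: "v \<in> borel_measurable (lebesgue_on {0..})"
    by (rule continuous_imp_measurable_on_sets_lebesgue[OF v_cont]) simp
  have g_meas: "g \<in> borel_measurable (lebesgue_on {0..})"
  proof -
    have "(\<lambda>t. 2 * max 0 (f t - v t) / \<epsilon>) \<in> borel_measurable (lebesgue_on {0..})"
      using f_meas v_meas by measurable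
    from measurable_compose[OF this, of sqrt borel] show ?thesis
      unfolding g_def by simp
  qed
  have restr: "h \<in> borel_measurable (lebesgue_on {0..b})" if "h \<in> borel_measurable (lebesgue_on {0..})" for h :: "real \<Rightarrow> real" and b
    by (rule measurable_restrict_mono[OF that]) auto
  have f_int: "f absolutely_integrable_on {0..b}" for b
  proof -
    have e: "exp (t / \<epsilon>) * exp (- t / \<epsilon>) = 1" for t by (simp flip: exp_add)
    have "f t = \<epsilon> * (exp (t / \<epsilon>) * lagrangian c k t - (k t)\<^sup>2 / 2)" for t
      unfolding lagrangian_def mult.assoc[symmetric] e using eps_pos by (simp add: f_def field_simps)
    then have f_eq: "f = (\<lambda>t. \<epsilon> * (exp (t / \<epsilon>) * lagrangian c k t - (k t)\<^sup>2 / 2))" by (rule ext)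
    have "(\<lambda>t. exp (t / \<epsilon>) * lagrangian c k t) absolutely_integrable_on {0..b}"
    proof (rule measurable_bounded_by_integrable_imp_absolutely_integrable)
      have "(\<lambda>t. exp (t / \<epsilon>)) \<in> borel_measurable (lebesgue_on {0..b})"
        by (intro continuous_imp_measurable_on_sets_lebesgue continuous_on_exp continuous_on_divide
          continuous_on_id continuous_on_const) (use eps_pos in auto)
      then show "(\<lambda>t. exp (t / \<epsilon>) * lagrangian c k t) \<in> borel_measurable (lebesgue_on {0..b})"
        using measurable_on_if_absolutely_integrable[OF lag_on] by (intro borel_measurable_times) auto
      show "(\<lambda>t. exp (b / \<epsilon>) * \<bar>lagrangian c k t\<bar>) integrable_on {0..b}"
        by (intro integrable_on_mult_right set_lebesgue_integral_eq_integral(1) set_integrable_abs lag_on)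
      show "norm (exp (t / \<epsilon>) * lagrangian c k t) \<le> exp (b / \<epsilon>) * \<bar>lagrangian c k t\<bar>" if "t \<in> {0..b}" for t
        using that eps_pos by (auto simp: abs_mult divide_right_mono intro!: mult_right_mono)
    qed simp
    then show ?thesis
      unfolding f_eq
      by (intro set_integrable_mult_right set_integral_diff(1) set_integrable_divide
          weighted_L2_local(1)[OF sm(1) eps_pos order_refl])
  qed
  have v_int: "v absolutely_integrable_on {0..b}" for b
    by (rule absolutely_integrable_continuous_real[OF v_cont_Icc])
  have vk_int: "(\<lambda>t. v t * k t) absolutely_integrable_on {0..b}" for b
  proof -
    have "bounded (v ` {0..b})"
      by (intro compact_imp_bounded compact_continuous_image v_cont_Icc) simp
    then obtain M where "\<forall>y \<in> v ` {0..b}. norm y \<le> M"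
      unfolding bounded_iff by blast
    then have M: "\<bar>v t\<bar> \<le> M" if "t \<in> {0..b}" for t using that by auto
    show ?thesis
    proof (rule measurable_bounded_by_integrable_imp_absolutely_integrable)
      show "(\<lambda>t. v t * k t) \<in> borel_measurable (lebesgue_on {0..b})"
        by (intro borel_measurable_times restr v_meas weighted_L2_measurable[OF sm(1) eps_pos])
      show "(\<lambda>t. M * k t) integrable_on {0..b}"
        by (intro integrable_on_mult_right set_lebesgue_integral_eq_integral(1) weighted_L2_local(2)[OF sm(1) eps_pos order_refl])
      show "norm (v t * k t) \<le> M * k t" if "t \<in> {0..b}" for t
        using M[OF that] k_nonneg[of t] by (auto simp: abs_mult intro!: mult_right_mono)
    qed simp
  qed
  have gk_int: "(\<lambda>t. g t * k t) absolutely_integrable_on {0..b}" for b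
  proof (rule measurable_bounded_by_integrable_imp_absolutely_integrable)
    show "(\<lambda>t. g t * k t) \<in> borel_measurable (lebesgue_on {0..b})"
      by (intro borel_measurable_times restr g_meas weighted_L2_measurable[OF sm(1) eps_pos])
    show "(\<lambda>t. 1 / \<epsilon> * \<bar>f t - v t\<bar> + 1 / 2 * (k t)\<^sup>2) integrable_on {0..b}"
      by (intro set_lebesgue_integral_eq_integral(1) set_integral_add(1) set_integral_diff(1)
          set_integrable_mult_right set_integrable_abs f_int v_int weighted_L2_local(1)[OF sm(1) eps_pos order_refl])
    show "norm (g t * k t) \<le> 1 / \<epsilon> * \<bar>f t - v t\<bar> + 1 / 2 * (k t)\<^sup>2" for t
    proof -
      have "2 * (g t * k t) \<le> (g t)\<^sup>2 + (k t)\<^sup>2"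
        using sum_squares_bound[of "g t" "k t"] by (simp add: mult.assoc)
      moreover have "(g t)\<^sup>2 \<le> 2 * (1 / \<epsilon> * \<bar>f t - v t\<bar>)"
        unfolding g2 using eps_pos by (simp add: divide_right_mono)
      moreover have "norm (g t * k t) = g t * k t"
        using g_nonneg[of t] k_nonneg[of t] by simp
      ultimately show ?thesis by linarith
    qed
  qed simp
  have v_le: "v s + integral {0..s} (\<lambda>r. g r * k r) \<le> v t + integral {0..t} (\<lambda>r. g r * k r)"
    if st: "0 \<le> s" "s \<le> t" for s t
  proof -
    have sub: "{s..t} \<subseteq> {0..t}" using st by auto
    have r2: "h \<in> borel_measurable (lebesgue_on {s..t})" if "h \<in> borel_measurable (lebesgue_on {0..})" for h :: "real \<Rightarrow> real"
      by (rule measurable_restrict_mono[OF that]) (use st in auto)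
    have "AE r in lborel. r \<in> {s..t} \<longrightarrow> 0 < k r \<longrightarrow>
        value_fun \<phi> \<epsilon> (c r) = ereal (v r) \<and> \<phi> (c r) = ereal (v r + \<epsilon> / 2 * (g r)\<^sup>2) \<and> 0 \<le> g r"
      using fin
    proof eventually_elim
      case (elim r)
      then show ?case using st V[of r] fv[of r] g_nonneg[of r] by auto
    qed
    from value_fun_slope_bound(1)[OF st(2) weighted_L2_local(2)[OF sm(1) eps_pos st(1)] k_nonneg r2[OF v_meas] r2[OF g_meas] _ this
        set_integrable_subset[OF vk_int _ sub] set_integrable_subset[OF gk_int _ sub]]
    have "v s \<le> v t + integral {s..t} (\<lambda>r. g r * k r)"
      using sm(2) st V[of s] V[of t] by simp
    moreover have "integral {0..s} (\<lambda>r. g r * k r) + integral {s..t} (\<lambda>r. g r * k r) = integral {0..t} (\<lambda>r. g r * k r)"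
      using st by (intro Henstock_Kurzweil_Integration.integral_combine set_lebesgue_integral_eq_integral(1) gk_int)
    ultimately show ?thesis by linarith
  qed
  have "AE t in lborel. \<forall>n::nat. t \<in> {0<..<real n} \<longrightarrow>
      ((\<lambda>x. integral {0..x} (lagrangian c k)) has_real_derivative lagrangian c k t) (at t)"
    and "AE t in lborel. \<forall>n::nat. t \<in> {0<..<real n} \<longrightarrow>
      ((\<lambda>x. integral {0..x} (\<lambda>r. g r * k r)) has_real_derivative g t * k t) (at t)"
    unfolding AE_all_countable
    by (intro allI indefinite_integral_differentiable_ae set_lebesgue_integral_eq_integral(1) lag_on gk_int)+
  with fin show "AE t in lborel. 0 < t \<longrightarrow> (v has_real_derivative - (k t)\<^sup>2) (at t) \<and>
      value_slope \<phi> \<epsilon> (c t) = ennreal (k t)"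
  proof (eventually_elim, intro impI)
    fix t :: real
    assume fin_t: "0 \<le> t \<longrightarrow> \<bar>\<phi> (c t)\<bar> \<noteq> \<infinity>"
      and L: "\<forall>n::nat. t \<in> {0<..<real n} \<longrightarrow>
        ((\<lambda>x. integral {0..x} (lagrangian c k)) has_real_derivative lagrangian c k t) (at t)"
      and gk: "\<forall>n::nat. t \<in> {0<..<real n} \<longrightarrow>
        ((\<lambda>x. integral {0..x} (\<lambda>r. g r * k r)) has_real_derivative g t * k t) (at t)"
      and t: "0 < t"
    obtain n where "t < real n" using reals_Archimedean2 by blast
    then have L: "((\<lambda>x. integral {0..x} (lagrangian c k)) has_real_derivative lagrangian c k t) (at t)"
      and gk: "((\<lambda>x. integral {0..x} (\<lambda>r. g r * k r)) has_real_derivative g t * k t) (at t)"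
      using L gk t by auto
    have facts: "v t \<le> f t" "value_slope \<phi> \<epsilon> (c t) = ennreal (g t)" "f t = v t + \<epsilon> / 2 * (g t)\<^sup>2"
      using fv[of t] fin_t t by auto
    have "(v has_real_derivative (exp (t / \<epsilon>) * (1 / \<epsilon>)) * (action c k - integral {0..t} (lagrangian c k))
        + (0 - lagrangian c k t) * exp (t / \<epsilon>)) (at t)"
      unfolding v_def
      by (intro DERIV_mult DERIV_diff DERIV_const L DERIV_fun_exp) (use eps_pos in \<open>auto intro!: derivative_eq_intros\<close>)
    moreover have "(exp (t / \<epsilon>) * (1 / \<epsilon>)) * (action c k - integral {0..t} (lagrangian c k))
        + (0 - lagrangian c k t) * exp (t / \<epsilon>) = - (((g t)\<^sup>2 + (k t)\<^sup>2) / 2)"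
    proof -
      have e: "exp (t / \<epsilon>) * exp (- t / \<epsilon>) = 1" by (simp flip: exp_add)
      have "lagrangian c k t * exp (t / \<epsilon>) = (exp (t / \<epsilon>) * exp (- t / \<epsilon>)) * ((k t)\<^sup>2 / 2 + f t / \<epsilon>)"
        by (simp add: lagrangian_def f_def)
      then have 1: "lagrangian c k t * exp (t / \<epsilon>) = (k t)\<^sup>2 / 2 + f t / \<epsilon>" by (simp only: e mult_1)
      have 2: "(exp (t / \<epsilon>) * (1 / \<epsilon>)) * (action c k - integral {0..t} (lagrangian c k)) = v t / \<epsilon>"
        by (simp add: v_def)
      have 3: "f t / \<epsilon> = v t / \<epsilon> + (g t)\<^sup>2 / 2"
        using eps_pos by (subst facts(3)) (simp add: field_simps)
      show ?thesis
        unfolding left_diff_distrib mult_zero_left 1 2 3 by (simp add: field_simps)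
    qed
    ultimately have dv: "(v has_real_derivative - (((g t)\<^sup>2 + (k t)\<^sup>2) / 2)) (at t)" by (simp only:)
    have "((\<lambda>s. v s + integral {0..s} (\<lambda>r. g r * k r)) has_real_derivative
        (- (((g t)\<^sup>2 + (k t)\<^sup>2) / 2) + g t * k t)) (at t)"
      by (intro DERIV_add dv gk)
    moreover have "mono_on {0..} (\<lambda>s. v s + integral {0..s} (\<lambda>r. g r * k r))"
      using v_le by (intro mono_onI) auto
    moreover have "t \<in> interior {0..}" using t by simp
    ultimately have "0 \<le> - (((g t)\<^sup>2 + (k t)\<^sup>2) / 2) + g t * k t"
      by (intro mono_on_imp_deriv_nonneg)
    moreover have "(g t - k t)\<^sup>2 = (g t)\<^sup>2 + (k t)\<^sup>2 - 2 * (g t * k t)"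
      by (simp add: power2_diff)
    ultimately have "(g t - k t)\<^sup>2 \<le> 0" by argo
    then have "g t = k t" by simp
    then show "(v has_real_derivative - (k t)\<^sup>2) (at t) \<and> value_slope \<phi> \<epsilon> (c t) = ennreal (k t)"
      using dv facts(2) by simp
  qed
qed

theorem minimizer_maximal_slope:
  assumes x: "x \<in> value_dom \<phi> \<epsilon>" and u: "u \<in> wed_minimizers \<phi> \<epsilon> x"
  shows "curve_of_maximal_slope (value_fun \<phi> \<epsilon>) (value_slope \<phi> \<epsilon>) u"
proof -
  note min = minimizer_action[OF x u]
  have opt: "value_fun \<phi> \<epsilon> (u 0) = ereal (action u (curve_speed u))"
    using min(2,3) by simp
  define v where "v t = exp (t / \<epsilon>) * (action u (curve_speed u) - integral {0..t} (lagrangian u (curve_speed u)))" for t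
  have V: "value_fun \<phi> \<epsilon> (u t) = ereal (v t)" if "0 \<le> t" for t
    unfolding v_def by (rule value_fun_along_optimal_curve[OF min(1) opt that])
  note slope = optimal_curve_slope[OF min(1) opt, folded v_def]
  show ?thesis
    unfolding curve_of_maximal_slope_def
  proof (intro conjI allI impI)
    show "u \<in> AC_loc 2 {0..}"
      using u by (simp add: wed_minimizers_def wed_curves_def)
    show "\<exists>C. \<forall>t\<in>{0..T}. \<bar>value_fun \<phi> \<epsilon> (u t)\<bar> \<le> ereal C" if "0 \<le> T" for T
    proof -
      have "bounded (v ` {0..T})"
        by (intro compact_imp_bounded compact_continuous_image continuous_on_subset[OF slope(1)]) auto
      then obtain C where "\<forall>y \<in> v ` {0..T}. norm y \<le> C"
        unfolding bounded_iff by blast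
      then have "\<bar>v t\<bar> \<le> C" if "t \<in> {0..T}" for t using that by auto
      then show ?thesis by (intro exI[of _ C]) (auto simp: V)
    qed
    show "AE t in lebesgue_on {0<..}.
      ((\<lambda>s. real_of_ereal (value_fun \<phi> \<epsilon> (u s))) has_real_derivative - (metric_deriv {0..} u t)\<^sup>2) (at t) \<and>
      ennreal ((metric_deriv {0..} u t)\<^sup>2) = (value_slope \<phi> \<epsilon> (u t))\<^sup>2"
      unfolding lebesgue_on_Ioi_AE using slope(2) AE_lborel_singleton[of 0]
    proof (eventually_elim, intro impI)
      fix t :: real
      assume "0 < t \<longrightarrow> (v has_real_derivative - (curve_speed u t)\<^sup>2) (at t) \<and>
          value_slope \<phi> \<epsilon> (u t) = ennreal (curve_speed u t)" and "t \<noteq> 0" "0 \<le> t"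
      then have t: "0 < t" and dv: "(v has_real_derivative - (curve_speed u t)\<^sup>2) (at t)"
        and vs: "value_slope \<phi> \<epsilon> (u t) = ennreal (curve_speed u t)" by auto
      have sq: "(curve_speed u t)\<^sup>2 = (metric_deriv {0..} u t)\<^sup>2" and cs: "0 \<le> curve_speed u t"
        using t by (simp_all add: curve_speed_def)
      have "\<forall>\<^sub>F s in nhds t. s \<in> {0<..}"
        using t by (intro eventually_nhds_in_open) auto
      then have ev: "\<forall>\<^sub>F s in nhds t. v s = real_of_ereal (value_fun \<phi> \<epsilon> (u s))"
        by eventually_elim (simp add: V)
      have "((\<lambda>s. real_of_ereal (value_fun \<phi> \<epsilon> (u s))) has_real_derivative - (metric_deriv {0..} u t)\<^sup>2) (at t)"
        using dv DERIV_cong_ev[OF refl ev refl] by (simp add: sq)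
      moreover have "ennreal ((metric_deriv {0..} u t)\<^sup>2) = (value_slope \<phi> \<epsilon> (u t))\<^sup>2"
        unfolding vs using cs by (simp add: ennreal_power sq)
      ultimately show "((\<lambda>s. real_of_ereal (value_fun \<phi> \<epsilon> (u s))) has_real_derivative - (metric_deriv {0..} u t)\<^sup>2) (at t) \<and>
        ennreal ((metric_deriv {0..} u t)\<^sup>2) = (value_slope \<phi> \<epsilon> (u t))\<^sup>2" ..
    qed
  qed
qed

end

theorem corollary4p7:
  fixes \<sigma> :: "'a::complete_space topology"
    and \<phi> :: "'a \<Rightarrow> ereal"
    and u0 :: 'a
    and A B \<epsilon> :: real
  assumes "compatible_topology \<sigma>"
    and "LSCC \<sigma> \<phi> u0 A B"
    and "\<epsilon> > 0"
    and "1 / (16 * \<epsilon>) > B"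
  shows "moderated_upper_gradient 1 (value_fun \<phi> \<epsilon>) (value_slope \<phi> \<epsilon>) \<and>
    (\<forall>x \<in> value_dom \<phi> \<epsilon>. \<forall>u \<in> wed_minimizers \<phi> \<epsilon> x.
       curve_of_maximal_slope (value_fun \<phi> \<epsilon>) (value_slope \<phi> \<epsilon>) u)"
proof -
  have \<phi>: "proper_fun \<phi>" "LSCC_lsc \<sigma> \<phi>" "LSCC_coercive \<phi> u0 A B"
    using assms(2) by (simp_all add: LSCC_def)
  interpret wed_setting \<phi> u0 A B \<epsilon>
  proof
    show "closed {x. \<phi> x \<le> y}" for y
      by (rule closed_sublevel[OF assms(1) \<phi>(2)])
    show "8 * \<epsilon> * B \<le> 1"
    proof -
      have "16 * \<epsilon> * B < 1" "0 \<le> \<epsilon> * B"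
        using assms(3,4) \<phi>(3) by (simp_all add: field_simps LSCC_coercive_def)
      then show ?thesis by linarith
    qed
  qed (use \<phi> assms(3) in \<open>auto simp: proper_fun_def LSCC_coercive_def\<close>)
  show ?thesis
    using value_slope_upper_gradient minimizer_maximal_slope by blast
qed

end
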